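(* Let $G=\mathbb{Z}/p\mathbb{Z}$ with $p\geq 2$ a prime, let $A,B\subseteq G$ be nonempty subsets with $A+B\neq G$, and set $C=-\,(G\setminus(A+B))$. Let $r$ be the integer with $|A+B|=|A|+|B|+r$. Suppose $|A|\geq|B|$, $$\frac{9253}{1963}\Big(10r+26.5+\sqrt{2r+\tfrac{17}{4}}\Big)\leq p,$$ and $$|A+B|=|A|+|B|+r\leq\min\Big\{|A|+\big(1+\tfrac19\big)|B|-3,\; p-9(r+3)\Big\}.$$ Then there are arithmetic progressions $P_A,P_B,P_C\subseteq G$, all having a common difference, such that $X\subseteq P_X$ and $|P_X|\leq|X|+r+1$ for all $X\in\{A,B,C\}$.
   Context: An arithmetic progression in $G$ with difference $d$ is a set $\{a,a+d,\dots,a+(n-1)d\}$. *)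

theory Defs
  imports
    Complex_Main
    "HOL-Library.Set_Algebras"
    "Berlekamp_Zassenhaus.Finite_Field"
begin

text \<open>The group of integers modulo a prime is the additive group of the type \<open>'p mod_ring\<close> with
  \<open>'p :: prime_card\<close> (a type of prime cardinality); sumsets \<open>A + B\<close> are those of
  \<^theory>\<open>HOL-Library.Set_Algebras\<close>.\<close>

text \<open>Here \<open>of_nat i * d\<close> is the \<open>i\<close>-fold sum of \<open>d\<close>. As usual, the terms need not be distinct:
  \<open>d = 0\<close> is not excluded, and the length \<open>n\<close> need not equal the cardinality of \<open>P\<close>.\<close>

definition arith_progression :: "'a::ring_1 \<Rightarrow> 'a set \<Rightarrow> bool" where
  "arith_progression d P \<longleftrightarrow>
     (\<exists>a n. n \<ge> 1 \<and> P = (\<lambda>i. a + of_nat i * d) ` {0..n - 1})"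

end

(*
  Two isoperimetric steps reduce the problem to small sets.  Put k = 9 (r + 3).  A k-atom X of B (a
  smallest set with at least k elements minimizing |X + B| - |X|) and a k-atom Y of X have between k
  and 11 (r + 3) elements and |X + Y| <= |X| + |Y| + r.  Parseval's identity yields a large
  simultaneous Fourier coefficient of X and Y, so after a dilation most of both sets lies in half
  circles, where addition behaves as in the integers and Freiman's 3k-4 theorem applies.  Hence X
  lies in a progression with at most |X| + r + 1 elements.  Such structure passes from one summand of
  a pair with small sumset to the other, first from X to B and then from B to A and to C.
  The 3k-4 theorem for integer sets is obtained by reducing modulo the diameter of the wider set and
  applying Mann's theorem there.
*)
theory Submission
  imports Defs "HOL-Analysis.Analysis"
begin

section \<open>Periodic sets of integers\<close>

text \<open>The lower bound on \<open>p\<close> depends on \<open>r\<close> only, while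
  \<open>A\<close> and \<open>B\<close> may be as large as the complement of \<open>A + B\<close>
  permits, and the Fourier argument needs sets that are small compared with \<open>p\<close>. Atoms
  remove this obstacle: they keep the excess of \<open>|X + Y|\<close> over \<open>|X| + |Y|\<close>
  at most \<open>r\<close>, but their size is linear in \<open>r\<close>, so
  \<open>p >= 47 (r + 3) - 10\<close> suffices for them. The two bounds on \<open>|A + B|\<close>
  are what makes the threshold \<open>k = 9 (r + 3)\<close> available: the first rearranges to
  \<open>|B| >= k\<close>, the second says that at least \<open>k\<close> residues lie outside
  \<open>A + B\<close>. Sizes between \<open>9 (r + 3)\<close> and \<open>11 (r + 3)\<close> also
  make the numerical estimate for the Fourier coefficient close. \<open>C\<close> enters by duality:
  \<open>B + C\<close> avoids \<open>- A\<close>, so \<open>(B, C)\<close> is again a pair with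
  excess at most \<open>r\<close>. A single dilation serves all three sets, hence the common
  difference. Subsets of the cyclic group are kept as periodic sets of integers, so that passing to
  integer sets, where the 3k-4 theorem lives, is just intersecting with a window.\<close>

text \<open>A subset of \<open>\<int>/n\<close> is represented by its preimage in \<open>\<int>\<close>: \<open>mu n X\<close> is then its size and
  \<open>ext n A\<close> the preimage of the image of \<open>A\<close>.\<close>

definition per :: "int \<Rightarrow> int set \<Rightarrow> bool" where
  "per n X \<longleftrightarrow> (\<forall>x. x + n \<in> X \<longleftrightarrow> x \<in> X)"

definition mu :: "int \<Rightarrow> int set \<Rightarrow> nat" where
  "mu n X = card (X \<inter> {0..<n})"

definition ext :: "int \<Rightarrow> int set \<Rightarrow> int set" where
  "ext n A = {x. \<exists>a\<in>A. x mod n = a mod n}"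

lemma per_add_mult:
  assumes "per n X" shows "x + k * n \<in> X \<longleftrightarrow> x \<in> X"
proof -
  have nat: "x + int j * n \<in> X \<longleftrightarrow> x \<in> X" for x j
  proof (induction j)
    case (Suc j)
    have "x + int (Suc j) * n = (x + int j * n) + n" by (simp add: algebra_simps)
    then show ?case using Suc assms by (metis per_def)
  qed simp
  show ?thesis
  proof (cases "k \<ge> 0")
    case True then show ?thesis using nat[of x "nat k"] by simp
  next
    case False
    then show ?thesis using nat[of "x + k * n" "nat (- k)"] by (simp add: algebra_simps)
  qed
qed

lemma per_cong:
  assumes "per n X" "x mod n = y mod n" shows "x \<in> X \<longleftrightarrow> y \<in> X"
proof -
  have "x = y + (x div n - y div n) * n"
    unfolding left_diff_distrib using assms(2) div_mult_mod_eq[of x n] div_mult_mod_eq[of y n] by linarith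
  then show ?thesis using per_add_mult[OF assms(1)] by metis
qed

lemma per_mod: "per n X \<Longrightarrow> x mod n \<in> X \<longleftrightarrow> x \<in> X"
  by (rule per_cong[of n]) auto

lemma per_dvd: "per n X \<Longrightarrow> n dvd x - y \<Longrightarrow> x \<in> X \<longleftrightarrow> y \<in> X"
  by (rule per_cong) (auto simp: mod_eq_dvd_iff)

lemma per_dvd_per: "per g X \<Longrightarrow> g dvd n \<Longrightarrow> per n X"
  unfolding per_def[of n] using per_dvd[of g X] by simp

lemma perI: "(\<And>x y. x \<in> X \<Longrightarrow> n dvd x - y \<Longrightarrow> y \<in> X) \<Longrightarrow> per n X"
  unfolding per_def
proof (intro allI iffI)
  fix x assume *: "\<And>x y. x \<in> X \<Longrightarrow> n dvd x - y \<Longrightarrow> y \<in> X"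
  show "x \<in> X" if "x + n \<in> X" using *[OF that, of x] by simp
  show "x + n \<in> X" if "x \<in> X" using *[OF that, of "x + n"] by simp
qed

lemma per_Un: "per n X \<Longrightarrow> per n Y \<Longrightarrow> per n (X \<union> Y)"
  and per_Int: "per n X \<Longrightarrow> per n Y \<Longrightarrow> per n (X \<inter> Y)"
  and per_Diff: "per n X \<Longrightarrow> per n Y \<Longrightarrow> per n (X - Y)"
  and per_Compl: "per n X \<Longrightarrow> per n (- X)"
  and per_UNIV: "per n UNIV" and per_empty: "per n {}"
  by (auto simp: per_def)

lemma mem_translate: "x \<in> (+) (a::int) ` X \<longleftrightarrow> x - a \<in> X"
proof
  assume "x - a \<in> X"
  then have "a + (x - a) \<in> (+) a ` X" by (rule imageI)
  then show "x \<in> (+) a ` X" by simp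
qed auto

lemma per_translate: "per n X \<Longrightarrow> per n ((+) a ` X)"
proof -
  assume X: "per n X"
  have "x + n - a \<in> X \<longleftrightarrow> x - a \<in> X" for x
    using per_add_mult[OF X, of "x - a" 1] by (simp add: algebra_simps)
  then show ?thesis by (simp add: per_def mem_translate)
qed

lemma mem_uminus: "(x::int) \<in> uminus ` X \<longleftrightarrow> - x \<in> X"
  by (metis add.inverse_inverse image_iff)

lemma per_uminus: "per n X \<Longrightarrow> per n (uminus ` X)"
proof -
  assume X: "per n X"
  have "- (x + n) \<in> X \<longleftrightarrow> - x \<in> X" for x
    using per_add_mult[OF X, of "- x" "-1"] by (simp add: algebra_simps)
  then show ?thesis unfolding per_def mem_uminus by blast
qed

lemma per_plus: "per n X \<Longrightarrow> per n (X + Y)"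
proof (rule perI)
  fix x y assume "per n X" and xy: "x \<in> X + Y" "n dvd x - y"
  from xy(1) obtain a b where ab: "a \<in> X" "b \<in> Y" "x = a + b" by (blast elim: set_plus_elim)
  then have e: "a - (y - b) = x - y" by simp
  have "n dvd a - (y - b)" unfolding e by (rule xy(2))
  then have "y - b \<in> X" using per_dvd[OF \<open>per n X\<close>] ab(1) by blast
  then have "(y - b) + b \<in> X + Y" using ab(2) by (rule set_plus_intro)
  then show "y \<in> X + Y" by simp
qed

lemma per_multiples: "per n {x. n dvd x}"
  by (simp add: per_def)

lemma per_ext: "per n (ext n A)"
  by (simp add: per_def ext_def)

lemma ext_superset: "A \<subseteq> ext n A" by (auto simp: ext_def)

lemma ext_subset: "per n X \<Longrightarrow> A \<subseteq> X \<Longrightarrow> ext n A \<subseteq> X"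
  unfolding ext_def using per_cong by blast

lemma mu_eq_card_residues:
  assumes "n > 0" "per n X" shows "mu n X = card ((\<lambda>x. x mod n) ` X)"
proof -
  have "X \<inter> {0..<n} = (\<lambda>x. x mod n) ` X"
  proof
    show "X \<inter> {0..<n} \<subseteq> (\<lambda>x. x mod n) ` X" by (force intro: rev_image_eqI)
    show "(\<lambda>x. x mod n) ` X \<subseteq> X \<inter> {0..<n}" using assms by (auto simp: per_mod)
  qed
  then show ?thesis by (simp add: mu_def)
qed

lemma mu_ext:
  assumes "n > 0" shows "mu n (ext n A) = card ((\<lambda>x. x mod n) ` A)"
proof -
  have "(\<lambda>x. x mod n) ` ext n A = (\<lambda>x. x mod n) ` A" by (auto simp: ext_def)
  then show ?thesis using mu_eq_card_residues[OF assms per_ext] by simp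
qed

lemma mu_mono: "X \<subseteq> Y \<Longrightarrow> mu n X \<le> mu n Y"
  unfolding mu_def by (rule card_mono) auto

lemma mu_le: "n > 0 \<Longrightarrow> int (mu n X) \<le> n"
proof -
  assume "n > 0"
  have "card (X \<inter> {0..<n}) \<le> card {0..<n}" by (rule card_mono) auto
  with \<open>n > 0\<close> show ?thesis by (simp add: mu_def)
qed

lemma mu_UNIV: "n > 0 \<Longrightarrow> int (mu n UNIV) = n"
  by (simp add: mu_def)

lemma mu_empty [simp]: "mu n {} = 0" by (simp add: mu_def)

lemma mu_disjoint: "X \<inter> Y = {} \<Longrightarrow> mu n (X \<union> Y) = mu n X + mu n Y"
  unfolding mu_def by (subst card_Un_disjoint[symmetric]) (auto simp: Int_Un_distrib2 intro!: arg_cong[of _ _ card])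

lemma mu_Un_Int: "mu n (X \<union> Y) + mu n (X \<inter> Y) = mu n X + mu n Y"
proof -
  have "(X \<union> Y) \<inter> {0..<n} = X \<inter> {0..<n} \<union> Y \<inter> {0..<n}" "(X \<inter> Y) \<inter> {0..<n} = (X \<inter> {0..<n}) \<inter> (Y \<inter> {0..<n})"
    by auto
  then show ?thesis unfolding mu_def by (metis card_Un_Int finite_Int finite_atLeastLessThan_int)
qed

lemma mu_Diff: "Y \<subseteq> X \<Longrightarrow> mu n (X - Y) + mu n Y = mu n X"
  using mu_disjoint[of "X - Y" Y n] by (simp add: Un_absorb2 Diff_disjoint inf_commute)

lemma mu_split: "mu n X = mu n (X \<inter> Y) + mu n (X - Y)"
  using mu_Diff[of "X \<inter> Y" X n] by (simp add: Diff_Int2 Diff_Int)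

lemma mu_Compl: "n > 0 \<Longrightarrow> int (mu n (- X)) = n - int (mu n X)"
  using mu_disjoint[of X "- X" n] mu_UNIV[of n] by simp

lemma mu_pos_iff:
  assumes "n > 0" "per n X" shows "mu n X > 0 \<longleftrightarrow> X \<noteq> {}"
  unfolding mu_eq_card_residues[OF assms]
proof -
  have "finite ((\<lambda>x. x mod n) ` X)"
    by (rule finite_subset[of _ "{0..<n}"]) (use assms in auto)
  then show "0 < card ((\<lambda>x. x mod n) ` X) \<longleftrightarrow> X \<noteq> {}" by (auto simp: card_gt_0_iff)
qed

lemma mu_eq_imp_eq:
  assumes "n > 0" "per n X" "per n Y" "X \<subseteq> Y" "mu n Y \<le> mu n X" shows "X = Y"
proof -
  have "mu n (Y - X) = 0" using mu_Diff[OF assms(4), of n] assms(5) by simp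
  then have "Y - X = {}" using mu_pos_iff[OF assms(1) per_Diff[OF assms(3,2)]] by simp
  with assms(4) show ?thesis by auto
qed

lemma card_le_mu:
  assumes "n > 0" "per n Y" "\<And>x. x \<in> A \<Longrightarrow> f x \<in> Y"
    "\<And>x y. x \<in> A \<Longrightarrow> y \<in> A \<Longrightarrow> f x mod n = f y mod n \<Longrightarrow> x = y"
  shows "card A \<le> mu n Y"
  unfolding mu_def
proof (rule card_inj_on_le[of "\<lambda>x. f x mod n"])
  show "inj_on (\<lambda>x. f x mod n) A" using assms(4) by (auto simp: inj_on_def)
  show "(\<lambda>x. f x mod n) ` A \<subseteq> Y \<inter> {0..<n}" using assms by (auto simp: per_mod)
qed simp

lemma mu_le_mu:
  assumes "n > 0" "per n Y" "\<And>x. x \<in> X \<Longrightarrow> f x \<in> Y"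
    "\<And>x y. x \<in> X \<Longrightarrow> y \<in> X \<Longrightarrow> n dvd f x - f y \<Longrightarrow> n dvd x - y"
  shows "mu n X \<le> mu n Y"
  unfolding mu_def[of n X]
proof (rule card_le_mu[of n Y _ f])
  fix x y assume *: "x \<in> X \<inter> {0..<n}" "y \<in> X \<inter> {0..<n}" "f x mod n = f y mod n"
  then have "n dvd f x - f y" by (simp add: mod_eq_dvd_iff)
  then have "n dvd x - y" using assms(4) * by blast
  then have "x mod n = y mod n" by (simp add: mod_eq_dvd_iff)
  then show "x = y" using * by simp
qed (use assms in auto)

lemma mu_le_card:
  assumes "finite A" "\<And>x. x \<in> X \<Longrightarrow> \<exists>a\<in>A. x mod n = a mod n"
  shows "mu n X \<le> card A"
proof -
  have "X \<inter> {0..<n} \<subseteq> (\<lambda>x. x mod n) ` A"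
  proof
    fix x assume "x \<in> X \<inter> {0..<n}"
    then obtain a where "a \<in> A" "x mod n = a mod n" using assms(2) by blast
    moreover have "x mod n = x" using \<open>x \<in> X \<inter> {0..<n}\<close> by simp
    ultimately show "x \<in> (\<lambda>x. x mod n) ` A" by force
  qed
  then have "mu n X \<le> card ((\<lambda>x. x mod n) ` A)" unfolding mu_def by (intro card_mono) (use assms(1) in auto)
  also have "\<dots> \<le> card A" by (rule card_image_le[OF assms(1)])
  finally show ?thesis .
qed

lemma mu_translate:
  assumes "n > 0" "per n X" shows "mu n ((+) a ` X) = mu n X"
proof (rule antisym)
  show "mu n ((+) a ` X) \<le> mu n X"
    by (rule mu_le_mu[of n X _ "\<lambda>x. x - a"]) (use assms in \<open>auto simp: mem_translate\<close>)
  show "mu n X \<le> mu n ((+) a ` X)"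
    by (rule mu_le_mu[of n _ _ "\<lambda>x. a + x"]) (use assms in \<open>auto simp: per_translate\<close>)
qed

lemma mu_uminus:
  assumes "n > 0" "per n X" shows "mu n (uminus ` X) = mu n X"
proof -
  have d: "n dvd x - y" if "n dvd - x - - y" for x y
    using that dvd_diff_commute[of n x y] by simp
  have "mu n (uminus ` X) \<le> mu n X"
    by (rule mu_le_mu[of n X _ uminus]) (use assms d in \<open>auto simp: mem_uminus\<close>)
  moreover have "mu n X \<le> mu n (uminus ` X)"
    by (rule mu_le_mu[of n _ _ uminus]) (use assms d in \<open>auto simp: mem_uminus per_uminus\<close>)
  ultimately show ?thesis by simp
qed

lemma mu_window:
  assumes "n > 0" "per n X" shows "card (X \<inter> {a..<a+n}) = mu n X"
proof (rule antisym)
  have w: "y = z" if "y \<in> {a..<a+n}" "z \<in> {a..<a+n}" "y mod n = z mod n" for y z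
  proof -
    have "n dvd y - z" using that by (simp add: mod_eq_dvd_iff)
    moreover have "\<bar>y - z\<bar> < n" using that by auto
    ultimately show ?thesis using dvd_imp_le_int[of "y - z" n] assms(1) by force
  qed
  show "card (X \<inter> {a..<a+n}) \<le> mu n X"
    by (rule card_le_mu[of n X _ id]) (use assms w in auto)
  show "mu n X \<le> card (X \<inter> {a..<a+n})"
  proof (rule mu_le_card)
    fix x assume "x \<in> X"
    define y where "y = a + (x - a) mod n"
    have "y mod n = x mod n" by (simp add: y_def mod_simps)
    moreover have "y \<in> {a..<a+n}" using assms(1) by (simp add: y_def)
    moreover have "y \<in> X" using per_cong[OF assms(2), of x y] \<open>x \<in> X\<close> \<open>y mod n = x mod n\<close> by simp
    ultimately show "\<exists>a\<in>X \<inter> {a..<a + n}. x mod n = a mod n" by (intro bexI[of _ y]) auto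
  qed simp
qed

lemma mu_plus_ge:
  assumes "n > 0" "per n X" "per n Y" "X \<noteq> {}" shows "mu n Y \<le> mu n (X + Y)"
proof -
  obtain a where "a \<in> X" using assms by auto
  then have "(+) a ` Y \<subseteq> X + Y" by (blast intro: set_plus_intro)
  then show ?thesis using mu_mono[of "(+) a ` Y" "X + Y" n] mu_translate[OF assms(1,3)] by simp
qed

lemma pigeonhole_sum:
  assumes "n > 0" "per n X" "per n Y" "int (mu n X) + int (mu n Y) > n" shows "X + Y = UNIV"
proof (rule ccontr)
  assume "X + Y \<noteq> UNIV"
  then obtain z where z: "z \<notin> X + Y" by auto
  have "X \<inter> ((+) z ` uminus ` Y) = {}"
  proof (rule ccontr)
    assume "X \<inter> ((+) z ` uminus ` Y) \<noteq> {}"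
    then obtain x where x: "x \<in> X" "x \<in> (+) z ` uminus ` Y" by blast
    then have "z - x \<in> Y" unfolding mem_translate mem_uminus by simp
    then have "x + (z - x) \<in> X + Y" using x(1) by (rule set_plus_intro[rotated])
    then show False using z by simp
  qed
  then have "mu n (X \<union> ((+) z ` uminus ` Y)) = mu n X + mu n Y"
    using assms by (simp add: mu_disjoint mu_translate mu_uminus per_uminus)
  then show False using mu_le[of n "X \<union> ((+) z ` uminus ` Y)"] assms by simp
qed

section \<open>Atoms and Mann's theorem\<close>

text \<open>The last clause leaves at least \<open>k\<close> residues outside \<open>X + Y\<close>.
  Hence the negated complement of \<open>X + Y\<close> has at least \<open>k\<close> elements, and
  by \<open>dual_sumset\<close> it is again admissible when \<open>X\<close> is;
  \<open>atom_exists\<close> rests on this symmetry.\<close>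

definition admissible :: "int \<Rightarrow> nat \<Rightarrow> int set \<Rightarrow> int set \<Rightarrow> bool" where
  "admissible n k Y X \<longleftrightarrow> per n X \<and> k \<le> mu n X \<and> int (mu n (X + Y)) + int k \<le> n"

lemma plus_Int_subset: "(X \<inter> X') + Y \<subseteq> (X + Y) \<inter> (X' + (Y :: int set))"
  by (auto elim!: set_plus_elim intro: set_plus_intro)

lemma plus_Un: "(X \<union> X') + Y = (X + Y) \<union> (X' + (Y :: int set))"
  by (auto elim!: set_plus_elim intro: set_plus_intro)

lemma translate_plus: "((+) d ` X) + Y = (+) d ` (X + (Y :: int set))"
proof (rule Set.set_eqI)
  fix z show "z \<in> (+) d ` X + Y \<longleftrightarrow> z \<in> (+) d ` (X + Y)"
  proof
    assume "z \<in> (+) d ` X + Y"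
    then obtain x y where "x \<in> X" "y \<in> Y" "z = d + x + y" by (auto elim!: set_plus_elim)
    then show "z \<in> (+) d ` (X + Y)" by (auto simp: add.assoc intro: imageI set_plus_intro)
  next
    assume "z \<in> (+) d ` (X + Y)"
    then obtain x y where "x \<in> X" "y \<in> Y" "z = d + (x + y)" by (auto elim!: set_plus_elim)
    moreover then have "(d + x) + y \<in> (+) d ` X + Y" by (intro set_plus_intro imageI)
    ultimately show "z \<in> (+) d ` X + Y" by (simp add: add.assoc)
  qed
qed

lemma mu_sumset_Un_le:
  assumes "n > 0" "per n X"
  shows "mu n ((X \<union> (+) d ` X) + Y) + mu n ((X \<inter> (+) d ` X) + Y) \<le> 2 * mu n (X + Y)"
proof -
  have "mu n ((X \<inter> (+) d ` X) + Y) \<le> mu n ((X + Y) \<inter> ((+) d ` X + Y))"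
    by (rule mu_mono[OF plus_Int_subset])
  moreover have "mu n ((+) d ` X + Y) = mu n (X + Y)"
    unfolding translate_plus by (rule mu_translate[OF assms(1) per_plus[OF assms(2)]])
  ultimately show ?thesis
    using mu_Un_Int[of n "X + Y" "(+) d ` X + Y"] by (simp add: plus_Un)
qed

text \<open>\<open>- c + y = - x\<close> would mean \<open>c = x + y\<close>. The negated complement
  of \<open>X + Y\<close> thus has a controlled sumset with the same \<open>Y\<close>; this serves
  both the atoms and the set \<open>C\<close> of the theorem.\<close>

lemma dual_sumset: "uminus ` (- (X + Y)) + Y \<subseteq> - uminus ` (X :: int set)"
proof
  fix z assume "z \<in> uminus ` (- (X + Y)) + Y"
  then obtain c y where c: "c \<notin> X + Y" "y \<in> Y" "z = - c + y" by (auto elim!: set_plus_elim)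
  have "- z \<notin> X"
  proof
    assume "- z \<in> X"
    then have "- z + y \<in> X + Y" using c(2) by (rule set_plus_intro)
    then show False using c by simp
  qed
  then show "z \<in> - uminus ` X" by (simp add: mem_uminus)
qed

text \<open>Minimize \<open>|X + Y| - |X|\<close> first and \<open>|X|\<close> second. The minimized
  function is submodular, so if \<open>X\<close> and a translate share at least \<open>k\<close>
  elements, their intersection is a minimizer as well and must be all of \<open>X\<close>. This
  needs the union to be admissible too.\<close>

lemma atom_exists:
  assumes n: "n > 0" and Y: "per n Y" and X0: "admissible n k Y X0" and k: "k \<ge> 1"
  obtains X where "admissible n k Y X"
    "\<And>X'. admissible n k Y X' \<Longrightarrow> mu n (X + Y) + mu n X' \<le> mu n (X' + Y) + mu n X"
    "\<And>d. (+) d ` X = X \<or> mu n (X \<inter> (+) d ` X) < k"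
proof -
  define f where "f X = int (mu n (X + Y)) - int (mu n X)" for X
  have fpos: "f X + n \<ge> 0" for X using mu_le[OF n, of X] by (simp add: f_def)
  obtain X1 where X1: "admissible n k Y X1" "\<And>X. admissible n k Y X \<Longrightarrow> nat (f X1 + n) \<le> nat (f X + n)"
    using ex_has_least_nat[of "admissible n k Y" X0 "\<lambda>X. nat (f X + n)"] X0 by blast
  obtain X where X: "admissible n k Y X" "f X = f X1"
    and Xmin: "\<And>X'. admissible n k Y X' \<Longrightarrow> f X' = f X1 \<Longrightarrow> mu n X \<le> mu n X'"
    using ex_has_least_nat[of "\<lambda>X. admissible n k Y X \<and> f X = f X1" X1 "mu n"] X1 by blast
  have fmin: "f X \<le> f X'" if "admissible n k Y X'" for X'
    using iffD1[OF nat_le_eq_zle[OF disjI2[OF fpos]] X1(2)[OF that]] X(2) by simp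
  have perX: "per n X" and kX: "k \<le> mu n X" and kXY: "int (mu n (X + Y)) + int k \<le> n"
    using X(1) by (auto simp: admissible_def)
  define Z where "Z = uminus ` (- (X + Y))"
  have perZ: "per n Z" unfolding Z_def by (intro per_uminus per_Compl per_plus perX)
  have muZ: "int (mu n Z) = n - int (mu n (X + Y))"
    unfolding Z_def using mu_uminus[OF n per_Compl[OF per_plus[OF perX]]] mu_Compl[OF n] by simp
  have muZY: "int (mu n (Z + Y)) \<le> n - int (mu n X)"
    using mu_mono[OF dual_sumset, of n X Y] mu_Compl[OF n, of "uminus ` X"] mu_uminus[OF n perX]
    by (simp add: Z_def)
  have admZ: "admissible n k Y Z" using perZ muZ muZY kX kXY by (simp add: admissible_def)
  have "f Z = f X" using fmin[OF admZ] muZ muZY by (simp add: f_def)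
  \<comment> \<open>The dual set attains the same minimum, so it cannot be smaller than
    \<open>X\<close>, that is \<open>|X| <= n - |X + Y|\<close>. This is the room that makes the
    union of two translates admissible.\<close>
  then have XZ: "mu n X \<le> mu n Z" using Xmin[OF admZ] X(2) by simp
  show thesis
  proof (rule that)
    show "admissible n k Y X" by (rule X)
    show "mu n (X + Y) + mu n X' \<le> mu n (X' + Y) + mu n X" if "admissible n k Y X'" for X'
      using fmin[OF that] by (simp add: f_def)
    fix d
    let ?X' = "(+) d ` X"
    have perX': "per n ?X'" by (rule per_translate[OF perX])
    show "?X' = X \<or> mu n (X \<inter> ?X') < k"
    proof (rule disjCI)
      assume "\<not> mu n (X \<inter> ?X') < k"
      then have kI: "k \<le> mu n (X \<inter> ?X')" by simp
      have "mu n ((X \<inter> ?X') + Y) \<le> mu n (X + Y)" by (rule mu_mono) (use plus_Int_subset in blast)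
      then have admI: "admissible n k Y (X \<inter> ?X')"
        using kI kXY per_Int[OF perX perX'] by (simp add: admissible_def)
      have sub: "mu n ((X \<union> ?X') + Y) + mu n ((X \<inter> ?X') + Y) \<le> 2 * mu n (X + Y)"
        by (rule mu_sumset_Un_le[OF n perX])
      have un: "mu n (X \<union> ?X') + mu n (X \<inter> ?X') = 2 * mu n X"
        using mu_Un_Int[of n X ?X'] mu_translate[OF n perX] by simp
      have admU: "admissible n k Y (X \<union> ?X')"
        unfolding admissible_def
      proof (intro conjI)
        show "per n (X \<union> ?X')" by (rule per_Un[OF perX perX'])
        show "k \<le> mu n (X \<union> ?X')" using kX mu_mono[of X "X \<union> ?X'" n] by simp
        show "int (mu n ((X \<union> ?X') + Y)) + int k \<le> n"
          using sub un fmin[OF admI] XZ muZ kI unfolding f_def by linarith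
      qed
      have "f (X \<inter> ?X') \<le> f X" using fmin[OF admU] sub un unfolding f_def by linarith
      then have "f (X \<inter> ?X') = f X1" using fmin[OF admI] X(2) by simp
      then have "mu n X \<le> mu n (X \<inter> ?X')" by (rule Xmin[OF admI])
      then have "X \<inter> ?X' = X" by (intro mu_eq_imp_eq[OF n _ perX]) (auto simp: per_Int perX perX')
      then have "X = ?X'" by (intro mu_eq_imp_eq[OF n perX perX']) (auto simp: mu_translate[OF n perX])
      then show "?X' = X" by simp
    qed
  qed
qed

lemma translate_invariant_imp_per: "(+) d ` X = X \<Longrightarrow> per d X"
  unfolding per_def
proof
  fix x assume e: "(+) d ` X = X"
  show "x + d \<in> X \<longleftrightarrow> x \<in> X" using mem_translate[of "x + d" d X] unfolding e by simp
qed

text \<open>Invariance under its own elements makes \<open>X\<close> a subgroup; by division with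
  remainder its least positive element generates it.\<close>

lemma subgroup_of_translate_invariant:
  assumes n: "n > 0" and X: "per n X" "0 \<in> X" and inv: "\<And>d. d \<in> X \<Longrightarrow> (+) (- d) ` X = X"
  obtains g where "g > 0" "g dvd n" "X = {x. g dvd x}"
proof -
  have nX: "n \<in> X" using X unfolding per_def by (metis add_0)
  define g where "g = int (LEAST m. m > 0 \<and> int m \<in> X)"
  have "nat n > 0 \<and> int (nat n) \<in> X" using n nX by simp
  then have g: "(LEAST m. m > 0 \<and> int m \<in> X) > 0 \<and> int (LEAST m. m > 0 \<and> int m \<in> X) \<in> X"
    by (rule LeastI)
  have gmin: "int m \<notin> X" if "0 < m" "int m < g" for m
    using not_less_Least[of m "\<lambda>m. m > 0 \<and> int m \<in> X"] that by (auto simp: g_def)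
  have gX: "g > 0" "g \<in> X" using g by (auto simp: g_def)
  have perd: "per d X" if "d \<in> X" for d
  proof -
    have "per (- d) X" by (rule translate_invariant_imp_per[OF inv[OF that]])
    then have "x + d \<in> X \<longleftrightarrow> x \<in> X" for x using per_add_mult[of "- d" X x "-1"] by simp
    then show ?thesis by (simp add: per_def)
  qed
  have XH: "X = {x. g dvd x}"
  proof
    show "X \<subseteq> {x. g dvd x}"
    proof
      fix x assume "x \<in> X"
      then have *: "x mod g \<in> X" using per_mod[OF perd[OF gX(2)]] by simp
      have "x mod g = 0"
      proof (rule ccontr)
        assume "x mod g \<noteq> 0"
        then have "0 < nat (x mod g)" "int (nat (x mod g)) < g" "int (nat (x mod g)) = x mod g"
          using gX(1) pos_mod_sign[of g x] pos_mod_bound[of g x] by linarith+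
        then show False using gmin * by metis
      qed
      then show "x \<in> {x. g dvd x}" by auto
    qed
    show "{x. g dvd x} \<subseteq> X"
      using per_dvd[OF perd[OF gX(2)], of _ 0] X(2) by auto
  qed
  show thesis by (rule that[OF gX(1) _ XH]) (use nX XH in auto)
qed

text \<open>Mann's theorem: the smallest set minimizing \<open>|X + T| - |X|\<close> is a subgroup.\<close>

lemma mann:
  assumes n: "n > 0" and T: "per n T" and S: "per n S" "S \<noteq> {}" "S + T \<noteq> UNIV"
  obtains g where "g > 0" "g dvd n" "{x. g dvd x} + T \<noteq> UNIV"
    "\<And>X. per n X \<Longrightarrow> X \<noteq> {} \<Longrightarrow> X + T \<noteq> UNIV \<Longrightarrow>
      mu n X + mu n ({x. g dvd x} + T) \<le> mu n (X + T) + mu n {x. g dvd x}"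
proof -
  have adm: "admissible n 1 T X \<longleftrightarrow> per n X \<and> X \<noteq> {} \<and> X + T \<noteq> UNIV" for X
  proof -
    have "int (mu n (X + T)) + 1 \<le> n \<longleftrightarrow> X + T \<noteq> UNIV" if "per n X"
    proof -
      have "int (mu n (- (X + T))) = n - int (mu n (X + T))" by (rule mu_Compl[OF n])
      moreover have "mu n (- (X + T)) > 0 \<longleftrightarrow> - (X + T) \<noteq> {}"
        by (rule mu_pos_iff[OF n per_Compl[OF per_plus[OF that]]])
      ultimately show ?thesis by auto
    qed
    moreover have "1 \<le> mu n X \<longleftrightarrow> X \<noteq> {}" if "per n X" using mu_pos_iff[OF n that] by auto
    ultimately show ?thesis by (auto simp: admissible_def)
  qed
  \<comment> \<open>For \<open>k = 1\<close> the atom property says that translates are equal or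
    disjoint, so the atom is a coset.\<close>
  obtain X where X: "admissible n 1 T X"
    "\<And>X'. admissible n 1 T X' \<Longrightarrow> mu n (X + T) + mu n X' \<le> mu n (X' + T) + mu n X"
    "\<And>d. (+) d ` X = X \<or> mu n (X \<inter> (+) d ` X) < 1"
    by (rule atom_exists[OF n T, of 1 S]) (use S adm in auto)
  have perX: "per n X" and "X \<noteq> {}" and XT: "X + T \<noteq> UNIV" using X(1) adm by auto
  then obtain a where a: "a \<in> X" by auto
  define H where "H = (+) (- a) ` X"
  have perH: "per n H" unfolding H_def by (rule per_translate[OF perX])
  have muH: "mu n H = mu n X" unfolding H_def by (rule mu_translate[OF n perX])
  have HT: "H + T = (+) (- a) ` (X + T)" unfolding H_def by (rule translate_plus)
  have muHT: "mu n (H + T) = mu n (X + T)" unfolding HT by (rule mu_translate[OF n per_plus[OF perX]])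
  have H0: "0 \<in> H" using a by (simp add: H_def)
  have "(+) (- d) ` H = H" if "d \<in> H" for d
  proof -
    have "d - (- a) \<in> X" using that unfolding H_def mem_translate .
    then have "a \<in> X \<inter> (+) (- d) ` X" using a unfolding mem_translate Int_iff by (simp add: add.commute)
    then have "mu n (X \<inter> (+) (- d) ` X) > 0"
      using mu_pos_iff[OF n per_Int[OF perX per_translate[OF perX]]] by blast
    then have "(+) (- d) ` X = X" using X(3)[of "- d"] by auto
    moreover have "(+) (- d) ` H = (+) (- a) ` (+) (- d) ` X" by (simp add: H_def image_image algebra_simps)
    ultimately show ?thesis by (simp add: H_def)
  qed
  from subgroup_of_translate_invariant[OF n perH H0 this]
  obtain g where g: "g > 0" "g dvd n" "H = {x. g dvd x}" by blast
  have "H + T \<noteq> UNIV"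
  proof
    assume "H + T = UNIV"
    then have "z + (- a) \<in> (+) (- a) ` (X + T)" for z using HT by auto
    then have "z \<in> X + T" for z unfolding mem_translate by simp
    then show False using XT by blast
  qed
  moreover have "mu n X' + mu n (H + T) \<le> mu n (X' + T) + mu n H"
    if "per n X'" "X' \<noteq> {}" "X' + T \<noteq> UNIV" for X'
    using X(2)[of X'] adm that muH muHT by simp
  ultimately show thesis using that[OF g(1,2)] g(3) by blast
qed

text \<open>For a prime modulus the subgroup in Mann's theorem is trivial: \<open>g = 1\<close>
  would make its sum with \<open>Y\<close> everything, so \<open>g = p\<close> and the subgroup is a
  single residue class.\<close>

lemma cauchy_davenport:
  assumes p: "prime p" and X: "per p X" "X \<noteq> {}" and Y: "per p Y" "Y \<noteq> {}" and ne: "X + Y \<noteq> UNIV"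
  shows "mu p X + mu p Y \<le> mu p (X + Y) + 1"
proof -
  have p0: "p > 0" using p prime_gt_0_int by blast
  obtain g where g: "g > 0" "g dvd p" "{x. g dvd x} + Y \<noteq> UNIV"
    "\<And>X. per p X \<Longrightarrow> X \<noteq> {} \<Longrightarrow> X + Y \<noteq> UNIV \<Longrightarrow>
      mu p X + mu p ({x. g dvd x} + Y) \<le> mu p (X + Y) + mu p {x. g dvd x}"
    using mann[OF p0 Y(1) X ne] by blast
  have "g \<noteq> 1"
  proof
    assume "g = 1"
    obtain y where "y \<in> Y" using Y(2) by auto
    then have "(z - y) + y \<in> {x. g dvd x} + Y" for z
      by (intro set_plus_intro) (auto simp: \<open>g = 1\<close>)
    then show False using g(3) by auto
  qed
  then have gp: "g = p" using g(1,2) p by (metis order_less_imp_le prime_int_iff)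
  have "mu p {x. p dvd x} \<le> card {0::int}"
    by (rule mu_le_card) auto
  then have "mu p {x. g dvd x} \<le> 1" by (simp add: gp)
  moreover have "mu p Y \<le> mu p ({x. g dvd x} + Y)"
    by (rule mu_plus_ge[OF p0 _ Y(1)]) (auto simp: gp per_multiples)
  ultimately show ?thesis using g(4)[OF X ne] by simp
qed

section \<open>Freiman's 3k-4 theorem\<close>

lemma card_translate: "card ((+) (a::int) ` X) = card X"
  by (rule card_image) auto

text \<open>The translates \<open>Min B + A\<close> and \<open>Max A + B\<close> meet only in
  \<open>Max A + Min B\<close>.\<close>

lemma card_sumset_ge:
  fixes A B :: "int set"
  assumes "finite A" "finite B" "A \<noteq> {}" "B \<noteq> {}"
  shows "card A + card B \<le> card (A + B) + 1"
proof -
  let ?P = "(+) (Min B) ` A" and ?Q = "(+) (Max A) ` B"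
  have "?P \<union> ?Q \<subseteq> A + B"
    using assms by (auto intro!: set_plus_intro Min_in Max_in simp: add.commute[of "Min B"])
  then have "card (?P \<union> ?Q) \<le> card (A + B)" using assms by (intro card_mono finite_set_plus)
  moreover have "?P \<inter> ?Q \<subseteq> {Max A + Min B}"
  proof
    fix x assume "x \<in> ?P \<inter> ?Q"
    then obtain a b where "a \<in> A" "b \<in> B" "x = Min B + a" "x = Max A + b" by auto
    moreover then have "a \<le> Max A" "Min B \<le> b" using assms by auto
    ultimately show "x \<in> {Max A + Min B}" by auto
  qed
  then have "card (?P \<inter> ?Q) \<le> card {Max A + Min B}" by (intro card_mono) auto
  then have "card (?P \<inter> ?Q) \<le> 1" by simp
  moreover have "card (?P \<union> ?Q) + card (?P \<inter> ?Q) = card A + card B"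
    using card_Un_Int[of ?P ?Q] assms by (simp add: card_translate)
  ultimately show ?thesis by linarith
qed

lemma ext_plus: "ext n A + ext n B = ext n (A + B)"
proof (rule Set.set_eqI)
  fix z show "z \<in> ext n A + ext n B \<longleftrightarrow> z \<in> ext n (A + B)"
  proof
    assume "z \<in> ext n A + ext n B"
    then obtain x y a b where "z = x + y" "a \<in> A" "b \<in> B" "x mod n = a mod n" "y mod n = b mod n"
      by (auto elim!: set_plus_elim simp: ext_def)
    then have "z mod n = (a + b) mod n" "a + b \<in> A + B" by (auto intro: mod_add_cong set_plus_intro)
    then show "z \<in> ext n (A + B)" by (auto simp: ext_def)
  next
    assume "z \<in> ext n (A + B)"
    then obtain a b where ab: "a \<in> A" "b \<in> B" "z mod n = (a + b) mod n"
      by (auto elim!: set_plus_elim simp: ext_def)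
    have "n dvd (z - b) - a" using ab(3) by (simp add: mod_eq_dvd_iff algebra_simps)
    then have "z - b \<in> ext n A" using ab(1) by (auto simp: ext_def mod_eq_dvd_iff)
    then have "(z - b) + b \<in> ext n A + ext n B" using ab(2) ext_superset by (intro set_plus_intro) auto
    then show "z \<in> ext n A + ext n B" by simp
  qed
qed

text \<open>Each residue class of \<open>A + B\<close> modulo \<open>l\<close> has a smallest representative, and it does not lie in
  \<open>l + B\<close>.\<close>

lemma card_sumset_ge_mu:
  fixes A B :: "int set"
  assumes fin: "finite A" "finite B" and l: "l > 0" "0 \<in> A" "l \<in> A" and W: "per l W" "B \<inter> W = {}"
  shows "mu l (ext l (A + B) - W) + card B + card ((A + B) \<inter> W) \<le> card (A + B)"
proof -
  let ?lB = "(+) l ` B"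
  define D where "D = A + B - W - ?lB"
  have finAB: "finite (A + B)" using fin by (rule finite_set_plus)
  have lB: "?lB \<subseteq> A + B" using l by (auto intro: set_plus_intro)
  have BAB: "B \<subseteq> A + B" using l by (auto intro: set_plus_intro[of 0 A, simplified])
  have lBW: "?lB \<inter> W = {}"
  proof -
    have "l + b \<notin> W" if "b \<in> B" for b using W that per_add_mult[OF W(1), of b 1] by (auto simp: add.commute)
    then show ?thesis by auto
  qed
  have "A + B = D \<union> ?lB \<union> ((A + B) \<inter> W)" using lB by (auto simp: D_def)
  moreover have "card (D \<union> ?lB \<union> ((A + B) \<inter> W)) = card D + card ?lB + card ((A + B) \<inter> W)"
    using lBW finAB fin by (subst card_Un_disjoint; (subst card_Un_disjoint)?) (auto simp: D_def)
  ultimately have "card (A + B) = card D + card B + card ((A + B) \<inter> W)" by (metis card_translate)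
  moreover have "mu l (ext l (A + B) - W) \<le> card D"
  proof (rule mu_le_card)
    show "finite D" using finAB by (simp add: D_def)
    fix x assume x: "x \<in> ext l (A + B) - W"
    define E where "E = {c \<in> A + B. c mod l = x mod l}"
    have "finite E" "E \<noteq> {}" using finAB x by (auto simp: E_def ext_def)
    define c where "c = Min E"
    have c: "c \<in> E" unfolding c_def using \<open>finite E\<close> \<open>E \<noteq> {}\<close> by (rule Min_in)
    have "c \<notin> W" using x c per_cong[OF W(1), of c x] by (auto simp: E_def)
    moreover have "c \<notin> ?lB"
    proof
      assume "c \<in> ?lB"
      then have "c - l \<in> B" by auto
      then have "c - l \<in> E" using c BAB by (auto simp: E_def)
      then have "c \<le> c - l" unfolding c_def using \<open>finite E\<close> by (intro Min_le)
      then show False using l by simp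
    qed
    ultimately show "\<exists>a\<in>D. x mod l = a mod l" using c by (intro bexI[of _ c]) (auto simp: D_def E_def)
  qed
  ultimately show ?thesis by linarith
qed

text \<open>Inside \<open>{0..l}\<close> only the two end points can coincide modulo
  \<open>l\<close>.\<close>

lemma mu_ext_ge:
  fixes A :: "int set"
  assumes "finite A" "l > 0" "A \<subseteq> {0..l}" shows "card A \<le> mu l (ext l A) + 1"
proof -
  have "card (A - {l}) \<le> mu l (ext l A)"
  proof (rule card_le_mu[OF assms(2) per_ext])
    show "x \<in> ext l A" if "x \<in> A - {l}" for x using that by (auto simp: ext_def)
    fix x y assume "x \<in> A - {l}" "y \<in> A - {l}" and e: "x mod l = y mod l"
    then have "0 \<le> x" "x < l" "0 \<le> y" "y < l" using assms(3) by force+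
    then show "x = y" using e by simp
  qed
  moreover have "card A \<le> card (A - {l}) + 1" using card_Suc_Diff1[OF assms(1), of l] by (cases "l \<in> A") auto
  ultimately show ?thesis by linarith
qed

text \<open>Split \<open>A\<close> into its multiples of \<open>g\<close> and the rest, both
  nonempty. As \<open>B\<close> consists of multiples of \<open>g\<close>, the two sumsets with
  \<open>B\<close> are disjoint, and each exceeds its part of \<open>A\<close> by at least
  \<open>|B| - 1\<close>.\<close>

lemma card_split_ge:
  fixes A B :: "int set"
  assumes fin: "finite A" "finite B" and "A \<noteq> {}" and B: "0 \<in> B" "\<forall>b\<in>B. g dvd b"
    and A: "0 \<in> A" "a \<in> A" "\<not> g dvd a"
  shows "card A + 2 * card B \<le> card (A + B) + 2"
proof -
  let ?A0 = "{a \<in> A. g dvd a}" and ?A1 = "{a \<in> A. \<not> g dvd a}"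
  have "(?A0 + B) \<inter> (?A1 + B) = {}"
  proof -
    have "g dvd x" if "x \<in> ?A0 + B" for x using that B by (auto elim!: set_plus_elim)
    moreover have "\<not> g dvd x" if "x \<in> ?A1 + B" for x using that B by (auto elim!: set_plus_elim simp: dvd_add_left_iff)
    ultimately show ?thesis by blast
  qed
  moreover have "A + B = (?A0 + B) \<union> (?A1 + B)"
  proof -
    have "A = ?A0 \<union> ?A1" by auto
    then show ?thesis using plus_Un[of ?A0 ?A1 B] by simp
  qed
  ultimately have "card (A + B) = card (?A0 + B) + card (?A1 + B)"
    using fin by (simp add: card_Un_disjoint finite_set_plus)
  moreover have "card ?A0 + card B \<le> card (?A0 + B) + 1" using fin A B by (intro card_sumset_ge) auto
  moreover have "card ?A1 + card B \<le> card (?A1 + B) + 1" using fin A B by (intro card_sumset_ge) auto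
  moreover have "card A = card ?A0 + card ?A1"
  proof -
    have "A = ?A0 \<union> ?A1" by auto
    then show ?thesis using fin card_Un_disjoint[of ?A0 ?A1] by auto
  qed
  ultimately show ?thesis by linarith
qed

text \<open>Otherwise let \<open>H\<close> be the subgroup from Mann's theorem and \<open>w\<close> a suitable coset of it. By
  \<open>card_sumset_ge_mu\<close>, \<open>A + B\<close> has at least \<open>|B|\<close> elements beyond its residues outside \<open>w\<close> and its
  elements in \<open>w\<close>. The atom property of \<open>H\<close> bounds the former from below, and one pair of classes
  of \<open>A\<close> and \<open>B\<close> with sum \<open>w\<close> bounds the latter.\<close>

lemma sumset_dichotomy:
  fixes A B :: "int set"
  assumes fin: "finite A" "finite B" and l: "l > 0" "0 \<in> A" "l \<in> A" "A \<subseteq> {0..l}"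
    and B: "0 \<in> B" "B \<subseteq> {0..l}" and gcd: "\<And>d. d > 1 \<Longrightarrow> \<exists>x\<in>A \<union> B. \<not> d dvd x"
    and small: "card (A + B) + 4 \<le> 2 * card A + card B" "card (A + B) + 4 \<le> card A + 2 * card B"
  shows "ext l (A + B) = UNIV"
proof (rule ccontr)
  define S where "S = ext l A"
  define T where "T = ext l B"
  define C where "C = S + T"
  have CAB: "C = ext l (A + B)" by (simp add: C_def S_def T_def ext_plus)
  assume "ext l (A + B) \<noteq> UNIV"
  then have CU: "S + T \<noteq> UNIV" using CAB C_def by simp
  have perS: "per l S" and perT: "per l T" by (auto simp: S_def T_def per_ext)
  have perC: "per l C" unfolding C_def by (rule per_plus[OF perS])
  have AS: "A \<subseteq> S" and BT: "B \<subseteq> T" by (auto simp: S_def T_def ext_superset)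
  have S0: "0 \<in> S" and T0: "0 \<in> T" using AS BT l B by auto
  have muS: "card A \<le> mu l S + 1" unfolding S_def by (rule mu_ext_ge[OF fin(1) l(1,4)])
  have muT: "card B \<le> mu l T + 1" unfolding T_def by (rule mu_ext_ge[OF fin(2) l(1) B(2)])
  obtain g where g: "g > 0" "g dvd l" and HTU: "{x. g dvd x} + T \<noteq> UNIV"
    and atom: "\<And>X. per l X \<Longrightarrow> X \<noteq> {} \<Longrightarrow> X + T \<noteq> UNIV \<Longrightarrow>
      mu l X + mu l ({x. g dvd x} + T) \<le> mu l (X + T) + mu l {x. g dvd x}"
    using mann[OF l(1) perT perS _ CU] S0 by blast
  define H where "H = {x. g dvd x}"
  define HT where "HT = H + T"
  note atom = atom[folded H_def, folded HT_def]
  have pgH: "per g H" unfolding H_def by (rule per_multiples)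
  have pgHT: "per g HT" unfolding HT_def by (rule per_plus[OF pgH])
  have perH: "per l H" and perHT: "per l HT" using per_dvd_per g pgH pgHT by blast+
  have H0: "0 \<in> H" by (simp add: H_def)
  have THT: "T \<subseteq> HT" unfolding HT_def using set_plus_intro[OF H0] by force
  have HTH: "x \<in> HT \<longleftrightarrow> y \<in> HT" if "g dvd x - y" for x y by (rule per_dvd[OF pgHT that])
  have HT_T: "x \<in> HT" if "t \<in> T" "g dvd x - t" for x t using HTH[OF that(2)] that(1) THT by blast
  have HHT: "H \<subseteq> HT" unfolding HT_def using set_plus_intro[OF _ T0] by force
  have h0: "mu l H > 0" using mu_pos_iff[OF l(1) perH] H0 by blast
  have g1: "g > 1"
  proof (rule ccontr)
    assume "\<not> g > 1"
    then have "g = 1" using g by simp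
    then have "H = UNIV" by (simp add: H_def)
    then show False using HHT HTU by (auto simp: HT_def H_def)
  qed
  define cos where "cos u = (+) u ` H" for u
  have mem_cos: "x \<in> cos u \<longleftrightarrow> g dvd x - u" for x u unfolding cos_def mem_translate by (simp add: H_def)
  have pgcos: "per g (cos u)" for u unfolding cos_def by (rule per_translate[OF pgH])
  have percos: "per l (cos u)" for u using per_dvd_per g pgcos by blast
  have mucos: "mu l (cos u) = mu l H" for u unfolding cos_def by (rule mu_translate[OF l(1) perH])
  have cosHT: "cos u \<subseteq> HT" if "u \<in> HT" for u using HTH that by (auto simp: mem_cos)
  have class_card: "mu l (S \<inter> cos u) + mu l (T \<inter> cos v) \<le> card ((A + B) \<inter> cos (u + v)) + 1"
    if uv: "u \<in> S" "v \<in> T" for u v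
  proof -
    have res: "\<exists>a\<in>D \<inter> cos u. x mod l = a mod l" if "x \<in> ext l D \<inter> cos u" for x u D
    proof -
      obtain a where a: "a \<in> D" "x mod l = a mod l" using \<open>x \<in> ext l D \<inter> cos u\<close> by (auto simp: ext_def)
      then have "a \<in> cos u" using that per_cong[OF percos, of x a] by auto
      then show ?thesis using a by auto
    qed
    have "mu l (S \<inter> cos u) \<le> card (A \<inter> cos u)" unfolding S_def by (rule mu_le_card) (use fin res in auto)
    moreover have "mu l (T \<inter> cos v) \<le> card (B \<inter> cos v)" unfolding T_def by (rule mu_le_card) (use fin res in auto)
    moreover have "A \<inter> cos u \<noteq> {}" using res[of u A u] uv by (auto simp: S_def mem_cos)
    moreover have "B \<inter> cos v \<noteq> {}" using res[of v B v] uv by (auto simp: T_def mem_cos)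
    then have "card (A \<inter> cos u) + card (B \<inter> cos v) \<le> card (A \<inter> cos u + B \<inter> cos v) + 1"
      using fin \<open>A \<inter> cos u \<noteq> {}\<close> by (intro card_sumset_ge) auto
    moreover have "A \<inter> cos u + B \<inter> cos v \<subseteq> (A + B) \<inter> cos (u + v)"
    proof
      fix x assume "x \<in> A \<inter> cos u + B \<inter> cos v"
      then obtain a b where ab: "a \<in> A" "b \<in> B" "g dvd a - u" "g dvd b - v" "x = a + b"
        by (auto elim!: set_plus_elim simp: mem_cos)
      have "g dvd (a - u) + (b - v)" using ab by (intro dvd_add) auto
      then have "g dvd x - (u + v)" using ab(5) by (simp add: algebra_simps)
      then show "x \<in> (A + B) \<inter> cos (u + v)" using ab by (auto simp: mem_cos)
    qed
    then have "card (A \<inter> cos u + B \<inter> cos v) \<le> card ((A + B) \<inter> cos (u + v))"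
      using fin by (intro card_mono) (auto simp: finite_set_plus)
    ultimately show ?thesis by linarith
  qed
  have N1: "mu l (C - W) + card B + card ((A + B) \<inter> W) \<le> card (A + B)" if "per l W" "B \<inter> W = {}" for W
    unfolding CAB by (rule card_sumset_ge_mu[OF fin l(1-3) that])
  have N0: "mu l C + card B \<le> card (A + B)" using N1[of "{}"] by (simp add: per_empty)
  \<comment> \<open>Neither set lies in \<open>H\<close>. If \<open>B\<close> did, some element of
    \<open>A\<close> would not, and \<open>card_split_ge\<close> would contradict the second
    smallness assumption. With this \<open>b\<close>, the first assumption handles \<open>A\<close>
    in the same way.\<close>
  obtain b where b: "b \<in> B" "\<not> g dvd b"
  proof (rule ccontr)
    assume "\<not> thesis"
    then have Bg: "\<forall>b\<in>B. g dvd b" using that by blast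
    then obtain a where "a \<in> A" "\<not> g dvd a" using gcd[OF g1] by auto
    then show False using card_split_ge[OF fin _ B(1) Bg l(2)] small(2) l by auto
  qed
  obtain a where a: "a \<in> A" "\<not> g dvd a"
  proof (rule ccontr)
    assume "\<not> thesis"
    then have Ag: "\<forall>b\<in>A. g dvd b" using that by blast
    then show False using card_split_ge[OF fin(2,1) _ l(2) Ag B(1) b] small(1) B by (auto simp: add.commute)
  qed
  have F: "2 * mu l H \<le> mu l HT"
  proof -
    have "H \<inter> cos b = {}" using b(2) dvd_diff_right_iff[of g _ b] by (auto simp: H_def mem_cos)
    then have "mu l (H \<union> cos b) = 2 * mu l H" by (simp add: mu_disjoint mucos)
    moreover have "H \<union> cos b \<subseteq> HT" using HHT cosHT[of b] BT THT b by blast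
    ultimately show ?thesis using mu_mono[of "H \<union> cos b" HT l] by simp
  qed
  obtain z where z: "z \<notin> C" using CU C_def by auto
  have zC: "z - s \<notin> T" if "s \<in> S" for s
    using z that set_plus_intro[OF that, of "z - s" T] by (auto simp: C_def)
  \<comment> \<open>For \<open>s\<close> in \<open>S\<close> the residue \<open>z - s\<close> is
    missing from \<open>T\<close>. \<open>Sr\<close> collects those \<open>s\<close> for which it
    still lies in \<open>HT\<close>; for all other \<open>s\<close>, the set \<open>s + T\<close>
    avoids the whole coset of \<open>z\<close>.\<close>
  define Sr where "Sr = {s \<in> S. z - s \<in> HT}"
  define S' where "S' = S - Sr"
  have Sr_cos: "s' \<in> Sr" if "s \<in> Sr" "s' \<in> S" "g dvd s' - s" for s s'
  proof -
    have e: "(z - s') - (z - s) = - (s' - s)" by simp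
    have "g dvd (z - s') - (z - s)" unfolding e dvd_minus_iff by (rule that(3))
    from HTH[OF this] show ?thesis using that by (simp add: Sr_def)
  qed
  have perSr: "per l Sr"
  proof (rule perI)
    fix x y assume xy: "x \<in> Sr" "l dvd x - y"
    then have "y \<in> S" using per_dvd[OF perS] by (auto simp: Sr_def)
    moreover have "g dvd y - x" using dvd_trans[OF g(2) xy(2)] by (subst dvd_diff_commute)
    ultimately show "y \<in> Sr" using Sr_cos xy(1) by blast
  qed
  have perS': "per l S'" unfolding S'_def by (rule per_Diff[OF perS perSr])
  have muSS: "mu l S' + mu l Sr = mu l S" unfolding S'_def by (rule mu_Diff) (auto simp: Sr_def)
  have S'T: "S' + T \<subseteq> C" unfolding C_def S'_def by (intro set_plus_mono2) auto
  have S'TU: "S' + T \<noteq> UNIV" using S'T z by auto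
  have S'Tw: "(S' + T) \<inter> cos z = {}"
  proof -
    have "s + t \<notin> cos z" if "s \<in> S'" "t \<in> T" for s t
    proof
      assume "s + t \<in> cos z"
      then have "g dvd t - (z - s)" by (simp add: mem_cos algebra_simps)
      then have "- (t - (z - s)) = (z - s) - t" "g dvd - (t - (z - s))" unfolding dvd_minus_iff by simp_all
      then have "z - s \<in> HT" using HT_T that by metis
      then show False using that by (auto simp: S'_def Sr_def)
    qed
    then show ?thesis by (auto elim!: set_plus_elim)
  qed
  \<comment> \<open>Apply the atom property to \<open>X\<close>, the negated holes of
    \<open>C\<close> in the coset of \<open>z\<close>. Both \<open>X + T\<close> and
    \<open>- Sr\<close> lie in the translate of \<open>HT\<close> by \<open>- z\<close>, and they
    are disjoint. So there are at most \<open>|H| - |Sr|\<close> holes.\<close>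
  have alpha: "mu l Sr \<le> mu l (C \<inter> cos z)"
  proof -
    define X where "X = uminus ` (cos z - C)"
    have perX: "per l X" unfolding X_def by (intro per_uminus per_Diff percos perC)
    have muX: "mu l X + mu l (C \<inter> cos z) = mu l H"
      unfolding X_def using mu_uminus[OF l(1) per_Diff[OF percos perC]] mu_split[of l "cos z" C] mucos
      by (simp add: Int_commute)
    have XT: "- s \<notin> X + T" if "s \<in> S" for s
    proof
      assume "- s \<in> X + T"
      then obtain c t where "c \<in> cos z" "c \<notin> C" "t \<in> T" "- s = - c + t" by (auto elim!: set_plus_elim simp: X_def)
      then have "c = s + t" by simp
      then show False using \<open>c \<notin> C\<close> that \<open>t \<in> T\<close> by (auto simp: C_def)
    qed
    have "X + T \<noteq> UNIV" using XT[OF S0] by auto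
    moreover have "z \<in> cos z - C" using z by (simp add: mem_cos)
    then have "X \<noteq> {}" unfolding X_def by blast
    ultimately have 1: "mu l X + mu l HT \<le> mu l (X + T) + mu l H" by (intro atom[OF perX])
    define Q where "Q = (+) (- z) ` HT"
    have memQ: "x \<in> Q \<longleftrightarrow> x + z \<in> HT" for x unfolding Q_def mem_translate by simp
    have "X + T \<subseteq> Q"
    proof
      fix x assume "x \<in> X + T"
      then obtain c t where ct: "c \<in> cos z" "t \<in> T" "x = - c + t" by (auto elim!: set_plus_elim simp: X_def)
      have e: "(x + z) - t = - (c - z)" using ct(3) by simp
      have "g dvd (x + z) - t" unfolding e dvd_minus_iff using ct(1) by (simp add: mem_cos)
      then show "x \<in> Q" unfolding memQ by (rule HT_T[OF ct(2)])
    qed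
    moreover have "uminus ` Sr \<subseteq> Q"
    proof
      fix x assume "x \<in> uminus ` Sr"
      then have "z - (- x) \<in> HT" by (auto simp: Sr_def)
      then show "x \<in> Q" by (simp add: memQ add.commute)
    qed
    moreover have "uminus ` Sr \<inter> (X + T) = {}" using XT by (auto simp: Sr_def)
    ultimately have "mu l (uminus ` Sr) + mu l (X + T) \<le> mu l Q"
      using mu_mono[of "uminus ` Sr \<union> (X + T)" Q l] by (simp add: mu_disjoint)
    moreover have "mu l Q = mu l HT" unfolding Q_def by (rule mu_translate[OF l(1) perHT])
    moreover have "mu l (uminus ` Sr) = mu l Sr" by (rule mu_uminus[OF l(1) perSr])
    ultimately show ?thesis using 1 muX by linarith
  qed
  have muC: "mu l S + mu l HT \<le> mu l C + mu l H" unfolding C_def using atom[OF perS _ CU] S0 by auto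
  \<comment> \<open>Otherwise \<open>|S| <= |H|\<close>. Since \<open>HT\<close> has at least two
    cosets, \<open>|C| >= 2 |S|\<close> follows, against the first smallness assumption.\<close>
  have S'0: "S' \<noteq> {}"
  proof
    assume "S' = {}"
    then have "mu l S = mu l Sr" using muSS by simp
    then have "mu l S \<le> mu l H" using alpha mu_mono[of "C \<inter> cos z" "cos z" l] mucos by simp
    then show False using muC N0 F muS small(1) by linarith
  qed
  \<comment> \<open>The distinguished coset is that of \<open>u + v\<close> if \<open>S' + T\<close>
    leaves \<open>HT\<close>, and that of \<open>z\<close> otherwise. In both cases it lies outside
    \<open>HT\<close> and so contains no element of \<open>B\<close>.\<close>
  show False
  proof (cases "\<exists>u\<in>S'. \<exists>v\<in>T. u + v \<notin> HT")
    case True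
    then obtain u v where uv: "u \<in> S'" "v \<in> T" "u + v \<notin> HT" by auto
    define w where "w = cos (u + v)"
    have perw: "per l w" unfolding w_def by (rule percos)
    have "b' \<notin> w" if "b' \<in> B" for b'
    proof
      assume "b' \<in> w"
      then have "g dvd (u + v) - b'" unfolding w_def mem_cos by (subst dvd_diff_commute)
      then show False using HT_T[of b'] BT that uv(3) by blast
    qed
    then have Bw: "B \<inter> w = {}" by blast
    have wz: "w \<inter> cos z = {}"
    proof (rule ccontr)
      assume "w \<inter> cos z \<noteq> {}"
      then obtain x where "g dvd x - (u + v)" "g dvd x - z" by (auto simp: w_def mem_cos)
      then have "g dvd (x - z) - (x - (u + v))" by - (rule dvd_diff)
      moreover have "(x - z) - (x - (u + v)) = (u + v) - z" by simp
      ultimately have "u + v \<in> cos z" unfolding mem_cos by metis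
      moreover have "u + v \<in> S' + T" using uv by (intro set_plus_intro)
      ultimately show False using S'Tw by blast
    qed
    define S2 where "S2 = S' - cos u"
    define T2 where "T2 = T - cos v"
    have perS2: "per l S2" unfolding S2_def by (intro per_Diff perS' percos)
    have Su: "S \<inter> cos u = S' \<inter> cos u"
    proof -
      have "s \<notin> Sr" if "s \<in> S" "g dvd s - u" for s
        using Sr_cos[of s u] that uv(1) dvd_diff_commute[of g s u] by (auto simp: S'_def)
      then show ?thesis by (auto simp: S'_def mem_cos)
    qed
    have muS2: "mu l S' = mu l (S \<inter> cos u) + mu l S2" unfolding S2_def Su by (rule mu_split)
    have muT2: "mu l T = mu l (T \<inter> cos v) + mu l T2" unfolding T2_def by (rule mu_split)
    define Q where "Q D = (\<Union>d\<in>D. cos d)" for D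
    have perQ: "per l (Q D)" for D using percos unfolding per_def Q_def by blast
    \<comment> \<open>Completing a coset met by \<open>S'\<close> adds no more elements to the
      sumset with \<open>T\<close> than to the set itself: this is the atom property of the part
      \<open>J\<close> already present, combined with inclusion-exclusion. Cosets are completed one
      at a time.\<close>
    have fill: "mu l ((S' \<union> Q D) + T) + mu l S' \<le> mu l (S' + T) + mu l (S' \<union> Q D)"
      if "finite D" "D \<subseteq> S'" for D
      using that
    proof (induction D rule: finite_induct)
      case empty then show ?case by (simp add: Q_def)
    next
      case (insert d D)
      define Y where "Y = S' \<union> Q D"
      have perY: "per l Y" unfolding Y_def by (rule per_Un[OF perS' perQ])
      have Y1: "S' \<union> Q (insert d D) = Y \<union> cos d" by (auto simp: Y_def Q_def)
      have IH: "mu l (Y + T) + mu l S' \<le> mu l (S' + T) + mu l Y" using insert unfolding Y_def by auto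
      show ?case
      proof (cases "d \<in> Q D")
        case True
        then obtain e where "e \<in> D" "g dvd d - e" by (auto simp: Q_def mem_cos)
        have "cos d \<subseteq> cos e"
        proof
          fix x assume "x \<in> cos d"
          then have "g dvd (x - d) + (d - e)" using \<open>g dvd d - e\<close> by (intro dvd_add) (auto simp: mem_cos)
          then show "x \<in> cos e" by (simp add: mem_cos)
        qed
        then have "Y \<union> cos d = Y" using \<open>e \<in> D\<close> by (auto simp: Y_def Q_def)
        then show ?thesis using IH unfolding Y1 by simp
      next
        case False
        have "x \<notin> Q D" if "x \<in> cos d" for x
        proof
          assume "x \<in> Q D"
          then obtain e where "e \<in> D" "g dvd x - e" by (auto simp: Q_def mem_cos)
          moreover have "g dvd x - d" using that by (simp add: mem_cos)
          ultimately have "g dvd (x - e) - (x - d)" by - (rule dvd_diff)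
          then have "d \<in> cos e" by (simp add: mem_cos)
          then show False using False \<open>e \<in> D\<close> by (auto simp: Q_def)
        qed
        then have I: "Y \<inter> cos d = S' \<inter> cos d" by (auto simp: Y_def)
        define J where "J = S' \<inter> cos d"
        have "J + T \<subseteq> S' + T" unfolding J_def by (intro set_plus_mono2) auto
        then have "J + T \<noteq> UNIV" using S'TU by auto
        moreover have "J \<noteq> {}" "per l J" using insert.prems by (auto simp: J_def mem_cos intro: per_Int perS' percos)
        ultimately have at: "mu l J + mu l HT \<le> mu l (J + T) + mu l H" by (intro atom)
        have cosT: "cos d + T = (+) d ` HT" unfolding cos_def HT_def by (rule translate_plus)
        have "mu l (J + T) \<le> mu l ((Y + T) \<inter> (cos d + T))"
          by (rule mu_mono) (use plus_Int_subset[of Y "cos d" T] I J_def in simp)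
        moreover have "mu l ((Y + T) \<union> (cos d + T)) + mu l ((Y + T) \<inter> (cos d + T)) = mu l (Y + T) + mu l HT"
          using mu_Un_Int[of l "Y + T" "cos d + T"] mu_translate[OF l(1) perHT, of d] cosT by simp
        moreover have "mu l (Y \<union> cos d) + mu l J = mu l Y + mu l H"
          using mu_Un_Int[of l Y "cos d"] I mucos by (simp add: J_def)
        ultimately show ?thesis using IH at unfolding Y1 plus_Un by linarith
      qed
    qed
    define D where "D = S2 \<inter> {0..<l}"
    have finD: "finite D" by (simp add: D_def)
    have DS': "D \<subseteq> S'" by (auto simp: D_def S2_def)
    have S2Q: "x \<in> Q D" if "s \<in> S2" "g dvd x - s" for x s
    proof -
      have "s mod l \<in> D" using that l(1) per_mod[OF perS2] by (simp add: D_def)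
      moreover have "l dvd s - s mod l" by simp
      then have "g dvd (x - s) + (s - s mod l)" using that g(2) by (intro dvd_add) (auto intro: dvd_trans)
      then have "g dvd x - s mod l" by simp
      ultimately show ?thesis by (auto simp: Q_def mem_cos)
    qed
    have Qu: "Q D \<inter> cos u = {}"
    proof (rule ccontr)
      assume "Q D \<inter> cos u \<noteq> {}"
      then obtain x d where "d \<in> D" "g dvd x - d" "g dvd x - u" by (auto simp: Q_def mem_cos)
      then have "g dvd (x - u) - (x - d)" by - (rule dvd_diff)
      then have "d \<in> cos u" by (simp add: mem_cos)
      then show False using \<open>d \<in> D\<close> by (auto simp: D_def S2_def)
    qed
    define X where "X = S' \<union> Q D"
    have perX: "per l X" unfolding X_def by (rule per_Un[OF perS' perQ])
    have S2sub: "S2 \<subseteq> Q D" using S2Q by fastforce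
    have "X = Q D \<union> (S \<inter> cos u)" using S2sub Su by (auto simp: X_def S2_def)
    moreover have "Q D \<inter> (S \<inter> cos u) = {}" using Qu by auto
    ultimately have muX: "mu l X = mu l (Q D) + mu l (S \<inter> cos u)" by (simp add: mu_disjoint)
    define G where "G = (Q D \<union> cos u) + T"
    have "(Q D \<union> cos u) + T \<noteq> UNIV"
    proof -
      have "y + t \<noteq> z" if "y \<in> Q D \<union> cos u" "t \<in> T" for y t
      proof
        assume "y + t = z"
        obtain s where "s \<in> S'" "g dvd y - s" using \<open>y \<in> Q D \<union> cos u\<close> uv(1) DS' by (auto simp: Q_def mem_cos)
        moreover have e: "(s + t) - z = - (y - s)" using \<open>y + t = z\<close> by simp
        ultimately have "s + t \<in> cos z" unfolding mem_cos e dvd_minus_iff by simp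
        moreover have "s + t \<in> S' + T" using \<open>s \<in> S'\<close> that by (intro set_plus_intro)
        ultimately show False using S'Tw by blast
      qed
      then have "z \<notin> (Q D \<union> cos u) + T" by (auto elim!: set_plus_elim)
      then show ?thesis by auto
    qed
    have "u \<in> cos u" by (simp add: mem_cos)
    then have "Q D \<union> cos u \<noteq> {}" by blast
    have "mu l (Q D \<union> cos u) + mu l HT \<le> mu l G + mu l H"
      unfolding G_def by (rule atom[OF per_Un[OF perQ percos]]) fact+
    then have muG: "mu l (Q D) + mu l HT \<le> mu l G" using Qu mucos by (simp add: mu_disjoint)
    \<comment> \<open>The residues of \<open>HT\<close> that \<open>T\<close> misses, apart from the
      coset of \<open>v\<close>. Outside \<open>w\<close>, completing the coset of \<open>u\<close>
      as well gains at most the translate \<open>u + K\<close>.\<close>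
    define K where "K = (HT - cos v) - T2"
    have perK: "per l K" unfolding K_def T2_def by (intro per_Diff perHT percos perT)
    have "mu l K + mu l T2 = mu l (HT - cos v)" unfolding K_def by (rule mu_Diff) (use THT in \<open>auto simp: T2_def\<close>)
    moreover have "mu l (HT - cos v) + mu l (cos v) = mu l HT" by (rule mu_Diff) (use cosHT THT uv(2) in auto)
    ultimately have muK: "mu l K + mu l T2 + mu l H = mu l HT" using mucos by simp
    have "G - w \<subseteq> ((X + T) - w) \<union> (+) u ` K"
    proof
      fix y assume y: "y \<in> G - w"
      then obtain x t where xt: "x \<in> Q D \<union> cos u" "t \<in> T" "y = x + t" by (auto elim!: set_plus_elim simp: G_def)
      show "y \<in> ((X + T) - w) \<union> (+) u ` K"
      proof (cases "y \<in> X + T")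
        case True then show ?thesis using y by auto
      next
        case False
        have "x \<notin> X" using False xt set_plus_intro[of x X t T] by blast
        then have "x \<in> cos u" using xt(1) by (auto simp: X_def)
        moreover have "(y - u) - t = x - u" using xt(3) by simp
        ultimately have "g dvd (y - u) - t" unfolding mem_cos by metis
        then have "y - u \<in> HT" by (rule HT_T[OF xt(2)])
        moreover have "y - u \<notin> T"
        proof
          assume "y - u \<in> T"
          moreover have "u \<in> X" using uv(1) by (simp add: X_def)
          ultimately have "u + (y - u) \<in> X + T" by (intro set_plus_intro)
          then show False using False by simp
        qed
        moreover have "y - u \<notin> cos v"
        proof -
          have "(y - u) - v = y - (u + v)" by simp
          then show ?thesis using y unfolding w_def mem_cos Diff_iff by metis
        qed
        ultimately show ?thesis unfolding mem_translate Un_iff by (simp add: K_def T2_def)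
      qed
    qed
    then have "mu l (G - w) \<le> mu l ((X + T) - w) + mu l ((+) u ` K)"
      using mu_mono[of "G - w" "((X + T) - w) \<union> (+) u ` K" l] mu_Un_Int[of l "(X + T) - w" "(+) u ` K"] by linarith
    then have 1: "mu l (G - w) \<le> mu l ((X + T) - w) + mu l K" using mu_translate[OF l(1) perK] by simp
    have 2: "mu l G \<le> mu l H + mu l (G - w)"
      using mu_split[of l G w] mu_mono[of "G \<inter> w" w l] mucos[of "u + v"] by (simp add: w_def)
    have 3: "mu l (X + T) + mu l S' \<le> mu l (S' + T) + mu l X"
      unfolding X_def by (rule fill[OF finD DS'])
    have 4: "mu l (S' + T) = mu l ((S' + T) \<inter> w) + mu l ((S' + T) - w)"
      "mu l (X + T) = mu l ((X + T) \<inter> w) + mu l ((X + T) - w)" by (rule mu_split)+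
    have "S' + T \<subseteq> X + T" unfolding X_def by (intro set_plus_mono2) auto
    then have 5: "mu l ((S' + T) \<inter> w) \<le> mu l ((X + T) \<inter> w)" by (intro mu_mono) auto
    \<comment> \<open>The atom inequality for the completed cosets is carried back to
      \<open>S'\<close>: by \<open>fill\<close>, undoing the completion costs at most as many sums
      as set elements.\<close>
    have beta: "mu l S2 + mu l T2 \<le> mu l ((S' + T) - w)"
      using 1 2 3 4 5 muG muK muX muS2 by linarith
    have "mu l ((S' + T) - w) + mu l (C \<inter> cos z) = mu l (((S' + T) - w) \<union> (C \<inter> cos z))"
      by (subst mu_disjoint) (use S'Tw in auto)
    also have "\<dots> \<le> mu l (C - w)" by (rule mu_mono) (use S'T wz in auto)
    finally have 6: "mu l ((S' + T) - w) + mu l (C \<inter> cos z) \<le> mu l (C - w)" .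
    have 7: "mu l (S \<inter> cos u) + mu l (T \<inter> cos v) \<le> card ((A + B) \<inter> w) + 1"
      unfolding w_def by (rule class_card) (use uv in \<open>auto simp: S'_def\<close>)
    \<comment> \<open>Altogether \<open>|A + B| >= |S| + |T| + |B| - 1 >= |A| + 2 |B| - 3\<close>,
      one more than the second smallness assumption permits.\<close>
    show False using N1[OF perw Bw] beta 6 7 alpha muS2 muT2 muSS muS muT small(2) by linarith
  next
    case False
    then have clos: "u + v \<in> HT" if "u \<in> S'" "v \<in> T" for u v using that by blast
    \<comment> \<open>For \<open>u\<close> in \<open>S'\<close> outside \<open>H\<close>, the union
      of \<open>H\<close> and its translate by \<open>u\<close> would be twice as large as
      \<open>H\<close> with its sumset still inside \<open>HT\<close>, against the atom
      property.\<close>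
    have S'H: "u \<in> H" if "u \<in> S'" for u
    proof (rule ccontr)
      assume "u \<notin> H"
      have "x + t \<in> HT" if "x \<in> H \<union> cos u" "t \<in> T" for x t
      proof (cases "x \<in> H")
        case True then show ?thesis using that by (auto simp: HT_def)
      next
        case False
        then have e: "g dvd (x + t) - (u + t)" using that by (simp add: mem_cos)
        show ?thesis using HTH[OF e] clos[OF \<open>u \<in> S'\<close> that(2)] by simp
      qed
      then have sub: "(H \<union> cos u) + T \<subseteq> HT" by (auto elim!: set_plus_elim)
      then have "(H \<union> cos u) + T \<noteq> UNIV" using HTU by (auto simp: HT_def H_def)
      moreover have "per l (H \<union> cos u)" "H \<union> cos u \<noteq> {}" using H0 by (auto intro: per_Un perH percos)
      ultimately have "mu l (H \<union> cos u) + mu l HT \<le> mu l ((H \<union> cos u) + T) + mu l H" by (intro atom)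
      moreover have "mu l ((H \<union> cos u) + T) \<le> mu l HT" by (rule mu_mono[OF sub])
      moreover have "H \<inter> cos u = {}" using \<open>u \<notin> H\<close> dvd_diff_right_iff[of g _ u] by (auto simp: H_def mem_cos)
      then have "mu l (H \<union> cos u) = 2 * mu l H" by (simp add: mu_disjoint mucos)
      ultimately show False using h0 by linarith
    qed
    have zHT: "z \<notin> HT"
    proof
      assume "z \<in> HT"
      obtain s where s: "s \<in> S'" using S'0 by auto
      then have "g dvd z - (z - s)" using S'H by (simp add: H_def)
      from HTH[OF this] have "z - s \<in> HT" using \<open>z \<in> HT\<close> by blast
      then show False using s by (auto simp: S'_def Sr_def)
    qed
    have "b' \<notin> cos z" if "b' \<in> B" for b'
    proof
      assume "b' \<in> cos z"
      then have "g dvd z - b'" unfolding mem_cos by (subst dvd_diff_commute)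
      then show False using HT_T[of b'] BT that zHT by blast
    qed
    then have Bw: "B \<inter> cos z = {}" by blast
    have aS: "a \<in> S" using a AS by auto
    \<comment> \<open>As \<open>a\<close> lies outside \<open>H\<close>, it belongs to
      \<open>Sr\<close>. Hence the coset of \<open>z\<close> is the sum of a class met by
      \<open>S\<close> and one met by \<open>T\<close>, and this pair supplies elements of
      \<open>A + B\<close> in it.\<close>
    then have "a \<in> Sr" using S'H[of a] a by (auto simp: S'_def H_def)
    then have "z - a \<in> HT" by (auto simp: Sr_def)
    then obtain k t where kt: "k \<in> H" "t \<in> T" "z - a = k + t" by (auto elim!: set_plus_elim simp: HT_def)
    have cz: "cos (a + t) = cos z"
    proof -
      have "g dvd x - (a + t) \<longleftrightarrow> g dvd x - z" for x
      proof -
        have e: "x - (a + t) = (x - z) + k" using kt(3) by simp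
        have "g dvd k" using kt(1) by (simp add: H_def)
        then show ?thesis unfolding e by (rule dvd_add_left_iff)
      qed
      then show ?thesis by (auto simp: mem_cos)
    qed
    have 1: "mu l (S \<inter> cos a) + mu l (T \<inter> cos t) \<le> card ((A + B) \<inter> cos z) + 1"
      using class_card[OF aS kt(2)] cz by simp
    have 2: "mu l (S' + T) \<le> mu l (C - cos z)" by (rule mu_mono) (use S'T S'Tw in blast)
    have 3: "mu l S' + mu l HT \<le> mu l (S' + T) + mu l H" by (rule atom[OF perS' S'0 S'TU])
    define K where "K = (HT - cos t) - (T - cos t)"
    have perK: "per l K" unfolding K_def by (intro per_Diff perHT percos perT)
    have "mu l K + mu l (T - cos t) = mu l (HT - cos t)" unfolding K_def by (rule mu_Diff) (use THT in auto)
    moreover have "mu l (HT - cos t) + mu l (cos t) = mu l HT" by (rule mu_Diff) (use cosHT THT kt(2) in auto)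
    ultimately have muK: "mu l K + mu l (T - cos t) + mu l H = mu l HT" using mucos by simp
    \<comment> \<open>The reflection of \<open>s\<close> to \<open>z - s\<close> sends
      \<open>Sr\<close> into the residues of \<open>HT\<close> that \<open>T\<close> misses.\<close>
    have 4: "mu l (Sr - cos a) \<le> mu l K"
    proof (rule mu_le_mu[OF l(1) perK, of _ "\<lambda>s. z - s"])
      fix s assume s: "s \<in> Sr - cos a"
      have "z - s \<notin> cos t"
      proof
        assume "z - s \<in> cos t"
        then have "g dvd k - ((z - s) - t)" using kt(1) unfolding H_def mem_cos mem_Collect_eq by - (rule dvd_diff)
        moreover have "k - ((z - s) - t) = s - a" using kt(3) by simp
        ultimately show False using s unfolding Diff_iff mem_cos by metis
      qed
      then show "z - s \<in> K" using s zC by (auto simp: K_def Sr_def)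
    next
      fix x y assume "l dvd z - x - (z - y)"
      then have "l dvd - (x - y)" by simp
      then show "l dvd x - y" unfolding dvd_minus_iff .
    qed
    have 5: "mu l Sr \<le> mu l (S \<inter> cos a) + mu l (Sr - cos a)"
      using mu_split[of l Sr "cos a"] mu_mono[of "Sr \<inter> cos a" "S \<inter> cos a" l] by (auto simp: Sr_def)
    have 6: "mu l T = mu l (T \<inter> cos t) + mu l (T - cos t)" by (rule mu_split)
    show False using N1[OF percos Bw] 1 2 3 4 5 6 muK muSS muS muT small(2) by linarith
  qed
qed

text \<open>The coprimality condition of the 3k-4 theorem, phrased by differences within each set so
  that the two sets may be translated independently.\<close>

definition spread :: "int set \<Rightarrow> int set \<Rightarrow> bool" where
  "spread A B \<longleftrightarrow> (\<forall>d>1. \<exists>x y. (x \<in> A \<and> y \<in> A \<or> x \<in> B \<and> y \<in> B) \<and> \<not> d dvd x - y)"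

definition diam_le :: "int set \<Rightarrow> int \<Rightarrow> bool" where
  "diam_le A n \<longleftrightarrow> (\<forall>x\<in>A. \<forall>y\<in>A. x - y \<le> n)"

lemma spread_mono: "spread A B \<Longrightarrow> A \<subseteq> A' \<Longrightarrow> B \<subseteq> B' \<Longrightarrow> spread A' B'"
  unfolding spread_def by (meson subsetD)

lemma spread_commute: "spread A B \<longleftrightarrow> spread B A"
  unfolding spread_def by meson

lemma spread_translate: "spread ((+) a ` A) ((+) b ` B) \<longleftrightarrow> spread A B"
proof -
  have "(\<exists>x y. (x \<in> (+) a ` A \<and> y \<in> (+) a ` A \<or> x \<in> (+) b ` B \<and> y \<in> (+) b ` B) \<and> \<not> d dvd x - y) \<longleftrightarrow>
    (\<exists>x y. (x \<in> A \<and> y \<in> A \<or> x \<in> B \<and> y \<in> B) \<and> \<not> d dvd x - y)" for d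
    by fastforce
  then show ?thesis by (simp add: spread_def)
qed

lemma card_le_diam:
  assumes "finite A" "A \<noteq> {}" "diam_le A n" shows "int (card A) \<le> n + 1"
proof -
  have "A \<subseteq> {Min A..Max A}" using assms by auto
  then have "card A \<le> card {Min A..Max A}" by (intro card_mono) auto
  moreover have "Max A - Min A \<le> n" using assms by (auto simp: diam_le_def)
  moreover have "Min A \<le> Max A" using assms by auto
  ultimately show ?thesis by auto
qed

text \<open>\<open>A + B\<close> meets every residue modulo the larger diameter \<open>l\<close>,
  which bounds \<open>l\<close>. By that bound \<open>A\<close> has few gaps, so its part in
  \<open>{0..<m}\<close> and \<open>B\<close> have by pigeonhole a sumset covering all residues
  modulo \<open>m\<close>, which bounds \<open>m\<close>.\<close>

lemma freiman_normalized:
  fixes A B :: "int set"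
  assumes fin: "finite A" "finite B" and A: "0 \<in> A" "l \<in> A" "A \<subseteq> {0..l}"
    and B: "0 \<in> B" "m \<in> B" "B \<subseteq> {0..m}" and ml: "m \<le> l" and spread: "spread A B"
    and small: "card (A + B) + 4 \<le> 2 * card A + card B" "card (A + B) + 4 \<le> card A + 2 * card B"
  shows "l + int (card B) \<le> int (card (A + B)) \<and> m + int (card A) \<le> int (card (A + B))"
proof -
  have cc: "card A + card B \<le> card (A + B) + 1" using fin A B by (intro card_sumset_ge) auto
  have m0: "m > 0"
  proof (rule ccontr)
    assume "\<not> m > 0"
    then have "B \<subseteq> {0}" using B by auto
    then have "card B \<le> card {0::int}" by (intro card_mono) auto
    then show False using cc small(2) by simp
  qed
  have l0: "l > 0" using m0 ml by simp
  have gcd: "\<exists>x\<in>A \<union> B. \<not> d dvd x" if d: "d > 1" for d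
  proof -
    from spread d obtain x y where xy: "x \<in> A \<and> y \<in> A \<or> x \<in> B \<and> y \<in> B" "\<not> d dvd x - y"
      unfolding spread_def by blast
    then have "\<not> d dvd x \<or> \<not> d dvd y" using dvd_diff by blast
    then show ?thesis using xy(1) by blast
  qed
  have "ext l (A + B) = UNIV"
    by (rule sumset_dichotomy[OF fin l0 A B(1) _ gcd small]) (use B ml in auto)
  then have l: "l + int (card B) \<le> int (card (A + B))"
    using card_sumset_ge_mu[OF fin l0 A(1,2) per_empty] mu_UNIV[OF l0] by simp
  have "{0..<m} \<subseteq> (A \<inter> {0..<m}) \<union> ({0..l} - A)" using ml by auto
  then have "card {0..<m} \<le> card ((A \<inter> {0..<m}) \<union> ({0..l} - A))" by (intro card_mono) (use fin in auto)
  also have "\<dots> \<le> card (A \<inter> {0..<m}) + card ({0..l} - A)" by (rule card_Un_le)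
  finally have "m \<le> int (card (A \<inter> {0..<m})) + int (card ({0..l} - A))" using m0 by simp
  moreover have "int (card ({0..l} - A)) = l + 1 - int (card A)"
  proof -
    have "card A \<le> card {0..l}" using A(3) by (intro card_mono) auto
    then show ?thesis using card_Diff_subset[OF fin(1) A(3)] l0 by (simp add: of_nat_diff)
  qed
  moreover have "card (A \<inter> {0..<m}) \<le> mu m (ext m A)"
    by (rule card_le_mu[OF m0 per_ext, of _ id]) (use ext_superset in auto)
  moreover have "card B \<le> mu m (ext m B) + 1" by (rule mu_ext_ge[OF fin(2) m0 B(3)])
  ultimately have "ext m A + ext m B = UNIV"
    using l small by (intro pigeonhole_sum[OF m0 per_ext per_ext]) linarith
  then have "ext m (B + A) = UNIV" by (simp add: ext_plus add.commute)
  then have "m + int (card A) \<le> int (card (B + A))"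
    using card_sumset_ge_mu[OF fin(2,1) m0 B(1,2) per_empty] mu_UNIV[OF m0] by simp
  with l show ?thesis by (simp add: add.commute)
qed

theorem freiman_3k4:
  fixes A B :: "int set"
  assumes fin: "finite A" "finite B" and ne: "A \<noteq> {}" "B \<noteq> {}" and spread: "spread A B"
    and small: "card (A + B) + 4 \<le> 2 * card A + card B" "card (A + B) + 4 \<le> card A + 2 * card B"
  shows "diam_le A (int (card (A + B)) - int (card B))" "diam_le B (int (card (A + B)) - int (card A))"
proof -
  define a where "a = Min A"
  define b where "b = Min B"
  define A' where "A' = (+) (- a) ` A"
  define B' where "B' = (+) (- b) ` B"
  have fin': "finite A'" "finite B'" using fin by (auto simp: A'_def B'_def)
  have mem: "x \<in> A' \<longleftrightarrow> x + a \<in> A" "x \<in> B' \<longleftrightarrow> x + b \<in> B" for x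
    unfolding A'_def B'_def mem_translate by simp_all
  have ab: "a \<in> A" "b \<in> B" "Max A \<in> A" "Max B \<in> B" using fin ne by (auto simp: a_def b_def)
  have bd: "a \<le> x \<and> x \<le> Max A" if "x \<in> A" for x using fin that by (simp add: a_def)
  have bd': "b \<le> x \<and> x \<le> Max B" if "x \<in> B" for x using fin that by (simp add: b_def)
  have A': "0 \<in> A'" "Max A - a \<in> A'" "A' \<subseteq> {0..Max A - a}"
    using ab bd unfolding subset_iff mem by fastforce+
  have B': "0 \<in> B'" "Max B - b \<in> B'" "B' \<subseteq> {0..Max B - b}"
    using ab bd' unfolding subset_iff mem by fastforce+
  have "A' + B' = (+) (- a) ` (A + B')" unfolding A'_def by (rule translate_plus)
  also have "A + B' = (+) (- b) ` (B + A)" unfolding B'_def by (subst add.commute) (rule translate_plus)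
  finally have e: "A' + B' = (+) (- a) ` (+) (- b) ` (B + A)" .
  have c: "card (A' + B') = card (A + B)" unfolding e card_translate by (simp add: add.commute)
  have cA: "card A' = card A" and cB: "card B' = card B" unfolding A'_def B'_def by (rule card_translate)+
  have sp: "spread A' B'" unfolding A'_def B'_def spread_translate by (rule spread)
  have "Max A - a + int (card B) \<le> int (card (A + B)) \<and> Max B - b + int (card A) \<le> int (card (A + B))"
  proof (cases "Max B - b \<le> Max A - a")
    case True
    show ?thesis
      using freiman_normalized[OF fin' A' B' True sp] small unfolding c cA cB by auto
  next
    case False
    have c': "card (B' + A') = card (A + B)" using c by (simp add: add.commute)
    show ?thesis
      using freiman_normalized[OF fin'(2,1) B' A' _ sp[unfolded spread_commute[of A']]] False small
      unfolding c' cA cB by auto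
  qed
  moreover have "diam_le A (Max A - a)" unfolding diam_le_def using bd by (meson diff_mono)
  moreover have "diam_le B (Max B - b)" unfolding diam_le_def using bd' by (meson diff_mono)
  ultimately show "diam_le A (int (card (A + B)) - int (card B))" "diam_le B (int (card (A + B)) - int (card A))"
    unfolding diam_le_def by force+
qed

section \<open>Rectification: integer models of sets modulo p\<close>

lemma freiman_rectified:
  assumes p: "p > 0" and X: "per p X" and A: "A \<subseteq> X" "finite A" "A \<noteq> {}" "diam_le A m"
    and B: "B \<subseteq> Y" "finite B" "B \<noteq> {}" "diam_le B n" and mn: "m + n < p" and spread: "spread A B"
    and small: "mu p (X + Y) + 4 \<le> 2 * card A + card B" "mu p (X + Y) + 4 \<le> card A + 2 * card B"
  shows "diam_le A (int (mu p (X + Y)) - int (card B))" "diam_le B (int (mu p (X + Y)) - int (card A))"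
proof -
  have "card (A + B) \<le> mu p (X + Y)"
  proof (rule card_le_mu[OF p per_plus[OF X]])
    show "x \<in> X + Y" if "x \<in> A + B" for x using that set_plus_mono2[OF A(1) B(1)] by auto
    fix x y assume "x \<in> A + B" "y \<in> A + B" and e: "x mod p = y mod p"
    then obtain a b a' b' where ab: "a \<in> A" "b \<in> B" "x = a + b" "a' \<in> A" "b' \<in> B" "y = a' + b'"
      by (auto elim!: set_plus_elim)
    then have "a - a' \<le> m" "a' - a \<le> m" "b - b' \<le> n" "b' - b \<le> n"
      using A(4) B(4) unfolding diam_le_def by blast+
    then have "\<bar>x - y\<bar> < p" using mn ab by linarith
    moreover have "p dvd x - y" using e by (simp add: mod_eq_dvd_iff)
    ultimately show "x = y" using dvd_imp_le_int[of "x - y" p] p by force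
  qed
  then have "diam_le A (int (card (A + B)) - int (card B))" "diam_le B (int (card (A + B)) - int (card A))"
    "card (A + B) \<le> mu p (X + Y)"
    using freiman_3k4[OF A(2) B(2) A(3) B(3) spread] small by linarith+
  then show "diam_le A (int (mu p (X + Y)) - int (card B))" "diam_le B (int (mu p (X + Y)) - int (card A))"
    unfolding diam_le_def by force+
qed

text \<open>One more element of \<open>Y\<close>, moved by a multiple of \<open>p\<close> as close
  to \<open>B\<close> as possible, keeps the diameters small enough for rectification, and Freiman's
  theorem then pulls it to within \<open>e\<close> of both ends of \<open>B\<close>. All elements so
  obtained are still rectifiable together, and a final application gives diameter
  \<open>e\<close>.\<close>

lemma rectified_extend:
  assumes p: "p > 0" and X: "per p X" and Y: "per p Y" and A: "A \<subseteq> X" "finite A" "A \<noteq> {}"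
    and B: "B \<subseteq> Y" "finite B" "B \<noteq> {}" and spread: "spread A B"
    and small: "mu p (X + Y) + 4 \<le> 2 * card A + card B" "mu p (X + Y) + 4 \<le> card A + 2 * card B"
    and sp: "2 * int (mu p (X + Y)) < p + 4"
    and dA: "diam_le A (int (mu p (X + Y)) - int (card B))" and dB: "diam_le B (int (mu p (X + Y)) - int (card A))"
  obtains Y' where "B \<subseteq> Y'" "Y' \<subseteq> Y" "finite Y'" "mu p Y \<le> card Y'"
    "diam_le Y' (int (mu p (X + Y)) - int (card A))"
proof -
  define s where "s = int (mu p (X + Y))"
  define e where "e = s - int (card A)"
  define u where "u = Min B"
  define v where "v = Max B"
  have uv: "u \<in> B" "v \<in> B" "\<And>b. b \<in> B \<Longrightarrow> u \<le> b \<and> b \<le> v" using B by (auto simp: u_def v_def)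
  have vu: "v - u \<le> e" using dB uv by (auto simp: diam_le_def e_def s_def)
  have "diam_le B (v - u)" unfolding diam_le_def using uv(3) by (meson diff_mono)
  then have cB: "int (card B) \<le> v - u + 1" by (rule card_le_diam[OF B(2,3)])
  have small': "s + 4 \<le> 2 * int (card A) + int (card B)" "s + 4 \<le> int (card A) + 2 * int (card B)"
    using small by (simp_all add: s_def)
  define Y' where "Y' = {y \<in> Y. v - e \<le> y \<and> y \<le> u + e}"
  have finY': "finite Y'" by (rule finite_subset[of _ "{v - e..u + e}"]) (auto simp: Y'_def)
  have BY': "B \<subseteq> Y'" using B(1) uv vu by (force simp: Y'_def)
  have cBY': "card B \<le> card Y'" by (rule card_mono[OF finY' BY'])
  have "mu p Y \<le> card Y'"
  proof (rule mu_le_card[OF finY'])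
    fix y0 assume y0: "y0 \<in> Y"
    \<comment> \<open>The window of length \<open>p\<close> from \<open>c\<close> on is centred at
      the middle of \<open>{u..v}\<close>, so \<open>y\<close> is at most
      \<open>(p + v - u) / 2\<close> away from either end.\<close>
    define c where "c = (u + v - p) div 2 + 1"
    define y where "y = c + (y0 - c) mod p"
    have ym: "y mod p = y0 mod p" by (simp add: y_def mod_simps)
    have yY: "y \<in> Y" using per_cong[OF Y ym] y0 by simp
    have "c \<le> y" "y < c + p" using p by (auto simp: y_def)
    then have yc: "2 * (v - y) \<le> p + (v - u)" "2 * (y - u) \<le> p + (v - u)" by (auto simp: c_def)
    define w where "w = (p + (v - u)) div 2"
    have "card A \<ge> 1" using A by (simp add: Suc_le_eq card_gt_0_iff)
    then have w: "v - y \<le> w" "y - u \<le> w" "v - u \<le> w" "2 * w \<le> p + (v - u)"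
      using yc vu small' sp unfolding w_def e_def s_def by auto
    have "diam_le (insert y B) w"
      unfolding diam_le_def using w uv by (auto; smt (verit))
    moreover have "card B \<le> card (insert y B)" using B(2) by (intro card_mono) auto
    moreover have "int (mu p (X + Y)) - int (card B) + w < p"
      using w vu small' sp unfolding e_def s_def by linarith
    ultimately have "diam_le (insert y B) e"
      unfolding e_def s_def using B yY A small dA spread_mono[OF spread, of A "insert y B"]
      by (intro freiman_rectified(2)[OF p X, of A _ "insert y B" Y w]) auto
    then have "y \<in> Y'" using uv(1,2) yY by (auto simp: Y'_def diam_le_def)
    then show "\<exists>a\<in>Y'. y0 mod p = a mod p" using ym by metis
  qed
  moreover have "diam_le Y' (int (mu p (X + Y)) - int (card A))"
  proof (rule freiman_rectified(2)[OF p X A dA])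
    show "Y' \<subseteq> Y" "Y' \<noteq> {}" "spread A Y'" using BY' B spread_mono[OF spread, of A Y'] by (auto simp: Y'_def)
    show "finite Y'" by (rule finY')
    show "diam_le Y' (2 * e - (v - u))" by (auto simp: diam_le_def Y'_def)
    show "int (mu p (X + Y)) - int (card B) + (2 * e - (v - u)) < p"
    proof -
      \<comment> \<open>The two smallness conditions add up to
        \<open>2 s + 8 <= 3 (|A| + |B|)\<close>; together with \<open>|B| <= v - u + 1\<close> this
        gives the bound.\<close>
      have "3 * (2 * e + (s - int (card B)) - (v - u)) \<le> 5 * s - 13"
        using cB small' unfolding e_def by (simp add: algebra_simps)
      moreover have "s \<ge> 0" "2 * s < p + 4" using sp by (simp_all add: s_def)
      ultimately have "2 * e + (s - int (card B)) - (v - u) < p" by simp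
      then show ?thesis by (simp add: s_def)
    qed
  qed (use small cBY' in linarith)+
  ultimately show thesis using that[OF BY' _ finY'] by (auto simp: Y'_def)
qed

text \<open>\<open>n\<close> is a length, so the arc has up to \<open>n + 1\<close> residues:
  \<open>n = |X| + r\<close> matches the \<open>|X| + r + 1\<close> allowed in the theorem.\<close>

definition arc :: "int \<Rightarrow> int \<Rightarrow> int set \<Rightarrow> bool" where
  "arc p n X \<longleftrightarrow> (\<exists>c. \<forall>x\<in>X. (x - c) mod p \<le> n)"

lemma arc_mono: "arc p m X \<Longrightarrow> m \<le> n \<Longrightarrow> arc p n X"
  unfolding arc_def by (meson order_trans)

text \<open>A diameter below \<open>p\<close> keeps the residues of \<open>A\<close> distinct, so by
  cardinality they are all the residues of \<open>X\<close>.\<close>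

lemma arcI:
  assumes p: "p > 0" and A: "finite A" "A \<subseteq> X" "diam_le A n" and X: "per p X" "mu p X \<le> card A" and n: "n < p"
  shows "arc p n X"
proof (cases "A = {}")
  case True
  then have "X = {}" using mu_pos_iff[OF p X(1)] X(2) by simp
  then show ?thesis by (simp add: arc_def)
next
  case False
  have inj: "x = y" if "x \<in> A" "y \<in> A" "x mod p = y mod p" for x y
  proof -
    have "x - y \<le> n" "y - x \<le> n" using A(3) that by (auto simp: diam_le_def)
    moreover have "p dvd x - y" using that by (simp add: mod_eq_dvd_iff)
    ultimately show ?thesis using dvd_imp_le_int[of "x - y" p] p n by force
  qed
  have "card A = mu p (ext p A)" using mu_ext[OF p, of A] inj by (simp add: card_image inj_on_def)
  then have XA: "ext p A = X" using mu_eq_imp_eq[OF p per_ext X(1) ext_subset[OF X(1) A(2)]] X(2) by simp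
  have "(x - Min A) mod p \<le> n" if "x \<in> X" for x
  proof -
    have "x \<in> ext p A" using that XA by simp
    then obtain a where a: "a \<in> A" "x mod p = a mod p" by (auto simp: ext_def)
    have "a - Min A \<le> n" "a \<ge> Min A" using A(1,3) a(1) False by (auto simp: diam_le_def)
    moreover have "(x - Min A) mod p = (a - Min A) mod p" using a(2) by (metis mod_diff_left_eq)
    ultimately show ?thesis using n by simp
  qed
  then show ?thesis by (auto simp: arc_def)
qed

text \<open>Both sets are extended from the same starting pair \<open>A\<close>, \<open>B\<close>.
  One further use of Freiman's theorem on the two extensions replaces \<open>|B|\<close> by
  \<open>|Y|\<close> in the bound.\<close>

lemma rectified_arc:
  assumes p: "p > 0" and X: "per p X" and Y: "per p Y" and A: "A \<subseteq> X" "finite A" "A \<noteq> {}" "diam_le A m"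
    and B: "B \<subseteq> Y" "finite B" "B \<noteq> {}" "diam_le B n" and mn: "m + n < p" and spread: "spread A B"
    and small: "mu p (X + Y) + 4 \<le> 2 * card A + card B" "mu p (X + Y) + 4 \<le> card A + 2 * card B"
    and sp: "2 * int (mu p (X + Y)) < p + 4"
  shows "arc p (int (mu p (X + Y)) - int (mu p Y)) X"
proof -
  note fr = freiman_rectified[OF p X A B mn spread small]
  obtain Y' where Y': "B \<subseteq> Y'" "Y' \<subseteq> Y" "finite Y'" "mu p Y \<le> card Y'"
    "diam_le Y' (int (mu p (X + Y)) - int (card A))"
    by (rule rectified_extend[OF p X Y A(1-3) B(1-3) spread small sp fr])
  have spread': "spread B A" using spread spread_commute by blast
  obtain X' where X': "A \<subseteq> X'" "X' \<subseteq> X" "finite X'" "mu p X \<le> card X'"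
    "diam_le X' (int (mu p (X + Y)) - int (card B))"
    using rectified_extend[OF p Y X B(1-3) A(1-3) spread'] small sp fr by (auto simp: add.commute)
  have ne: "X' \<noteq> {}" "Y' \<noteq> {}" using X' Y' A B by auto
  have "card A \<le> card X'" "card B \<le> card Y'" using X' Y' by (auto intro: card_mono)
  moreover have "int (card B) \<le> int (mu p (X + Y))" "int (card A) \<le> int (mu p (X + Y))"
    using fr A(3) B(3) by (force simp: diam_le_def)+
  ultimately have "diam_le X' (int (mu p (X + Y)) - int (card Y'))"
    using small sp by (intro freiman_rectified(1)[OF p X X'(2,3) ne(1) X'(5) Y'(2,3) ne(2) Y'(5)]
      spread_mono[OF spread X'(1) Y'(1)]) linarith+
  then have "diam_le X' (int (mu p (X + Y)) - int (mu p Y))" using Y'(4) by (force simp: diam_le_def)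
  moreover have "int (mu p (X + Y)) - int (mu p Y) < p" using mu_le[OF p, of "X + Y"] mu_pos_iff[OF p Y] B by auto
  ultimately show ?thesis by (intro arcI[OF p X'(3,2) _ X X'(4)])
qed

section \<open>Fourier coefficients and half circles\<close>

definition fourier :: "nat \<Rightarrow> int set \<Rightarrow> int \<Rightarrow> complex" where
  "fourier p X t = (\<Sum>x\<in>X \<inter> {0..<int p}. cis (2 * pi * real_of_int (t * x) / real p))"

lemma cis_eq_one_iff:
  assumes "p > 0" shows "cis (2 * pi * real_of_int n / real p) = 1 \<longleftrightarrow> int p dvd n"
proof
  assume "cis (2 * pi * real_of_int n / real p) = 1"
  then have "cos (2 * pi * real_of_int n / real p) = 1" by (simp add: complex_eq_iff)
  then obtain k :: int where "2 * pi * real_of_int n / real p = real_of_int k * 2 * pi"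
    using cos_one_2pi_int by blast
  then have "real_of_int n = real_of_int (k * int p)" using assms by (simp add: field_simps)
  then show "int p dvd n" by (metis dvd_triv_right of_int_eq_iff)
next
  assume "int p dvd n"
  then obtain k where "n = int p * k" by auto
  then have "2 * pi * real_of_int n / real p = 2 * pi * real_of_int k" using assms by simp
  then show "cis (2 * pi * real_of_int n / real p) = 1" by (simp add: cis_multiple_2pi)
qed

lemma character_sum:
  assumes "p > 0"
  shows "(\<Sum>t<p. cis (2 * pi * real_of_int (int t * n) / real p)) = (if int p dvd n then of_nat p else 0)"
proof -
  define w where "w = cis (2 * pi * real_of_int n / real p)"
  have "cis (2 * pi * real_of_int (int t * n) / real p) = w ^ t" for t
  proof -
    have "2 * pi * real_of_int (int t * n) / real p = real t * (2 * pi * real_of_int n / real p)" by simp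
    then show ?thesis by (simp only: w_def Complex.DeMoivre)
  qed
  then have s: "(\<Sum>t<p. cis (2 * pi * real_of_int (int t * n) / real p)) = (\<Sum>t<p. w ^ t)" by simp
  have "w ^ p = cis (2 * pi * real_of_int n)" using assms by (simp add: w_def Complex.DeMoivre)
  then have wp: "w ^ p = 1" by (simp add: cis_multiple_2pi)
  show ?thesis
  proof (cases "int p dvd n")
    case True
    then have "w = 1" using cis_eq_one_iff[OF assms] by (simp add: w_def)
    then show ?thesis using s True by simp
  next
    case False
    then have "w \<noteq> 1" using cis_eq_one_iff[OF assms] by (simp add: w_def)
    then have "(\<Sum>t<p. w ^ t) = 0" using wp geometric_sum[of w p] by simp
    then show ?thesis using s False by simp
  qed
qed

lemma cis_shift:
  "cis (2 * pi * real_of_int (t * x) / real p) * cnj (cis (2 * pi * real_of_int (t * y) / real p))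
    = cis (2 * pi * real_of_int (t * (x - y)) / real p)"
  by (simp add: cis_cnj cis_mult algebra_simps diff_divide_distrib[symmetric])

lemma parseval:
  assumes "p > 0"
  shows "(\<Sum>t<p. (cmod (fourier p X (int t)))\<^sup>2) = real p * real (mu (int p) X)"
proof -
  let ?X = "X \<inter> {0..<int p}"
  have "complex_of_real (\<Sum>t<p. (cmod (fourier p X (int t)))\<^sup>2) = (\<Sum>t<p. fourier p X (int t) * cnj (fourier p X (int t)))"
    by (simp add: complex_norm_square[symmetric] del: of_real_power)
  also have "\<dots> = (\<Sum>t<p. \<Sum>x\<in>?X. \<Sum>y\<in>?X. cis (2 * pi * real_of_int (int t * (x - y)) / real p))"
    unfolding fourier_def cnj_sum sum_product cis_shift by simp
  also have "\<dots> = (\<Sum>x\<in>?X. \<Sum>y\<in>?X. \<Sum>t<p. cis (2 * pi * real_of_int (int t * (x - y)) / real p))"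
    by (subst sum.swap, rule sum.cong[OF refl], subst sum.swap, rule refl)
  also have "\<dots> = (\<Sum>x\<in>?X. \<Sum>y\<in>?X. if x = y then of_nat p else 0)"
  proof (intro sum.cong refl)
    fix x y assume xy: "x \<in> ?X" "y \<in> ?X"
    have "int p dvd x - y \<longleftrightarrow> x = y"
    proof
      assume "int p dvd x - y"
      then have "x mod int p = y mod int p" by (simp add: mod_eq_dvd_iff)
      then show "x = y" using xy by simp
    qed simp
    then show "(\<Sum>t<p. cis (2 * pi * real_of_int (int t * (x - y)) / real p)) = (if x = y then of_nat p else 0)"
      using character_sum[OF assms, of "x - y"] by simp
  qed
  also have "\<dots> = of_nat p * of_nat (card ?X)" by (simp add: sum.delta)
  also have "\<dots> = complex_of_real (real p * real (mu (int p) X))" by (simp add: mu_def)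
  finally show ?thesis using of_real_eq_iff by blast
qed

lemma sum_product3:
  fixes f g h :: "_ \<Rightarrow> 'c::comm_semiring_0"
  shows "(\<Sum>x\<in>A. f x) * (\<Sum>y\<in>B. g y) * (\<Sum>z\<in>C. h z) = (\<Sum>x\<in>A. \<Sum>y\<in>B. \<Sum>z\<in>C. (f x * g y) * h z)"
proof -
  have "(\<Sum>x\<in>A. f x) * (\<Sum>y\<in>B. g y) * (\<Sum>z\<in>C. h z) = (\<Sum>x\<in>A. \<Sum>y\<in>B. f x * g y) * (\<Sum>z\<in>C. h z)"
    by (simp only: sum_product)
  also have "\<dots> = (\<Sum>x\<in>A. \<Sum>y\<in>B. (f x * g y) * (\<Sum>z\<in>C. h z))" by (simp only: sum_distrib_right)
  also have "\<dots> = (\<Sum>x\<in>A. \<Sum>y\<in>B. \<Sum>z\<in>C. (f x * g y) * h z)" by (simp only: sum_distrib_left)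
  finally show ?thesis .
qed

text \<open>Orthogonality counts the triples with \<open>x + y\<close> congruent to
  \<open>s\<close>, and each pair \<open>x\<close>, \<open>y\<close> has exactly one such
  \<open>s\<close>.\<close>

lemma sumset_character_sum:
  assumes p: "p > 0" and X: "per (int p) X"
  shows "(\<Sum>t<p. fourier p X (int t) * fourier p Y (int t) * cnj (fourier p (X + Y) (int t)))
    = of_nat (p * mu (int p) X * mu (int p) Y)"
proof -
  let ?X = "X \<inter> {0..<int p}" and ?Y = "Y \<inter> {0..<int p}" and ?S = "(X + Y) \<inter> {0..<int p}"
  have "(\<Sum>t<p. fourier p X (int t) * fourier p Y (int t) * cnj (fourier p (X + Y) (int t)))
    = (\<Sum>t<p. \<Sum>x\<in>?X. \<Sum>y\<in>?Y. \<Sum>s\<in>?S. cis (2 * pi * real_of_int (int t * (x + y - s)) / real p))"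
  proof (rule sum.cong[OF refl])
    fix t
    have "fourier p X (int t) * fourier p Y (int t) * cnj (fourier p (X + Y) (int t)) =
      (\<Sum>x\<in>?X. \<Sum>y\<in>?Y. \<Sum>s\<in>?S. (cis (2 * pi * real_of_int (int t * x) / real p) *
        cis (2 * pi * real_of_int (int t * y) / real p)) * cnj (cis (2 * pi * real_of_int (int t * s) / real p)))"
      unfolding fourier_def cnj_sum by (rule sum_product3)
    also have "\<dots> = (\<Sum>x\<in>?X. \<Sum>y\<in>?Y. \<Sum>s\<in>?S. cis (2 * pi * real_of_int (int t * (x + y - s)) / real p))"
    proof (intro sum.cong refl)
      fix x y s
      have "cis (2 * pi * real_of_int (int t * x) / real p) * cis (2 * pi * real_of_int (int t * y) / real p)
        = cis (2 * pi * real_of_int (int t * (x + y)) / real p)"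
        by (simp add: cis_mult algebra_simps add_divide_distrib)
      then show "(cis (2 * pi * real_of_int (int t * x) / real p) *
        cis (2 * pi * real_of_int (int t * y) / real p)) * cnj (cis (2 * pi * real_of_int (int t * s) / real p))
        = cis (2 * pi * real_of_int (int t * (x + y - s)) / real p)"
        by (simp only: cis_shift)
    qed
    finally show "fourier p X (int t) * fourier p Y (int t) * cnj (fourier p (X + Y) (int t)) =
      (\<Sum>x\<in>?X. \<Sum>y\<in>?Y. \<Sum>s\<in>?S. cis (2 * pi * real_of_int (int t * (x + y - s)) / real p))" .
  qed
  also have "\<dots> = (\<Sum>x\<in>?X. \<Sum>y\<in>?Y. \<Sum>s\<in>?S. \<Sum>t<p. cis (2 * pi * real_of_int (int t * (x + y - s)) / real p))"
    by (subst sum.swap, rule sum.cong[OF refl], subst sum.swap, rule sum.cong[OF refl], subst sum.swap, rule refl)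
  also have "\<dots> = (\<Sum>x\<in>?X. \<Sum>y\<in>?Y. of_nat p)"
  proof (intro sum.cong refl)
    fix x y assume xy: "x \<in> ?X" "y \<in> ?Y"
    have "x + y \<in> X + Y" using xy by (intro set_plus_intro) auto
    then have r: "(x + y) mod int p \<in> ?S" using per_mod[OF per_plus[OF X]] p by simp
    have "int p dvd x + y - s \<longleftrightarrow> s = (x + y) mod int p" if "s \<in> ?S" for s
      using that by (auto simp: mod_eq_dvd_iff[symmetric])
    then have "(\<Sum>s\<in>?S. \<Sum>t<p. cis (2 * pi * real_of_int (int t * (x + y - s)) / real p))
      = (\<Sum>s\<in>?S. if s = (x + y) mod int p then of_nat p else 0)"
      by (intro sum.cong refl) (simp only: character_sum[OF p])
    also have "\<dots> = of_nat p" using r by (simp add: sum.delta)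
    finally show "(\<Sum>s\<in>?S. \<Sum>t<p. cis (2 * pi * real_of_int (int t * (x + y - s)) / real p)) = of_nat p" .
  qed
  also have "\<dots> = of_nat (p * mu (int p) X * mu (int p) Y)" by (simp add: mu_def)
  finally show ?thesis .
qed

text \<open>Frequency 0 contributes \<open>x y s\<close> to the character sum \<open>p x y\<close>,
  so the other frequencies must produce \<open>x y (p - s)\<close>. Maximizing the product of the
  two moduli gives one frequency that serves both sets.\<close>

lemma large_fourier_coefficient:
  assumes p: "p > 1" and X: "per (int p) X" and s: "mu (int p) (X + Y) < p"
  defines "x \<equiv> real (mu (int p) X)" and "y \<equiv> real (mu (int p) Y)" and "s \<equiv> real (mu (int p) (X + Y))"
  obtains t where "0 < t" "t < p" "(x * y)\<^sup>2 * (p - s) \<le>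
    cmod (fourier p X (int t)) * cmod (fourier p Y (int t)) * ((x + y) / 2 * (p - (x + y) / 2) * s)"
proof -
  define f where "f t = cmod (fourier p X (int t))" for t
  define g where "g t = cmod (fourier p Y (int t))" for t
  define k where "k t = cmod (fourier p (X + Y) (int t))" for t
  let ?I = "{1..<p}"
  have split0: "(\<Sum>t<p. F t) = F 0 + (\<Sum>t\<in>?I. F t)" for F :: "nat \<Rightarrow> 'c::comm_monoid_add"
    using p by (simp add: lessThan_atLeast0 sum.atLeast_Suc_lessThan)
  have zero: "fourier p Z 0 = of_nat (mu (int p) Z)" for Z by (simp add: fourier_def mu_def)
  have pars: "(\<Sum>t\<in>?I. (cmod (fourier p Z (int t)))\<^sup>2) = p * real (mu (int p) Z) - (real (mu (int p) Z))\<^sup>2" for Z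
    using parseval[of p Z] split0[of "\<lambda>t. (cmod (fourier p Z (int t)))\<^sup>2"] p by (simp add: zero)
  have "(\<Sum>t\<in>?I. fourier p X (int t) * fourier p Y (int t) * cnj (fourier p (X + Y) (int t)))
    = complex_of_real (x * y * (p - s))"
    using sumset_character_sum[OF _ X, of Y] p
      split0[of "\<lambda>t. fourier p X (int t) * fourier p Y (int t) * cnj (fourier p (X + Y) (int t))"]
    by (simp add: zero x_def y_def s_def algebra_simps)
  then have "cmod (complex_of_real (x * y * (p - s))) =
    cmod (\<Sum>t\<in>?I. fourier p X (int t) * fourier p Y (int t) * cnj (fourier p (X + Y) (int t)))"
    by (rule arg_cong[OF sym])
  also have "\<dots> \<le> (\<Sum>t\<in>?I. cmod (fourier p X (int t) * fourier p Y (int t) * cnj (fourier p (X + Y) (int t))))"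
    by (rule norm_sum)
  also have "\<dots> = (\<Sum>t\<in>?I. f t * g t * k t)" by (simp add: norm_mult f_def g_def k_def)
  finally have "cmod (complex_of_real (x * y * (p - s))) \<le> (\<Sum>t\<in>?I. f t * g t * k t)" .
  then have main: "x * y * (p - s) \<le> (\<Sum>t\<in>?I. f t * g t * k t)"
    unfolding norm_of_real by linarith
  have "finite ((\<lambda>t. f t * g t) ` ?I)" "(\<lambda>t. f t * g t) ` ?I \<noteq> {}" using p by auto
  then have "Max ((\<lambda>t. f t * g t) ` ?I) \<in> (\<lambda>t. f t * g t) ` ?I" by (rule Max_in)
  then obtain t0 where t0: "t0 \<in> ?I" "f t0 * g t0 = Max ((\<lambda>t. f t * g t) ` ?I)" by force
  define M where "M = f t0 * g t0"
  have M: "f t * g t \<le> M" if "t \<in> ?I" for t unfolding M_def t0(2) using that by (intro Max_ge) auto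
  have pos: "f t \<ge> 0" "g t \<ge> 0" "k t \<ge> 0" for t by (auto simp: f_def g_def k_def)
  have M0: "M \<ge> 0" using pos by (simp add: M_def)
  \<comment> \<open>One square root of \<open>f t * g t\<close> is bounded by its maximum and the
    other is kept, so that Cauchy-Schwarz leaves the sum of \<open>f t * g t\<close>, which Parseval
    controls.\<close>
  have "(\<Sum>t\<in>?I. f t * g t * k t) \<le> (\<Sum>t\<in>?I. sqrt M * (sqrt (f t * g t) * k t))"
  proof (rule sum_mono)
    fix t assume "t \<in> ?I"
    then have "sqrt (f t * g t) * sqrt (f t * g t) \<le> sqrt M * sqrt (f t * g t)"
      using M by (intro mult_right_mono) (auto simp: pos)
    then have "f t * g t \<le> sqrt M * sqrt (f t * g t)" using pos[of t] by simp
    then show "f t * g t * k t \<le> sqrt M * (sqrt (f t * g t) * k t)"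
      using mult_right_mono[OF _ pos(3)] by (metis mult.assoc)
  qed
  also have "\<dots> = sqrt M * (\<Sum>t\<in>?I. sqrt (f t * g t) * k t)" by (simp add: sum_distrib_left)
  finally have "x * y * (p - s) \<le> sqrt M * (\<Sum>t\<in>?I. sqrt (f t * g t) * k t)" using main by simp
  moreover have "0 \<le> x * y * (p - s)" using s by (simp add: x_def y_def s_def)
  ultimately have "(x * y * (p - s))\<^sup>2 \<le> (sqrt M * (\<Sum>t\<in>?I. sqrt (f t * g t) * k t))\<^sup>2"
    by (rule power_mono)
  also have "\<dots> = M * (\<Sum>t\<in>?I. sqrt (f t * g t) * k t)\<^sup>2" using M0 by (simp add: power_mult_distrib)
  also have "\<dots> \<le> M * ((\<Sum>t\<in>?I. (sqrt (f t * g t))\<^sup>2) * (\<Sum>t\<in>?I. (k t)\<^sup>2))"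
    by (intro mult_left_mono Cauchy_Schwarz_ineq_sum M0)
  also have "\<dots> \<le> M * (((x + y) / 2 * (p - (x + y) / 2)) * (p * s - s\<^sup>2))"
  proof (intro mult_left_mono mult_mono M0)
    have "(\<Sum>t\<in>?I. (sqrt (f t * g t))\<^sup>2) \<le> (\<Sum>t\<in>?I. ((f t)\<^sup>2 + (g t)\<^sup>2) / 2)"
    proof (rule sum_mono)
      fix t
      show "(sqrt (f t * g t))\<^sup>2 \<le> ((f t)\<^sup>2 + (g t)\<^sup>2) / 2"
        using sum_squares_bound[of "f t" "g t"] pos[of t] by simp
    qed
    also have "\<dots> = ((p * x - x\<^sup>2) + (p * y - y\<^sup>2)) / 2"
      using pars[of X] pars[of Y] by (simp add: sum.distrib sum_divide_distrib[symmetric] f_def g_def x_def y_def)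
    also have "\<dots> \<le> (x + y) / 2 * (p - (x + y) / 2)"
      using sum_squares_bound[of x y] by (simp add: field_simps power2_eq_square)
    finally show fg: "(\<Sum>t\<in>?I. (sqrt (f t * g t))\<^sup>2) \<le> (x + y) / 2 * (p - (x + y) / 2)" .
    show "0 \<le> (x + y) / 2 * (p - (x + y) / 2)" by (rule order_trans[OF sum_nonneg fg]) simp
    show "(\<Sum>t\<in>?I. (k t)\<^sup>2) \<le> p * s - s\<^sup>2" using pars[of "X + Y"] by (simp add: k_def s_def)
  qed (simp add: sum_nonneg)
  also have "\<dots> = (M * ((x + y) / 2 * (p - (x + y) / 2) * s)) * (p - s)"
    by (simp add: field_simps power2_eq_square)
  finally have "((x * y)\<^sup>2 * (p - s)) * (p - s) \<le> (M * ((x + y) / 2 * (p - (x + y) / 2) * s)) * (p - s)"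
    by (simp add: power2_eq_square algebra_simps)
  moreover have "p - s > 0" using s by (simp add: s_def)
  ultimately have "(x * y)\<^sup>2 * (p - s) \<le> M * ((x + y) / 2 * (p - (x + y) / 2) * s)" by (rule mult_right_le_imp_le)
  then show thesis using that[of t0] t0(1) by (simp add: M_def f_def g_def)
qed

section \<open>Half circles rich in elements\<close>

text \<open>The sign switches at \<open>a\<close> if \<open>a < 0\<close> and at
  \<open>a - pi\<close> otherwise, and \<open>cos v / 2\<close> is an antiderivative of the weight.
  On this interval the weight is nonnegative with total mass 1, so it defines an average.\<close>

lemma half_wave_integral:
  assumes "- pi \<le> a" "a < pi"
  shows "((\<lambda>v. (if v \<le> a \<and> a < v + pi then 1 else -1) * (- sin v / 2)) has_integral cos a) {-pi..0}"
proof -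
  have plus: "((\<lambda>v. - sin v / 2) has_integral (cos c / 2 - cos b / 2)) {b..c}" if "b \<le> c" for b c :: real
    by (rule fundamental_theorem_of_calculus[OF that])
       (auto intro!: derivative_eq_intros simp: has_real_derivative_iff_has_vector_derivative[symmetric])
  have minus: "((\<lambda>v. sin v / 2) has_integral (cos b / 2 - cos c / 2)) {b..c}" if "b \<le> c" for b c :: real
    using has_integral_neg[OF plus[OF that]] by simp
  let ?F = "\<lambda>v. (if v \<le> a \<and> a < v + pi then 1 else -1) * (- sin v / 2)"
  show ?thesis
  proof (cases "a < 0")
    case True
    have 1: "(?F has_integral (cos a / 2 - cos (-pi) / 2)) {-pi..a}"
      by (rule has_integral_spike_finite[OF _ _ plus, of "{}"]) (use assms True in auto)
    have 2: "(?F has_integral (cos a / 2 - cos 0 / 2)) {a..0}"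
      by (rule has_integral_spike_finite[OF _ _ minus, of "{a}"]) (use assms True in auto)
    show ?thesis using has_integral_combine[OF _ _ 1 2] assms True by simp
  next
    case False
    have 1: "(?F has_integral (cos (-pi) / 2 - cos (a - pi) / 2)) {-pi..a - pi}"
      by (rule has_integral_spike_finite[OF _ _ minus, of "{}"]) (use assms False in auto)
    have 2: "(?F has_integral (cos 0 / 2 - cos (a - pi) / 2)) {a - pi..0}"
      by (rule has_integral_spike_finite[OF _ _ plus, of "{a - pi}"]) (use assms False in auto)
    have "cos (a - pi) = - cos a" by (simp add: cos_diff)
    then show ?thesis using has_integral_combine[OF _ _ 1 2] assms False by simp
  qed
qed

text \<open>Averaging the half circles \<open>[v, v + \<pi>)\<close> against the weight \<open>- sin v / 2\<close> recovers the cosines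
  whose sum is the modulus of the Fourier coefficient.\<close>

lemma half_circle:
  assumes p: "p > 0" and X: "per (int p) X"
  obtains w where "real (mu (int p) X) + cmod (fourier p X 1) \<le> 2 * real (card (X \<inter> {w..w + (int p - 1) div 2}))"
proof -
  let ?W = "\<lambda>w. card (X \<inter> {w..w + (int p - 1) div 2})"
  define Z where "Z = fourier p X 1"
  define \<theta> where "\<theta> = Arg Z"
  \<comment> \<open>In the window from \<open>c\<close> on, every residue has a representative whose
    phase relative to \<open>\<theta>\<close> lies in \<open>[-pi, pi)\<close>.\<close>
  define c where "c = \<lceil>(\<theta> - pi) * p / (2 * pi)\<rceil>"
  define I where "I = X \<inter> {c..<c + int p}"
  define \<psi> where "\<psi> x = 2 * pi * real_of_int x / p - \<theta>" for x :: int
  have finI: "finite I" by (simp add: I_def)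
  have cardI: "card I = mu (int p) X" unfolding I_def by (rule mu_window) (use p X in auto)
  have psi: "- pi \<le> \<psi> x" "\<psi> x < pi" if "x \<in> I" for x
  proof -
    have "(\<theta> - pi) * p / (2 * pi) \<le> c" "c < (\<theta> - pi) * p / (2 * pi) + 1" by (auto simp: c_def) linarith
    moreover have "real_of_int c \<le> x" "x \<le> real_of_int c + p - 1" using that by (auto simp: I_def)
    ultimately have "(\<theta> - pi) * p / (2 * pi) \<le> x" "x < (\<theta> - pi) * p / (2 * pi) + p" by linarith+
    then show "- pi \<le> \<psi> x" "\<psi> x < pi" using p by (auto simp: \<psi>_def field_simps)
  qed
  have ZI: "Z = (\<Sum>x\<in>I. cis (2 * pi * real_of_int x / p))"
  proof -
    have "bij_betw (\<lambda>x. x mod int p) I (X \<inter> {0..<int p})"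
      unfolding bij_betw_def
    proof
      show inj: "inj_on (\<lambda>x. x mod int p) I"
      proof (rule inj_onI)
        fix x y assume xy: "x \<in> I" "y \<in> I" "x mod int p = y mod int p"
        then have "int p dvd x - y" by (simp add: mod_eq_dvd_iff)
        moreover have "\<bar>x - y\<bar> < int p" using xy by (auto simp: I_def)
        ultimately show "x = y" using dvd_imp_le_int[of "x - y" "int p"] p by force
      qed
      have "(\<lambda>x. x mod int p) ` I \<subseteq> X \<inter> {0..<int p}" using p per_mod[OF X] by (auto simp: I_def)
      then show "(\<lambda>x. x mod int p) ` I = X \<inter> {0..<int p}"
        by (rule card_subset_eq[rotated]) (use cardI card_image[OF inj] in \<open>auto simp: mu_def\<close>)
    qed
    then have "Z = (\<Sum>x\<in>I. cis (2 * pi * real_of_int (x mod int p) / p))"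
      unfolding Z_def fourier_def using sum.reindex_bij_betw[of "\<lambda>x. x mod int p" I _ "\<lambda>x. cis (2 * pi * real_of_int x / p)"]
      by simp
    moreover have "cis (2 * pi * real_of_int (x mod int p) / p) = cis (2 * pi * real_of_int x / p)" for x
    proof -
      have "real_of_int x = real_of_int (x mod int p) + real_of_int (x div int p) * p"
        by (metis add.commute of_int_add of_int_mult of_int_of_nat_eq mult_div_mod_eq mult.commute)
      then have "2 * pi * real_of_int x / p = 2 * pi * real_of_int (x mod int p) / p + 2 * pi * real_of_int (x div int p)"
        using p by (simp add: field_simps)
      then show ?thesis by (simp add: cis_mult[symmetric] cis_multiple_2pi)
    qed
    ultimately show ?thesis by simp
  qed
  have "cmod Z = Re (Z * cis (- \<theta>))"
  proof -
    have "Z = rcis (cmod Z) \<theta>" by (simp add: \<theta>_def rcis_cmod_Arg)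
    then have "Z * cis (- \<theta>) = complex_of_real (cmod Z)" by (metis rcis_def cis_mult mult.assoc add.right_inverse cis_zero mult.right_neutral)
    then show ?thesis by simp
  qed
  also have "\<dots> = (\<Sum>x\<in>I. cos (\<psi> x))"
    unfolding ZI sum_distrib_right Re_sum cis_mult by (simp add: \<psi>_def)
  finally have ZM: "cmod Z = (\<Sum>x\<in>I. cos (\<psi> x))" .
  have "?W w \<le> mu (int p) X" for w
  proof -
    have "?W w \<le> card (X \<inter> {w..<w + int p})" using p by (intro card_mono) auto
    then show ?thesis using mu_window[OF _ X] p by simp
  qed
  then obtain w where w: "\<And>v. ?W v \<le> ?W w"
    using ex_has_greatest_nat[of "\<lambda>_. True" 0 ?W "Suc (mu (int p) X)"] by (auto simp: less_Suc_eq_le)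
  define K where "K = 2 * real (?W w) - real (mu (int p) X)"
  let ?e = "\<lambda>x v. if v \<le> \<psi> x \<and> \<psi> x < v + pi then 1 else (-1 :: real)"
  have "((\<lambda>v. \<Sum>x\<in>I. ?e x v * (- sin v / 2)) has_integral (\<Sum>x\<in>I. cos (\<psi> x))) {-pi..0}"
    by (intro has_integral_sum finI half_wave_integral psi)
  moreover have "((\<lambda>v. K * (- sin v / 2)) has_integral K * 1) {-pi..0}"
  proof (rule has_integral_mult_right)
    have "((\<lambda>v. - sin v / 2) has_integral (cos 0 / 2 - cos (-pi) / 2)) {-pi..0}"
      by (rule fundamental_theorem_of_calculus)
         (auto intro!: derivative_eq_intros simp: has_real_derivative_iff_has_vector_derivative[symmetric])
    then show "((\<lambda>v. - sin v / 2) has_integral 1) {-pi..0}" by simp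
  qed
  ultimately have "(\<Sum>x\<in>I. cos (\<psi> x)) \<le> K * 1"
  proof (rule has_integral_le)
    fix v :: real assume v: "v \<in> {-pi..0}"
    define J where "J = {x \<in> I. v \<le> \<psi> x \<and> \<psi> x < v + pi}"
    have "(\<Sum>x\<in>I. ?e x v) = (\<Sum>x\<in>I. 2 * (if x \<in> J then 1 else 0) - 1)"
      by (intro sum.cong) (auto simp: J_def)
    also have "\<dots> = 2 * real (card J) - real (card I)"
      using finI by (simp add: sum_subtractf sum_distrib_left[symmetric] J_def sum.If_cases Int_def)
    also have "\<dots> \<le> K"
    proof -
      \<comment> \<open>The half circle pulls back to a half-open real interval of length
        \<open>p / 2\<close>. Its integers start at the rounded-up left end \<open>u\<close> and go
        no further than \<open>u + (p - 1) div 2\<close>.\<close>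
      define u where "u = \<lceil>(v + \<theta>) * p / (2 * pi)\<rceil>"
      have "J \<subseteq> X \<inter> {u..u + (int p - 1) div 2}"
      proof
        fix x assume x: "x \<in> J"
        define r where "r = (v + \<theta>) * p / (2 * pi)"
        have r: "r \<le> x" "x < r + p / 2" using x p by (auto simp: J_def \<psi>_def r_def field_simps)
        have "r \<le> u" by (simp add: u_def r_def)
        then have "real_of_int x < real_of_int u + p / 2" using r(2) by linarith
        have ux: "u \<le> x" using r(1) by (simp add: u_def r_def[symmetric] ceiling_le_iff)
        have "real_of_int (2 * x) < real_of_int (2 * u + int p)"
          using \<open>real_of_int x < real_of_int u + p / 2\<close> by simp
        then have "2 * x < 2 * u + int p" by (simp only: of_int_less_iff)
        then show "x \<in> X \<inter> {u..u + (int p - 1) div 2}" using x ux by (auto simp: J_def I_def)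
      qed
      then have "card J \<le> ?W u" by (intro card_mono) auto
      then show ?thesis using w[of u] by (simp add: K_def cardI)
    qed
    finally have "(\<Sum>x\<in>I. ?e x v) \<le> K" .
    moreover have "0 \<le> - sin v / 2" using v sin_ge_zero[of "- v"] by simp
    ultimately show "(\<Sum>x\<in>I. ?e x v * (- sin v / 2)) \<le> K * (- sin v / 2)"
      unfolding sum_distrib_right[symmetric] by (rule mult_right_mono)
  qed
  then have "cmod Z \<le> K" using ZM by simp
  then show thesis using that[of w] by (simp add: K_def Z_def)
qed

section \<open>The size of atoms\<close>

text \<open>A second moment argument for the number of representations \<open>r s\<close> of
  \<open>s\<close> in \<open>U + X\<close>: the counts sum to \<open>|U| |X|\<close>, and their
  squares to at most \<open>|X| |U| + |X| (|X| - 1)\<close>, since distinct translates of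
  \<open>U\<close> share at most one residue.\<close>

lemma energy_bound:
  assumes p: "p > 0" and U: "per p U" and X: "per p X"
    and Sidon: "\<And>d. \<not> p dvd d \<Longrightarrow> mu p (U \<inter> (+) d ` U) \<le> 1"
  shows "mu p U * mu p U * mu p X * mu p X \<le> mu p (U + X) * (mu p X * mu p U + mu p X * (mu p X - 1))"
proof -
  let ?X = "X \<inter> {0..<p}" and ?S = "(U + X) \<inter> {0..<p}"
  define u where "u = mu p U"
  define x where "x = mu p X"
  define i where "i b s = (if s - b \<in> U then 1 else 0 :: real)" for b s
  define r where "r s = (\<Sum>b\<in>?X. i b s)" for s
  have cX: "card ?X = x" by (simp add: x_def mu_def)
  have sub: "(+) b ` U \<subseteq> U + X" if "b \<in> X" for b using that by (auto simp: add.commute[of b] intro: set_plus_intro)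
  have sum1: "(\<Sum>s\<in>?S. i b s) = u" if "b \<in> ?X" for b
  proof -
    have "(\<Sum>s\<in>?S. i b s) = card {s \<in> ?S. s - b \<in> U}" by (simp add: i_def sum.If_cases Int_def)
    also have "{s \<in> ?S. s - b \<in> U} = (+) b ` U \<inter> {0..<p}"
      using sub[of b] that by (auto simp: mem_translate)
    also have "card \<dots> = u" using mu_translate[OF p U, of b] by (simp add: mu_def u_def)
    finally show ?thesis .
  qed
  have sum2: "(\<Sum>s\<in>?S. i b s * i c s) \<le> (if b = c then real u else 1)" if "b \<in> ?X" "c \<in> ?X" for b c
  proof -
    have "(\<Sum>s\<in>?S. i b s * i c s) = (\<Sum>s\<in>?S. if s - b \<in> U \<and> s - c \<in> U then 1 else 0)"
      by (intro sum.cong) (auto simp: i_def)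
    also have "\<dots> = card {s \<in> ?S. s - b \<in> U \<and> s - c \<in> U}" by (simp add: sum.If_cases Int_def)
    also have "{s \<in> ?S. s - b \<in> U \<and> s - c \<in> U} = (+) b ` (U \<inter> (+) (c - b) ` U) \<inter> {0..<p}"
    proof (rule Set.set_eqI)
      fix s
      have "s \<in> (+) b ` (U \<inter> (+) (c - b) ` U) \<longleftrightarrow> s - b \<in> U \<and> s - c \<in> U"
        unfolding mem_translate Int_iff by simp
      moreover have "s \<in> U + X" if "s - b \<in> U" using sub[of b] \<open>b \<in> ?X\<close> that mem_translate[of s b U] by blast
      ultimately show "s \<in> {s \<in> ?S. s - b \<in> U \<and> s - c \<in> U} \<longleftrightarrow> s \<in> (+) b ` (U \<inter> (+) (c - b) ` U) \<inter> {0..<p}"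
        by blast
    qed
    also have "card \<dots> = mu p (U \<inter> (+) (c - b) ` U)"
      using mu_translate[OF p per_Int[OF U per_translate[OF U]], of b "c - b"] by (simp add: mu_def)
    finally have e: "(\<Sum>s\<in>?S. i b s * i c s) = mu p (U \<inter> (+) (c - b) ` U)" .
    show ?thesis
    proof (cases "b = c")
      case True then show ?thesis unfolding e by (simp add: u_def mu_mono)
    next
      case False
      have "\<not> p dvd c - b"
      proof
        assume "p dvd c - b"
        then have "c mod p = b mod p" by (simp add: mod_eq_dvd_iff)
        then show False using that False by simp
      qed
      then show ?thesis unfolding e using Sidon[of "c - b"] False by simp
    qed
  qed
  have R1: "(\<Sum>s\<in>?S. r s) = real x * u"
    unfolding r_def by (subst sum.swap) (simp add: sum1 cX)
  have "(\<Sum>s\<in>?S. (r s)\<^sup>2) = (\<Sum>b\<in>?X. \<Sum>c\<in>?X. \<Sum>s\<in>?S. i b s * i c s)"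
    unfolding r_def power2_eq_square sum_product
    by (subst sum.swap, rule sum.cong[OF refl], subst sum.swap, rule refl)
  also have "\<dots> \<le> (\<Sum>b\<in>?X. \<Sum>c\<in>?X. if b = c then real u else 1)"
    by (intro sum_mono sum2)
  also have "\<dots> = (\<Sum>b\<in>?X. real u + (real x - 1))"
  proof (rule sum.cong[OF refl])
    fix b assume b: "b \<in> ?X"
    have "(\<Sum>c\<in>?X. if b = c then real u else 1) = real u + (\<Sum>c\<in>?X - {b}. if b = c then real u else 1)"
      using b by (subst sum.remove[of _ b]) auto
    also have "(\<Sum>c\<in>?X - {b}. if b = c then real u else 1) = (\<Sum>c\<in>?X - {b}. 1)" by (intro sum.cong) auto
    also have "\<dots> = real x - 1"
    proof -
      have "Suc (card (?X - {b})) = x" using card_Suc_Diff1[OF _ b] cX by simp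
      then show ?thesis by auto
    qed
    finally show "(\<Sum>c\<in>?X. if b = c then real u else 1) = real u + (real x - 1)" .
  qed
  also have "\<dots> = real x * (real u + (real x - 1))" by (simp add: cX)
  finally have R2: "(\<Sum>s\<in>?S. (r s)\<^sup>2) \<le> real x * (real u + (real x - 1))" .
  have "(real x * u)\<^sup>2 = (\<Sum>s\<in>?S. 1 * r s)\<^sup>2" using R1 by simp
  also have "\<dots> \<le> (\<Sum>s\<in>?S. 1\<^sup>2) * (\<Sum>s\<in>?S. (r s)\<^sup>2)" by (rule Cauchy_Schwarz_ineq_sum)
  also have "\<dots> \<le> real (mu p (U + X)) * (real x * (real u + (real x - 1)))"
    using R2 by (intro mult_mono) (auto simp: mu_def sum_nonneg)
  finally have main: "(real x * u)\<^sup>2 \<le> real (mu p (U + X)) * (real x * (real u + (real x - 1)))" .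
  show ?thesis
  proof (cases "x = 0")
    case True then show ?thesis by (simp add: x_def)
  next
    case False
    then have "real (x - 1) = real x - 1" by simp
    then have "real (u * u * x * x) \<le> real (mu p (U + X) * (x * u + x * (x - 1)))"
      using main unfolding of_nat_mult of_nat_add \<open>real (x - 1) = real x - 1\<close>
      by (simp add: power2_eq_square algebra_simps)
    then show ?thesis unfolding of_nat_le_iff by (simp only: u_def x_def)
  qed
qed

lemma prime_inverse:
  fixes p u :: int
  assumes "prime p" "\<not> p dvd u" obtains v where "p dvd u * v - 1" "\<not> p dvd v"
proof -
  have "coprime u p" using assms by (metis coprime_commute prime_imp_coprime)
  then obtain v where "[u * v = 1] (mod p)" using cong_solve_coprime_int by blast
  then have v: "p dvd u * v - 1" by (simp add: cong_iff_dvd_diff)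
  have "\<not> p dvd v"
  proof
    assume "p dvd v"
    then have "p dvd u * v - (u * v - 1)" using v dvd_diff[OF dvd_mult] by blast
    then have "p dvd 1" by simp
    then show False using assms(1) not_prime_unit by blast
  qed
  with v show thesis by (rule that)
qed

lemma per_prime_eq_UNIV:
  fixes p :: int
  assumes p: "prime p" and X: "per p X" "per d X" "X \<noteq> {}" and d: "\<not> p dvd d" shows "X = UNIV"
proof -
  obtain v where v: "p dvd d * v - 1" by (rule prime_inverse[OF p d])
  obtain a where "a \<in> X" using X by auto
  have "z \<in> X" for z
  proof -
    have "a + (v * (z - a)) * d \<in> X" using per_add_mult[OF X(2)] \<open>a \<in> X\<close> by blast
    moreover have "a + (v * (z - a)) * d - z = (d * v - 1) * (z - a)" by (simp add: algebra_simps)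
    then have "p dvd a + (v * (z - a)) * d - z" using v by simp
    ultimately show ?thesis using per_dvd[OF X(1)] by blast
  qed
  then show ?thesis by auto
qed

lemma translate_eq_imp_trivial:
  assumes "prime p" "per p X" "X \<noteq> {}" "X \<noteq> UNIV" "\<not> p dvd d" shows "(+) d ` X \<noteq> X"
  using translate_invariant_imp_per[of d X] per_prime_eq_UNIV[of p X d] assms by blast

lemma atom_size_arith:
  fixes R u x :: int
  assumes R: "R \<ge> 2" and x: "x \<le> 10 * R - 4 + u" and e: "u * u * x \<le> (u + x + R - 3) * (u + x - 1)"
  shows "x \<le> 11 * R - 1"
proof (rule ccontr)
  assume "\<not> x \<le> 11 * R - 1"
  \<comment> \<open>\<open>a\<close> and \<open>c\<close> are the excesses over the extreme case
    \<open>u = R + 4\<close>, \<open>x = 11 * R\<close>, and the bound on \<open>x\<close> becomes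
    \<open>c <= a\<close>. After this substitution the energy inequality says that a visibly
    positive polynomial is not positive.\<close>
  define a where "a = u - R - 4"
  define c where "c = x - 11 * R"
  have ac: "0 \<le> c" "c \<le> a" using \<open>\<not> x \<le> 11 * R - 1\<close> x by (auto simp: a_def c_def)
  have u: "u = R + 4 + a" and x': "x = 11 * R + c" by (auto simp: a_def c_def)
  have "(u + x + R - 3) * (u + x - 1) \<le> (13 * R + 1 + 2 * a) * (12 * R + 3 + 2 * a)"
    using ac R unfolding u x' by (intro mult_mono) auto
  moreover have "u * u * (11 * R) \<le> u * u * x" using ac R unfolding u x' by (intro mult_left_mono) auto
  ultimately have "u * u * (11 * R) \<le> (13 * R + 1 + 2 * a) * (12 * R + 3 + 2 * a)" using e by linarith
  then have "R * (11 * R * R - 68 * R + 125) - 3 + a * (22 * R * R + 38 * R - 8) + a * a * (11 * R - 4) \<le> 0"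
    unfolding u by (simp add: algebra_simps)
  moreover have "0 \<le> a * (22 * R * R + 38 * R - 8)"
  proof -
    have "0 \<le> 22 * R * R" using R by simp
    then have "0 \<le> 22 * R * R + 38 * R - 8" using R by linarith
    then show ?thesis using ac by (intro mult_nonneg_nonneg) auto
  qed
  moreover have "0 \<le> a * a * (11 * R - 4)" using ac R by simp
  moreover have "R * 2 \<le> R * (11 * R * R - 68 * R + 125)"
  proof (rule mult_left_mono)
    have "0 \<le> (11 * R - 34) * (11 * R - 34)" by simp
    then show "2 \<le> 11 * R * R - 68 * R + 125" by (simp add: algebra_simps)
  qed (use R in simp)
  ultimately show False using R by linarith
qed

text \<open>A \<open>k\<close>-atom \<open>X\<close> is hardly larger than \<open>k\<close>: a \<open>2\<close>-atom \<open>U\<close> of \<open>X\<close> is small, and shifting \<open>X\<close> by a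
  difference of two elements of \<open>U\<close> moves at most \<open>|U| + r\<close> elements out of \<open>X\<close>.\<close>

lemma atom_size:
  fixes r :: int
  assumes p: "prime p" and r: "r \<ge> -1" and X: "per p X" and k: "int (mu p X) \<ge> 9 * (r + 3)"
    and atom: "\<And>d. (+) d ` X = X \<or> int (mu p (X \<inter> (+) d ` X)) < 9 * (r + 3)"
    and B: "per p B" "2 \<le> mu p B" "int (mu p (X + B)) \<le> int (mu p X) + int (mu p B) + r"
      "int (mu p (X + B)) + 2 \<le> p"
  shows "int (mu p X) \<le> 11 * (r + 3) - 1"
proof -
  have p0: "p > 0" using p prime_gt_0_int by blast
  \<comment> \<open>\<open>B\<close> competes with the \<open>2\<close>-atom \<open>U\<close> of
    \<open>X\<close>, so \<open>U\<close> inherits the excess bound \<open>r\<close>.\<close>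
  have "admissible p 2 X B" using B by (simp add: admissible_def add.commute)
  then obtain U where U: "admissible p 2 X U"
    "\<And>X'. admissible p 2 X X' \<Longrightarrow> mu p (U + X) + mu p X' \<le> mu p (X' + X) + mu p U"
    "\<And>d. (+) d ` U = U \<or> mu p (U \<inter> (+) d ` U) < 2"
    using atom_exists[OF p0 X, of 2 B] by auto
  have perU: "per p U" and U2: "2 \<le> mu p U" and UX: "int (mu p (U + X)) + 2 \<le> p"
    using U(1) by (auto simp: admissible_def)
  have Xne: "X \<noteq> {}" using k r by auto
  have Une: "U \<noteq> {}" using U2 by auto
  have mUX: "mu p X \<le> mu p (U + X)" by (rule mu_plus_ge[OF p0 perU X Une])
  have mXU: "mu p U \<le> mu p (U + X)" using mu_plus_ge[OF p0 X perU Xne] by (simp add: add.commute)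
  have notU: "X \<noteq> UNIV" "U \<noteq> UNIV" using mUX mXU UX mu_UNIV[OF p0] by auto
  have uX: "int (mu p (U + X)) \<le> int (mu p U) + int (mu p X) + r"
    using U(2)[OF \<open>admissible p 2 X B\<close>] B(3) by (simp add: add.commute[of B])
  \<comment> \<open>For a prime modulus no proper nonempty set is fixed by a nontrivial translation,
    so only the other alternative of the atom property remains.\<close>
  have "mu p (U \<inter> (+) d ` U) \<le> 1" if "\<not> p dvd d" for d
    using U(3)[of d] translate_eq_imp_trivial[OF p perU Une notU(2) that] by auto
  from energy_bound[OF p0 perU X this]
  have en: "mu p U * mu p U * mu p X * mu p X \<le> mu p (U + X) * (mu p X * mu p U + mu p X * (mu p X - 1))" .
  define u where "u = int (mu p U)"
  define x where "x = int (mu p X)"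
  have x0: "x > 0" using k r by (simp add: x_def)
  have "u * u * x * x \<le> int (mu p (U + X)) * (x * u + x * (x - 1))"
  proof -
    have "int (mu p U * mu p U * mu p X * mu p X) \<le> int (mu p (U + X) * (mu p X * mu p U + mu p X * (mu p X - 1)))"
      using en by (simp only: of_nat_le_iff)
    moreover have "int (mu p X - 1) = x - 1" using x0 by (simp add: x_def of_nat_diff)
    ultimately show ?thesis by (simp add: u_def x_def)
  qed
  also have "\<dots> \<le> (u + x + r) * (x * u + x * (x - 1))"
    using uX x0 by (intro mult_right_mono) (auto simp: u_def x_def)
  finally have "x * (u * u * x) \<le> x * ((u + x + r) * (u + x - 1))" by (simp add: algebra_simps)
  then have e: "u * u * x \<le> (u + x + r) * (u + x - 1)" using x0 by simp
  have "2 \<le> card (U \<inter> {0..<p})" using U2 by (simp add: mu_def)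
  then obtain a b where ab: "a \<in> U" "b \<in> U" "a \<in> {0..<p}" "b \<in> {0..<p}" "a \<noteq> b"
    by (metis (no_types, opaque_lifting) IntE card_2_iff' card_le_Suc0_iff_eq finite_Int finite_atLeastLessThan_int not_less_eq_eq numeral_2_eq_2)
  have "\<not> p dvd b - a"
  proof
    assume "p dvd b - a"
    then have "b mod p = a mod p" by (simp add: mod_eq_dvd_iff)
    then show False using ab by simp
  qed
  then have "int (mu p (X \<inter> (+) (b - a) ` X)) < 9 * (r + 3)"
    using atom translate_eq_imp_trivial[OF p X Xne notU(1)] by blast
  moreover have "mu p ((+) a ` X \<inter> (+) b ` X) = mu p (X \<inter> (+) (b - a) ` X)"
  proof -
    have "(+) a ` X \<inter> (+) b ` X = (+) a ` (X \<inter> (+) (b - a) ` X)"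
    proof (rule Set.set_eqI)
      fix z show "z \<in> (+) a ` X \<inter> (+) b ` X \<longleftrightarrow> z \<in> (+) a ` (X \<inter> (+) (b - a) ` X)"
        unfolding mem_translate Int_iff by simp
    qed
    then show ?thesis using mu_translate[OF p0 per_Int[OF X per_translate[OF X]]] by simp
  qed
  moreover have "mu p ((+) a ` X \<union> (+) b ` X) + mu p ((+) a ` X \<inter> (+) b ` X) = 2 * mu p X"
    using mu_Un_Int[of p "(+) a ` X" "(+) b ` X"] mu_translate[OF p0 X] by simp
  moreover have "mu p ((+) a ` X \<union> (+) b ` X) \<le> mu p (U + X)"
    by (rule mu_mono) (use ab in \<open>auto intro: set_plus_intro\<close>)
  ultimately have "x \<le> 10 * (r + 3) - 4 + u" using uX by (simp add: u_def x_def)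
  then show ?thesis using atom_size_arith[of "r + 3" x u] e r by (simp add: x_def algebra_simps)
qed

section \<open>Small pairs\<close>

text \<open>A preimage, so periodicity is inherited without inverting \<open>u\<close>. Modulo a
  prime not dividing \<open>u\<close> it is the image under the inverse affine map.\<close>

definition aff :: "int \<Rightarrow> int \<Rightarrow> int set \<Rightarrow> int set" where
  "aff c u X = {z. c + u * z \<in> X}"

lemma per_aff: "per p X \<Longrightarrow> per p (aff c u X)"
proof -
  assume X: "per p X"
  have "c + u * (z + p) \<in> X \<longleftrightarrow> c + u * z \<in> X" for z
    using per_add_mult[OF X, of "c + u * z" u] by (simp add: algebra_simps)
  then show ?thesis by (simp add: per_def aff_def)
qed

lemma mu_aff:
  assumes p: "prime p" and u: "\<not> p dvd u" and X: "per p X" shows "mu p (aff c u X) = mu p X"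
proof (rule antisym)
  have p0: "p > 0" using p prime_gt_0_int by blast
  show "mu p (aff c u X) \<le> mu p X"
  proof (rule mu_le_mu[OF p0 X, of _ "\<lambda>z. c + u * z"])
    show "c + u * z \<in> X" if "z \<in> aff c u X" for z using that by (simp add: aff_def)
    fix x y assume "p dvd c + u * x - (c + u * y)"
    then have "p dvd u * (x - y)" by (simp add: algebra_simps)
    then show "p dvd x - y" using p u prime_dvd_multD by blast
  qed
  obtain v where v: "p dvd u * v - 1" "\<not> p dvd v" by (rule prime_inverse[OF p u])
  show "mu p X \<le> mu p (aff c u X)"
  proof (rule mu_le_mu[OF p0 per_aff[OF X], of _ "\<lambda>x. v * (x - c)"])
    fix x assume x: "x \<in> X"
    have "c + u * (v * (x - c)) - x = (u * v - 1) * (x - c)" by (simp add: algebra_simps)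
    then have "p dvd c + u * (v * (x - c)) - x" using v(1) by simp
    then show "v * (x - c) \<in> aff c u X" using per_dvd[OF X] x by (simp add: aff_def)
  next
    fix x y assume "p dvd v * (x - c) - v * (y - c)"
    then have "p dvd v * (x - y)" by (simp add: algebra_simps)
    then show "p dvd x - y" using p v(2) prime_dvd_multD by blast
  qed
qed

lemma aff_plus:
  assumes p: "prime p" and u: "\<not> p dvd u" and X: "per p X" and Y: "per p Y"
  shows "aff c u X + aff d u Y = aff (c + d) u (X + Y)"
proof (rule Set.set_eqI)
  obtain v where v: "p dvd u * v - 1" "\<not> p dvd v" by (rule prime_inverse[OF p u])
  fix z show "z \<in> aff c u X + aff d u Y \<longleftrightarrow> z \<in> aff (c + d) u (X + Y)"
  proof
    assume "z \<in> aff c u X + aff d u Y"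
    then obtain a b where ab: "c + u * a \<in> X" "d + u * b \<in> Y" "z = a + b" by (auto elim!: set_plus_elim simp: aff_def)
    have "(c + u * a) + (d + u * b) \<in> X + Y" using ab by (intro set_plus_intro)
    moreover have "(c + u * a) + (d + u * b) = c + d + u * z" using ab(3) by (simp add: algebra_simps)
    ultimately show "z \<in> aff (c + d) u (X + Y)" by (simp add: aff_def)
  next
    assume "z \<in> aff (c + d) u (X + Y)"
    then obtain x y where xy: "x \<in> X" "y \<in> Y" "c + d + u * z = x + y" by (auto elim!: set_plus_elim simp: aff_def)
    define a where "a = v * (x - c)"
    have "c + u * a - x = (u * v - 1) * (x - c)" by (simp add: a_def algebra_simps)
    then have cx: "p dvd c + u * a - x" using v(1) by simp
    then have "a \<in> aff c u X" using per_dvd[OF X] xy(1) by (simp add: aff_def)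
    moreover have "z - a \<in> aff d u Y"
    proof -
      have "d + u * (z - a) - y = - (c + u * a - x)" using xy(3) by (simp add: algebra_simps)
      then have "p dvd d + u * (z - a) - y" using cx by (metis dvd_minus_iff)
      then show ?thesis using per_dvd[OF Y] xy(2) by (simp add: aff_def)
    qed
    ultimately have "a + (z - a) \<in> aff c u X + aff d u Y" by (rule set_plus_intro)
    then show "z \<in> aff c u X + aff d u Y" by simp
  qed
qed

lemma cis_cong:
  assumes "p > 0" "int p dvd a - b"
  shows "cis (2 * pi * real_of_int a / real p) = cis (2 * pi * real_of_int b / real p)"
proof -
  obtain k where k: "a - b = int p * k" using assms(2) by auto
  have "a = b + int p * k" using k by simp
  then have "real_of_int a = real_of_int (b + int p * k)" by (simp only:)
  then have "2 * pi * real_of_int a / real p = 2 * pi * real_of_int b / real p + 2 * pi * real_of_int k"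
    using assms(1) by (simp add: field_simps)
  then show ?thesis by (simp add: cis_mult[symmetric] cis_multiple_2pi)
qed

text \<open>Substituting \<open>x = v z\<close> with \<open>v\<close> inverse to \<open>t\<close>
  turns frequency \<open>t\<close> into frequency 1, the only one for which
  \<open>half_circle\<close> is stated.\<close>

lemma fourier_aff:
  assumes p: "prime (int p)" and v: "int p dvd t * v - 1" "\<not> int p dvd v" and X: "per (int p) X"
  shows "fourier p X t = fourier p (aff 0 v X) 1"
proof -
  have p0: "int p > 0" using p prime_gt_0_int by blast
  let ?f = "\<lambda>z. (v * z) mod int p"
  let ?A = "aff 0 v X \<inter> {0..<int p}"
  have inj: "inj_on ?f ?A"
  proof (rule inj_onI)
    fix x y assume xy: "x \<in> ?A" "y \<in> ?A" "?f x = ?f y"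
    then have "int p dvd v * (x - y)" by (simp add: mod_eq_dvd_iff right_diff_distrib)
    then have "int p dvd x - y" using p v(2) prime_dvd_multD by blast
    then have "x mod int p = y mod int p" by (simp add: mod_eq_dvd_iff)
    then show "x = y" using xy by simp
  qed
  have "?f ` ?A \<subseteq> X \<inter> {0..<int p}" using p0 per_mod[OF X] by (auto simp: aff_def)
  moreover have "card (?f ` ?A) = card (X \<inter> {0..<int p})"
    using card_image[OF inj] mu_aff[OF p v(2) X, of 0] by (simp add: mu_def)
  ultimately have "?f ` ?A = X \<inter> {0..<int p}" by (intro card_subset_eq) auto
  then have bij: "bij_betw ?f ?A (X \<inter> {0..<int p})" using inj by (simp add: bij_betw_def)
  have "fourier p X t = (\<Sum>z\<in>?A. cis (2 * pi * real_of_int (t * ?f z) / real p))"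
    unfolding fourier_def by (rule sum.reindex_bij_betw[OF bij, symmetric])
  also have "\<dots> = (\<Sum>z\<in>?A. cis (2 * pi * real_of_int (1 * z) / real p))"
  proof (intro sum.cong refl cis_cong)
    show "p > 0" using p0 by simp
    fix z
    have e: "t * ?f z - 1 * z = t * (?f z - v * z) + (t * v - 1) * z" by (simp add: algebra_simps)
    have "int p dvd ?f z - v * z" by (simp add: mod_eq_dvd_iff[symmetric])
    then show "int p dvd t * ?f z - 1 * z" unfolding e using v(1) by (intro dvd_add dvd_mult dvd_mult2) auto
  qed
  also have "\<dots> = fourier p (aff 0 v X) 1" by (simp add: fourier_def)
  finally show ?thesis .
qed

text \<open>\<open>g\<close> is the gcd of all differences inside \<open>A\<close> and inside
  \<open>B\<close>; two distinct elements of \<open>A\<close> keep it from being 0.\<close>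

lemma normalize_spread:
  fixes A B :: "int set"
  assumes a: "a \<in> A" "a' \<in> A" "a \<noteq> a'" and b: "b \<in> B"
  obtains g where "g > 0" "g dvd a' - a" "\<And>x. x \<in> A \<Longrightarrow> g dvd x - a" "\<And>x. x \<in> B \<Longrightarrow> g dvd x - b"
    "spread {z. a + g * z \<in> A} {z. b + g * z \<in> B}"
proof -
  define D where "D = {x - y | x y. x \<in> A \<and> y \<in> A} \<union> {x - y | x y. x \<in> B \<and> y \<in> B}"
  define g where "g = Gcd D"
  have gA: "g dvd x - y" if "x \<in> A" "y \<in> A" for x y unfolding g_def by (rule Gcd_dvd) (use that D_def in blast)
  have gB: "g dvd x - y" if "x \<in> B" "y \<in> B" for x y unfolding g_def by (rule Gcd_dvd) (use that D_def in blast)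
  have "g \<noteq> 0" using gA[OF a(1,2)] a(3) by auto
  then have g0: "g > 0" by (simp add: g_def order.strict_iff_order)
  have "spread {z. a + g * z \<in> A} {z. b + g * z \<in> B}"
    unfolding spread_def
  proof (intro allI impI, rule ccontr)
    fix d :: int assume d: "d > 1" and "\<not> (\<exists>x y. (x \<in> {z. a + g * z \<in> A} \<and> y \<in> {z. a + g * z \<in> A} \<or>
      x \<in> {z. b + g * z \<in> B} \<and> y \<in> {z. b + g * z \<in> B}) \<and> \<not> d dvd x - y)"
    then have "(\<forall>x y. a + g * x \<in> A \<longrightarrow> a + g * y \<in> A \<longrightarrow> d dvd x - y) \<and>
      (\<forall>x y. b + g * x \<in> B \<longrightarrow> b + g * y \<in> B \<longrightarrow> d dvd x - y)" by blast
    then have dA: "\<And>x y. a + g * x \<in> A \<Longrightarrow> a + g * y \<in> A \<Longrightarrow> d dvd x - y"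
      and dB: "\<And>x y. b + g * x \<in> B \<Longrightarrow> b + g * y \<in> B \<Longrightarrow> d dvd x - y" by blast+
    have "g * d dvd e" if "e \<in> D" for e
    proof -
      have *: "g * d dvd x - y" if xyc: "x \<in> C" "y \<in> C" "c \<in> C"
        and gC: "\<And>x y. x \<in> C \<Longrightarrow> y \<in> C \<Longrightarrow> g dvd x - y"
        and dC: "\<And>x y. c + g * x \<in> C \<Longrightarrow> c + g * y \<in> C \<Longrightarrow> d dvd x - y" for x y c C
      proof -
        obtain i where i: "x - c = g * i" using gC[OF xyc(1,3)] by auto
        obtain j where j: "y - c = g * j" using gC[OF xyc(2,3)] by auto
        have "c + g * i = x" "c + g * j = y" using i j by auto
        then have "d dvd i - j" using dC[of i j] xyc(1,2) by simp
        moreover have "x - y = g * (i - j)" using i j by (simp add: right_diff_distrib)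
        ultimately show ?thesis by simp
      qed
      from that consider x y where "e = x - y" "x \<in> A" "y \<in> A" | x y where "e = x - y" "x \<in> B" "y \<in> B"
        unfolding D_def by blast
      then show ?thesis
      proof cases
        case 1 then show ?thesis using *[OF 1(2,3) a(1) gA dA] by simp
      next
        case 2 then show ?thesis using *[OF 2(2,3) b gB dB] by simp
      qed
    qed
    then have "g * d dvd g * 1" unfolding g_def[symmetric] using Gcd_greatest[of D "g * d"] by (simp add: g_def)
    then have "d dvd 1" using g0 by (simp only: dvd_mult_cancel_left) simp
    then show False using d by simp
  qed
  then show thesis using that[OF g0 gA[OF a(2,1)] gA[OF _ a(1)] gB[OF _ b]] by blast
qed

section \<open>Pairs of small sets\<close>

text \<open>\<open>P\<close> and \<open>Q\<close> stand for the surpluses \<open>2 |A| - x\<close>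
  and \<open>2 |B| - y\<close> of the half-circle parts; the conclusion then gives
  \<open>|A| + 2 |B| > s + 3\<close>, as Freiman's theorem requires. If it failed,
  \<open>8 P Q <= (P + 2 Q)^2\<close> and \<open>R <= x / 9\<close> would bound \<open>M\<close> by
  a multiple of \<open>x^2\<close> that is too small for this \<open>p\<close>.\<close>

lemma large_coefficient_arith:
  fixes R x y s p M P Q :: real
  assumes R: "R \<ge> 2" and x: "9 * R \<le> x" "x \<le> 11 * R" and y: "9 * R \<le> y" "y \<le> 11 * R"
    and s: "0 \<le> s" "s \<le> x + y + R - 3" and p: "p \<ge> 47 * R - 10"
    and M: "(x * y)\<^sup>2 * (p - s) \<le> M * ((x + y) / 2 * (p - (x + y) / 2) * s)"
    and PQ: "M \<le> P * Q" "0 \<le> P" "0 \<le> Q"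
  shows "x + 2 * R < P + 2 * Q"
proof (rule ccontr)
  assume "\<not> x + 2 * R < P + 2 * Q"
  then have le: "P + 2 * Q \<le> 11 / 9 * x" using x by simp
  have "8 * (P * Q) \<le> (P + 2 * Q)\<^sup>2" using zero_le_power2[of "P - 2 * Q"] by (simp add: power2_eq_square algebra_simps)
  also have "\<dots> \<le> (11 / 9 * x)\<^sup>2" using le PQ by (intro power_mono) auto
  finally have Mx: "M \<le> 121 / 648 * x\<^sup>2" using PQ(1) by (simp add: power2_eq_square)
  define T where "T = (x + y) / 2"
  have T: "9 * R \<le> T" "T \<le> 10 / 9 * y" "T \<le> 11 * R" using x y by (auto simp: T_def)
  have s': "s \<le> 23 / 9 * y" "s \<le> 23 * R - 3" using s x y by auto
  have pT: "p - T \<ge> 0" using p T R by linarith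
  have Ts: "T * s \<le> (10 / 9 * y) * (23 / 9 * y)" using T s' s(1) R y by (intro mult_mono) auto
  have "(x * y)\<^sup>2 * (p - s) \<le> M * (T * (p - T) * s)" using M by (simp add: T_def)
  also have "\<dots> \<le> (121 / 648 * x\<^sup>2) * (T * (p - T) * s)"
    using Mx pT T s R by (intro mult_right_mono) (auto intro!: mult_nonneg_nonneg)
  also have "\<dots> = (121 / 648 * x\<^sup>2) * ((T * s) * (p - T))" by (simp add: algebra_simps)
  also have "\<dots> \<le> (121 / 648 * x\<^sup>2) * (((10 / 9 * y) * (23 / 9 * y)) * (p - T))"
    using Ts pT by (intro mult_left_mono mult_right_mono) auto
  \<comment> \<open>The constant is \<open>121 / 648\<close> times \<open>10 / 9\<close> times
    \<open>23 / 9\<close>.\<close>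
  also have "\<dots> = (x * y)\<^sup>2 * (27830 / 52488 * (p - T))" by (simp add: power2_eq_square field_simps)
  finally have "(x * y)\<^sup>2 * (p - s) \<le> (x * y)\<^sup>2 * (27830 / 52488 * (p - T))" .
  moreover have "(x * y)\<^sup>2 > 0" using x y R by simp
  ultimately have "p - s \<le> 27830 / 52488 * (p - T)" by (simp only: mult_le_cancel_left_pos)
  then show False using p T(1) s'(2) R by simp
qed

lemma two_elements:
  assumes "finite A" "2 \<le> card A" obtains a b where "a \<in> A" "b \<in> A" "a \<noteq> b"
  using assms by (metis card_le_Suc0_iff_eq not_less_eq_eq numeral_2_eq_2)

text \<open>For a prime \<open>p\<close> not dividing \<open>u\<close>, this places \<open>X\<close>
  in a progression modulo \<open>p\<close> with difference \<open>u\<close> and at most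
  \<open>n + 1\<close> terms.\<close>

definition arc_along :: "int \<Rightarrow> int \<Rightarrow> int \<Rightarrow> int set \<Rightarrow> bool" where
  "arc_along p u n X \<longleftrightarrow> (\<exists>c. arc p n (aff c u X))"

text \<open>Two dilations are composed. The first moves the large coefficient to frequency 1, so
  that half circles capture most of both sets. The second divides by the gcd of the differences in
  the captured parts, as Freiman's theorem needs them coprime.\<close>

lemma small_pair_arc_along:
  fixes r :: int
  assumes p: "prime (int p)" "real p \<ge> 47 * real_of_int (r + 3) - 10" and r: "r \<ge> -1"
    and X: "per (int p) X" "9 * (r + 3) \<le> int (mu (int p) X)" "int (mu (int p) X) \<le> 11 * (r + 3) - 1"
    and Y: "per (int p) Y" "9 * (r + 3) \<le> int (mu (int p) Y)" "int (mu (int p) Y) \<le> 11 * (r + 3) - 1"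
    and XY: "int (mu (int p) (X + Y)) \<le> int (mu (int p) X) + int (mu (int p) Y) + r"
  obtains u where "\<not> int p dvd u" "arc_along (int p) u (int (mu (int p) X) + r) X"
proof -
  define x where "x = mu (int p) X"
  define y where "y = mu (int p) Y"
  define s where "s = mu (int p) (X + Y)"
  have p0: "int p > 0" using p(1) prime_gt_0_int by blast
  have "real_of_int (47 * (r + 3) - 10) \<le> real_of_int (int p)" using p(2) by simp
  then have pR: "47 * (r + 3) - 10 \<le> int p" by (simp only: of_int_le_iff)
  have sp: "2 * int s < int p + 4" using XY X(3) Y(3) pR by (simp add: s_def)
  have p2: "int p > 2" using pR r by simp
  \<comment> \<open>For odd \<open>p\<close> two half circles have lengths adding up to
    \<open>p - 1\<close>, just below the threshold for rectification.\<close>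
  then have "odd (int p)" using p(1) prime_odd_int by blast
  then have half: "2 * ((int p - 1) div 2) = int p - 1" by simp
  have "mu (int p) (X + Y) < p" using XY X(3) Y(3) pR r by simp
  then obtain t where t: "0 < t" "t < p" and
    M: "(real x * real y)\<^sup>2 * (p - real s) \<le> cmod (fourier p X (int t)) * cmod (fourier p Y (int t)) *
      ((real x + real y) / 2 * (p - (real x + real y) / 2) * real s)"
    using large_fourier_coefficient[OF _ X(1), of Y] p2 unfolding x_def y_def s_def by auto
  have "\<not> int p dvd int t" using t by (auto dest: zdvd_imp_le)
  then obtain v where v: "int p dvd int t * v - 1" "\<not> int p dvd v" by (rule prime_inverse[OF p(1)])
  define X1 where "X1 = aff 0 v X"
  define Y1 where "Y1 = aff 0 v Y"
  have per1: "per (int p) X1" "per (int p) Y1" using per_aff X(1) Y(1) by (auto simp: X1_def Y1_def)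
  have mu1: "mu (int p) X1 = x" "mu (int p) Y1 = y"
    using mu_aff[OF p(1) v(2)] X(1) Y(1) by (auto simp: X1_def Y1_def x_def y_def)
  define h where "h = (int p - 1) div 2"
  obtain w where w: "real x + cmod (fourier p X (int t)) \<le> 2 * real (card (X1 \<inter> {w..w + h}))"
    using half_circle[OF _ per1(1)] p0 fourier_aff[OF p(1) v X(1)] mu1 by (auto simp: X1_def h_def)
  obtain w' where w': "real y + cmod (fourier p Y (int t)) \<le> 2 * real (card (Y1 \<inter> {w'..w' + h}))"
    using half_circle[OF _ per1(2)] p0 fourier_aff[OF p(1) v Y(1)] mu1 by (auto simp: Y1_def h_def)
  define A where "A = X1 \<inter> {w..w + h}"
  define B where "B = Y1 \<inter> {w'..w' + h}"
  have fin: "finite A" "finite B" by (auto simp: A_def B_def)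
  define P where "P = 2 * real (card A) - x"
  define Q where "Q = 2 * real (card B) - y"
  have PQ: "cmod (fourier p X (int t)) \<le> P" "cmod (fourier p Y (int t)) \<le> Q"
    using w w' by (auto simp: P_def Q_def A_def B_def)
  then have PQ0: "0 \<le> P" "0 \<le> Q" by (meson norm_ge_zero order_trans)+
  have MPQ: "cmod (fourier p X (int t)) * cmod (fourier p Y (int t)) \<le> P * Q"
    using PQ PQ0 by (intro mult_mono) auto
  define R where "R = real_of_int (r + 3)"
  have R2: "R \<ge> 2" using r by (simp add: R_def)
  have bx: "9 * R \<le> real x" "real x \<le> 11 * R" and bdy: "9 * R \<le> real y" "real y \<le> 11 * R"
    and bs: "real s \<le> real x + real y + R - 3"
    using X Y XY by (simp_all add: R_def x_def y_def s_def)
  have "real x + 2 * R < P + 2 * Q"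
    by (rule large_coefficient_arith[OF R2 bx bdy _ bs _ M MPQ PQ0]) (use p(2) R_def in auto)
  then have "real (s + 3) < real (card A + 2 * card B)" using bs by (simp add: P_def Q_def)
  then have sm1: "s + 4 \<le> card A + 2 * card B" unfolding of_nat_less_iff by simp
  have "real y + 2 * R < Q + 2 * P"
  proof (rule large_coefficient_arith[OF R2 bdy bx])
    show "(real y * real x)\<^sup>2 * (real p - real s) \<le> cmod (fourier p X (int t)) * cmod (fourier p Y (int t)) *
      ((real y + real x) / 2 * (real p - (real y + real x) / 2) * real s)" using M by (simp add: ac_simps)
    show "cmod (fourier p X (int t)) * cmod (fourier p Y (int t)) \<le> Q * P" using MPQ by (simp add: mult.commute)
  qed (use bs p(2) R_def PQ0 in auto)
  then have "real (s + 3) < real (2 * card A + card B)" using bs by (simp add: P_def Q_def)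
  then have sm2: "s + 4 \<le> 2 * card A + card B" unfolding of_nat_less_iff by simp
  have "real x \<le> 2 * real (card A)" "real y \<le> 2 * real (card B)" using PQ0 by (auto simp: P_def Q_def)
  then have cAB: "2 \<le> card A" "1 \<le> card B" using bx bdy R2 by auto
  obtain a a' where a: "a \<in> A" "a' \<in> A" "a \<noteq> a'" by (rule two_elements[OF fin(1) cAB(1)])
  obtain b where b: "b \<in> B" using cAB(2) by fastforce
  obtain g where g: "g > 0" "g dvd a' - a" "\<And>x. x \<in> A \<Longrightarrow> g dvd x - a" "\<And>x. x \<in> B \<Longrightarrow> g dvd x - b"
    "spread {z. a + g * z \<in> A} {z. b + g * z \<in> B}"
    using normalize_spread[OF a b] by blast
  define A2 where "A2 = {z. a + g * z \<in> A}"
  define B2 where "B2 = {z. b + g * z \<in> B}"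
  have img: "C = (\<lambda>z. c + g * z) ` {z. c + g * z \<in> C}" if "\<And>x. x \<in> C \<Longrightarrow> g dvd x - c" for c C
  proof
    show "C \<subseteq> (\<lambda>z. c + g * z) ` {z. c + g * z \<in> C}"
    proof
      fix x assume "x \<in> C"
      then obtain k where "x - c = g * k" using \<open>\<And>x. x \<in> C \<Longrightarrow> g dvd x - c\<close> by blast
      then have "x = c + g * k" by simp
      then show "x \<in> (\<lambda>z. c + g * z) ` {z. c + g * z \<in> C}" using \<open>x \<in> C\<close> by blast
    qed
  qed auto
  have inj: "inj_on (\<lambda>z. c + g * z) S" for c S using g(1) by (auto simp: inj_on_def)
  have c2: "card A2 = card A" "card B2 = card B"
    using card_image[OF inj] img[OF g(3)] img[OF g(4)] by (metis A2_def, metis B2_def)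
  have fin2: "finite A2" "finite B2"
    using finite_imageD[OF _ inj] fin img[OF g(3)] img[OF g(4)] by (metis A2_def, metis B2_def)
  have ne2: "A2 \<noteq> {}" "B2 \<noteq> {}" using cAB c2 by auto
  have dm: "diam_le {z. c + g * z \<in> C} h" if "C \<subseteq> {e..e + h}" for c C e
    unfolding diam_le_def
  proof (intro ballI)
    fix z z' assume "z \<in> {z. c + g * z \<in> C}" "z' \<in> {z. c + g * z \<in> C}"
    then have "c + g * z \<le> e + h" "e \<le> c + g * z'" using that by auto
    then have "g * (z - z') \<le> h" by (simp add: right_diff_distrib)
    moreover have "z - z' \<le> g * (z - z')" if "z - z' \<ge> 0" using mult_right_mono[of 1 g "z - z'"] g(1) that by simp
    moreover have "0 \<le> h" using p2 by (simp add: h_def)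
    ultimately show "z - z' \<le> h" by linarith
  qed
  \<comment> \<open>\<open>g\<close> divides a nonzero difference inside a half circle, so it is
    less than \<open>p\<close> and dividing by it is a dilation modulo \<open>p\<close>.\<close>
  have "\<bar>a' - a\<bar> \<le> h" using a by (auto simp: A_def)
  then have "g < int p" using dvd_imp_le_int[OF _ g(2)] a(3) g(1) half p2 by (simp add: h_def)
  then have gp: "\<not> int p dvd g" using g(1) zdvd_imp_le by fastforce
  define X2 where "X2 = aff a g X1"
  define Y2 where "Y2 = aff b g Y1"
  have per2: "per (int p) X2" "per (int p) Y2" using per_aff per1 by (auto simp: X2_def Y2_def)
  have muY2: "mu (int p) Y2 = y" unfolding Y2_def using mu_aff[OF p(1) gp per1(2)] mu1 by simp
  have "X1 + Y1 = aff 0 v (X + Y)"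
    unfolding X1_def Y1_def using aff_plus[OF p(1) v(2) X(1) Y(1), of 0 0] by simp
  moreover have "X2 + Y2 = aff (a + b) g (X1 + Y1)"
    unfolding X2_def Y2_def by (rule aff_plus[OF p(1) gp per1])
  ultimately have "X2 + Y2 = aff (a + b) g (aff 0 v (X + Y))" by simp
  then have mus: "mu (int p) (X2 + Y2) = s"
    using mu_aff[OF p(1) gp per_aff[OF per_plus[OF X(1)]]] mu_aff[OF p(1) v(2) per_plus[OF X(1)]] by (simp add: s_def)
  have "arc (int p) (int (mu (int p) (X2 + Y2)) - int (mu (int p) Y2)) X2"
  proof (rule rectified_arc[OF p0 per2 _ fin2(1) ne2(1) _ _ fin2(2) ne2(2)])
    show "A2 \<subseteq> X2" "B2 \<subseteq> Y2" by (auto simp: A2_def B2_def X2_def Y2_def A_def B_def aff_def)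
    show "diam_le A2 h" unfolding A2_def by (rule dm[of A w]) (auto simp: A_def)
    show "diam_le B2 h" unfolding B2_def by (rule dm[of B w']) (auto simp: B_def)
    show "h + h < int p" using half by (simp add: h_def)
    show "spread A2 B2" using g(5) by (simp add: A2_def B2_def)
  qed (use sm1 sm2 sp mus c2 in auto)
  then have "arc (int p) (int x + r) X2" unfolding mus muY2
    by (rule arc_mono) (use XY in \<open>simp add: s_def x_def y_def\<close>)
  moreover have "X2 = aff (v * a) (v * g) X" by (auto simp: X2_def X1_def aff_def algebra_simps)
  ultimately have "arc_along (int p) (v * g) (int x + r) X" by (auto simp: arc_along_def)
  moreover have "\<not> int p dvd v * g" using p(1) v(2) gp prime_dvd_multD by blast
  ultimately show thesis using that by (simp add: x_def)
qed

section \<open>Transfer of structure\<close>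

text \<open>If some \<open>d > 1\<close> divided all differences in \<open>A\<close>, halving the
  distance to the minimum would be injective on \<open>A\<close>, leaving at most
  \<open>n div 2 + 1\<close> elements.\<close>

lemma spread_of_dense:
  assumes A: "finite A" "diam_le A n" "n + 2 < 2 * int (card A)" and ne: "A \<noteq> {}" shows "spread A B"
  unfolding spread_def
proof (intro allI impI, rule ccontr)
  fix d :: int assume d: "d > 1"
    and "\<not> (\<exists>x y. (x \<in> A \<and> y \<in> A \<or> x \<in> B \<and> y \<in> B) \<and> \<not> d dvd x - y)"
  then have dA: "d dvd x - y" if "x \<in> A" "y \<in> A" for x y using that by blast
  define m where "m = Min A"
  have m: "m \<in> A" "\<And>x. x \<in> A \<Longrightarrow> m \<le> x" using A(1) ne by (auto simp: m_def)
  have inj: "inj_on (\<lambda>x. (x - m) div 2) A"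
  proof (rule inj_onI, rule ccontr)
    fix x y assume xy: "x \<in> A" "y \<in> A" "(x - m) div 2 = (y - m) div 2" "x \<noteq> y"
    then have "\<bar>x - y\<bar> \<le> 1" by linarith
    moreover have "\<bar>d\<bar> \<le> \<bar>x - y\<bar>" using dvd_imp_le_int[OF _ dA[OF xy(1,2)]] xy(4) by simp
    ultimately show False using d by simp
  qed
  have "(\<lambda>x. (x - m) div 2) ` A \<subseteq> {0..n div 2}"
  proof
    fix z assume "z \<in> (\<lambda>x. (x - m) div 2) ` A"
    then obtain x where x: "x \<in> A" "z = (x - m) div 2" by blast
    then have "0 \<le> x - m" "x - m \<le> n" using m A(2) by (auto simp: diam_le_def)
    then show "z \<in> {0..n div 2}" using x(2) by (auto intro: zdiv_mono1)
  qed
  then have "card ((\<lambda>x. (x - m) div 2) ` A) \<le> card {0..n div 2}" by (intro card_mono) auto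
  then have "card A \<le> card {0..n div 2}" unfolding card_image[OF inj] .
  moreover have "0 \<le> n" using A(2) m(1) by (force simp: diam_le_def)
  ultimately have "int (card A) \<le> n div 2 + 1" by simp
  then show False using A(3) by linarith
qed

lemma inj_mod_window:
  fixes p :: int
  assumes "p > 0" "x \<in> {a..<a + p}" "y \<in> {a..<a + p}" "x mod p = y mod p" shows "x = y"
proof -
  have "p dvd x - y" using assms(4) by (simp add: mod_eq_dvd_iff)
  moreover have "\<bar>x - y\<bar> < p" using assms(2,3) by auto
  ultimately show ?thesis using dvd_imp_le_int[of "x - y" p] assms(1) by force
qed

lemma arc_lift:
  assumes p: "p > 0" and X: "per p X" "arc p n X" and n: "0 \<le> n" "n < p"
  obtains c where "card (X \<inter> {c..c + n}) = mu p X"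
proof -
  obtain c where c: "\<And>x. x \<in> X \<Longrightarrow> (x - c) mod p \<le> n" using X(2) by (auto simp: arc_def)
  have "X \<inter> {c..<c + p} = X \<inter> {c..c + n}"
  proof -
    have "x - c \<le> n" if "x \<in> X" "c \<le> x" "x < c + p" for x using c[OF that(1)] that by simp
    then show ?thesis using n by force
  qed
  then show thesis using that mu_window[OF p X(1), of c] by simp
qed

text \<open>An element \<open>w\<close> of \<open>Y\<close> far from \<open>Y0\<close> would contribute too many new elements \<open>w + x\<close> to \<open>X + Y\<close>.\<close>

lemma far_element:
  fixes r :: int
  assumes p: "p > 0" and r: "r \<ge> -1" and X: "per p X"
    and X0: "X0 \<subseteq> X" "X0 \<subseteq> {c..c + L}" "L + 1 \<le> int (card X0) + r + 1" "9 * (r + 3) \<le> int (card X0)"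
    and Y0: "Y0 \<subseteq> Y" "Y0 \<subseteq> {m..m + M}" and fin: "finite X0" "finite Y0"
    and s: "int (mu p (X + Y)) \<le> int (card (X0 + Y0)) + 2 * r + 2" and LM: "L + M + 8 * (r + 3) < p" "0 \<le> M"
    and w: "w \<in> Y" "w = m + M + d" "3 * r + 4 \<le> d" "3 * r + 4 \<le> p - M - d"
  shows False
proof -
  \<comment> \<open>For \<open>x\<close> in \<open>{a..b}\<close> the sum \<open>w + x\<close> falls
    into the gap between the interval containing \<open>X0 + Y0\<close> and its next copy modulo
    \<open>p\<close>. There are at least \<open>3 r + 4\<close> such integers and \<open>X0\<close>
    misses at most \<open>r + 1\<close> of them, so \<open>2 r + 3\<close> sums are new.\<close>
  define a where "a = c + max 0 (L - d + 1)"
  define b where "b = c + min L (p - M - d - 1)"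
  have "card X0 \<le> card {c..c + L}" by (rule card_mono[OF _ X0(2)]) simp
  then have "int (card X0) \<le> L + 1" using X0(4) r by (cases "0 \<le> L") auto
  then have ab: "c \<le> a" "b \<le> c + L" "c + L - d < a" "b < c + p - M - d" "3 * r + 4 \<le> b - a + 1"
    using w(3,4) LM X0(3,4) r by (auto simp: a_def b_def min_def max_def)
  define N where "N = (+) w ` (X0 \<inter> {a..b})"
  have cN: "2 * r + 3 \<le> int (card N)"
  proof -
    have "{a..b} \<subseteq> (X0 \<inter> {a..b}) \<union> ({c..c + L} - X0)" using ab by auto
    then have "card {a..b} \<le> card ((X0 \<inter> {a..b}) \<union> ({c..c + L} - X0))" by (intro card_mono) (use fin in auto)
    also have "\<dots> \<le> card (X0 \<inter> {a..b}) + card ({c..c + L} - X0)" by (rule card_Un_le)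
    finally have "int (card {a..b}) \<le> int (card (X0 \<inter> {a..b})) + int (card ({c..c + L} - X0))" by linarith
    moreover have "card ({c..c + L} - X0) + card X0 = card {c..c + L}"
      using card_Diff_subset[OF fin(1) X0(2)] card_mono[OF _ X0(2)] by simp
    moreover have "int (card {c..c + L}) = L + 1" using ab r by simp
    moreover have "int (card {a..b}) = b - a + 1" using ab r by simp
    moreover have "card N = card (X0 \<inter> {a..b})" unfolding N_def by (rule card_translate)
    ultimately show ?thesis using ab X0(3) by linarith
  qed
  have XYw: "z \<in> {c + m..c + m + (L + M)}" if "z \<in> X0 + Y0" for z
    using that X0(2) Y0(2) by (force elim!: set_plus_elim)
  have Nw: "z \<in> {c + m + (L + M) + 1..<c + m + p}" if "z \<in> N" for z
    using that ab w(2) by (auto simp: N_def)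
  have finXY: "finite (X0 + Y0)" using fin by (rule finite_set_plus)
  have finN: "finite N" using fin by (simp add: N_def)
  have "card (N \<union> (X0 + Y0)) \<le> mu p (X + Y)"
  proof (rule card_le_mu[OF p per_plus[OF X]])
    fix z assume "z \<in> N \<union> (X0 + Y0)"
    moreover have "X0 + Y0 \<subseteq> X + Y" by (rule set_plus_mono2[OF X0(1) Y0(1)])
    moreover have "N \<subseteq> X + Y"
      unfolding N_def using X0(1) w(1) by (auto simp: add.commute[of w] intro: set_plus_intro)
    ultimately show "z \<in> X + Y" by blast
  next
    fix z z' assume "z \<in> N \<union> (X0 + Y0)" "z' \<in> N \<union> (X0 + Y0)" and e: "z mod p = z' mod p"
    moreover have "z \<in> {c + m..<c + m + p}" if "z \<in> N \<union> (X0 + Y0)" for z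
      using that XYw[of z] Nw[of z] LM r w(3,4) X0(3,4) ab by auto
    ultimately show "z = z'" using inj_mod_window[OF p _ _ e] by blast
  qed
  moreover have "N \<inter> (X0 + Y0) = {}" using XYw Nw by force
  ultimately have "card N + card (X0 + Y0) \<le> mu p (X + Y)" using finXY finN by (simp add: card_Un_disjoint)
  then show False using cN s by linarith
qed

text \<open>For \<open>z\<close> outside \<open>X + Y\<close>, the reflection of \<open>v\<close> to
  \<open>z - v\<close> sends the part of \<open>Y\<close> in the reflected arc into the at most
  \<open>r + 1\<close> gaps of \<open>X\<close>. The rest, \<open>Y0\<close>, fits a window in which
  sums with \<open>X0\<close> do not wrap around, so Freiman's theorem shortens it.
  \<open>far_element\<close> places the exceptional elements nearby, and a last application gives
  the sharp length.\<close>

lemma arc_transfer: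
  fixes p r :: int
  assumes p: "p > 0" and r: "r \<ge> -1" and X: "per p X" "9 * (r + 3) \<le> int (mu p X)" "arc p (int (mu p X) + r) X"
    and Y: "per p Y" "9 * (r + 3) \<le> int (mu p Y)"
    and XY: "int (mu p (X + Y)) \<le> int (mu p X) + int (mu p Y) + r" "int (mu p (X + Y)) + 9 * (r + 3) \<le> p"
  shows "arc p (int (mu p Y) + r) Y"
proof -
  define x where "x = int (mu p X)"
  define y where "y = int (mu p Y)"
  define s where "s = int (mu p (X + Y))"
  have R: "9 * (r + 3) \<le> x" "9 * (r + 3) \<le> y" "s \<le> x + y + r" "s + 9 * (r + 3) \<le> p"
    using X Y XY by (auto simp: x_def y_def s_def)
  have ne: "X \<noteq> {}" "Y \<noteq> {}" using R r by (auto simp: x_def y_def)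
  have xs: "x \<le> s" "y \<le> s"
    using mu_plus_ge[OF p X(1) Y(1) ne(1)] mu_plus_ge[OF p Y(1) X(1) ne(2)]
    by (auto simp: x_def y_def s_def add.commute)
  obtain c where c: "card (X \<inter> {c..c + (x + r)}) = mu p X"
    using arc_lift[OF p X(1) X(3)[folded x_def]] R xs r by auto
  define X0 where "X0 = X \<inter> {c..c + (x + r)}"
  have X0: "X0 \<subseteq> X" "finite X0" "X0 \<subseteq> {c..c + (x + r)}" "int (card X0) = x" "X0 \<noteq> {}"
    using c R r by (auto simp: X0_def x_def)
  have dX0: "diam_le X0 (x + r)" by (auto simp: diam_le_def X0_def)
  have sp: "spread X0 B" for B by (rule spread_of_dense[OF X0(2) dX0]) (use X0(4,5) R r in auto)
  have "X + Y \<noteq> UNIV" using R(4) r mu_UNIV[OF p] by (auto simp: s_def)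
  then obtain z where z: "z \<notin> X + Y" by auto
  define e where "e = z - c"
  define W where "W = Y \<inter> {e - (x + r)..e}"
  define Y0 where "Y0 = Y \<inter> {e + 1..e + p - (x + r) - 1}"
  have fin: "finite W" "finite Y0" by (auto simp: W_def Y0_def)
  have cW: "int (card W) \<le> r + 1"
  proof -
    have "(\<lambda>v. z - v) ` W \<subseteq> {c..c + (x + r)} - X0"
    proof
      fix u assume "u \<in> (\<lambda>v. z - v) ` W"
      then obtain v where v: "v \<in> W" "u = z - v" by blast
      have "u \<notin> X"
      proof
        assume "u \<in> X"
        then have "u + v \<in> X + Y" using v(1) by (intro set_plus_intro) (auto simp: W_def)
        then show False using z v(2) by simp
      qed
      then show "u \<in> {c..c + (x + r)} - X0" using v by (auto simp: W_def X0_def e_def)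
    qed
    then have "card ((\<lambda>v. z - v) ` W) \<le> card ({c..c + (x + r)} - X0)" by (intro card_mono) auto
    moreover have "card ((\<lambda>v. z - v) ` W) = card W" by (rule card_image) (auto simp: inj_on_def)
    moreover have "card ({c..c + (x + r)} - X0) + card X0 = card {c..c + (x + r)}"
      using card_Diff_subset[OF X0(2,3)] card_mono[OF _ X0(3)] by simp
    moreover have "int (card {c..c + (x + r)}) = x + r + 1" using R r by simp
    ultimately show ?thesis using X0(4) by linarith
  qed
  have "Y \<inter> {e - (x + r)..<e - (x + r) + p} = W \<union> Y0"
    using R xs r by (auto simp: W_def Y0_def)
  moreover have "W \<inter> Y0 = {}" by (auto simp: W_def Y0_def)
  ultimately have cY0: "y = int (card W) + int (card Y0)"
    using mu_window[OF p Y(1), of "e - (x + r)"] fin by (simp add: y_def card_Un_disjoint)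
  have Y0ne: "Y0 \<noteq> {}" using cY0 cW R r by auto
  have dY0: "diam_le Y0 (p - (x + r) - 2)" by (auto simp: diam_le_def Y0_def)
  have small0: "mu p (X + Y) + 4 \<le> 2 * card X0 + card Y0" "mu p (X + Y) + 4 \<le> card X0 + 2 * card Y0"
  proof -
    have "y \<le> int (card Y0) + r + 1" using cY0 cW by simp
    then have "s + 4 \<le> 2 * x + int (card Y0)" "s + 4 \<le> x + 2 * int (card Y0)" using R r by simp_all
    then show "mu p (X + Y) + 4 \<le> 2 * card X0 + card Y0" "mu p (X + Y) + 4 \<le> card X0 + 2 * card Y0"
      unfolding X0(4)[symmetric] s_def by simp_all
  qed
  have "card (X0 + Y0) \<le> mu p (X + Y)"
  proof (rule card_le_mu[OF p per_plus[OF X(1)]])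
    show "v \<in> X + Y" if "v \<in> X0 + Y0" for v
      using that set_plus_mono2[OF X0(1), of Y0 Y] by (auto simp: Y0_def)
    fix v v' assume v: "v \<in> X0 + Y0" "v' \<in> X0 + Y0" "v mod p = v' mod p"
    have "v \<in> {c + e + 1..<c + e + 1 + p}" if "v \<in> X0 + Y0" for v
      using that by (auto elim!: set_plus_elim simp: X0_def Y0_def)
    then show "v = v'" using inj_mod_window[OF p _ _ v(3)] v(1,2) by blast
  qed
  define s0 where "s0 = int (card (X0 + Y0))"
  have s0: "s0 \<le> s" using \<open>card (X0 + Y0) \<le> mu p (X + Y)\<close> by (simp add: s0_def s_def)
  have "diam_le Y0 (s0 - x)"
    using freiman_3k4(2)[OF X0(2) fin(2) X0(5) Y0ne sp] small0 s0 X0(4) by (simp add: s0_def s_def)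
  define m where "m = Min Y0"
  define M where "M = Max Y0 - m"
  have mM: "m \<in> Y0" "m + M \<in> Y0" "\<And>v. v \<in> Y0 \<Longrightarrow> m \<le> v \<and> v \<le> m + M"
    using fin(2) Y0ne by (auto simp: m_def M_def)
  have M: "M \<le> s0 - x" "0 \<le> M" using \<open>diam_le Y0 (s0 - x)\<close> mM by (force simp: diam_le_def)+
  have "diam_le Y0 M"
    unfolding diam_le_def
  proof (intro ballI)
    fix u v assume "u \<in> Y0" "v \<in> Y0"
    then show "u - v \<le> M" using mM(3)[of u] mM(3)[of v] by linarith
  qed
  then have cM: "int (card Y0) \<le> M + 1" by (rule card_le_diam[OF fin(2) Y0ne])
  \<comment> \<open>\<open>far_element\<close> excludes elements at distance \<open>3 r + 4\<close>
    or more on both sides.\<close>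
  define q where "q = 3 * r + 3"
  define Y1 where "Y1 = Y \<inter> {m - q..m + M + q}"
  have finY1: "finite Y1" by (simp add: Y1_def)
  have Y0Y1: "Y0 \<subseteq> Y1" using mM(3) r by (auto simp: Y1_def Y0_def q_def; force)
  have LM: "x + r + M + 8 * (r + 3) < p" using M s0 R(4) by simp
  have muY1: "mu p Y \<le> card Y1"
  proof (rule mu_le_card[OF finY1])
    fix v assume v: "v \<in> Y"
    define w where "w = m + (v - m) mod p"
    have wv: "w mod p = v mod p" by (simp add: w_def mod_simps)
    have wY: "w \<in> Y" using per_cong[OF Y(1) wv] v by simp
    have wm: "m \<le> w" "w < m + p" using p by (auto simp: w_def)
    show "\<exists>a\<in>Y1. v mod p = a mod p"
    proof (cases "w \<le> m + M + q \<or> m - q \<le> w - p")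
      case True
      then show ?thesis
      proof
        assume "w \<le> m + M + q"
        then show ?thesis using wY wm wv r by (intro bexI[of _ w]) (auto simp: Y1_def q_def)
      next
        assume "m - q \<le> w - p"
        moreover have "w - p \<in> Y" using per_add_mult[OF Y(1), of w "-1"] wY by simp
        ultimately show ?thesis using wm wv M r by (intro bexI[of _ "w - p"]) (auto simp: Y1_def q_def)
      qed
    next
      case False
      have False
      proof (rule far_element[OF p r X(1) X0(1,3) _ _ _ _ X0(2) fin(2)])
        show "x + r + 1 \<le> int (card X0) + r + 1" "9 * (r + 3) \<le> int (card X0)" using X0(4) R by auto
        show "Y0 \<subseteq> Y" by (auto simp: Y0_def)
        show "Y0 \<subseteq> {m..m + M}" using mM(3) by auto
        \<comment> \<open>From \<open>M <= s0 - x\<close>, \<open>|Y0| <= M + 1\<close> and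
          \<open>y <= |Y0| + r + 1\<close> one gets \<open>s0 >= x + y - r - 2\<close>, which is at
          most \<open>2 r + 2\<close> below \<open>x + y + r\<close>.\<close>
        show "int (mu p (X + Y)) \<le> int (card (X0 + Y0)) + 2 * r + 2"
          using M(1) cM cY0 cW R(3) unfolding s_def[symmetric] s0_def[symmetric] by simp
        show "x + r + M + 8 * (r + 3) < p" "0 \<le> M" by (rule LM, rule M)
        show "w \<in> Y" by (rule wY)
        show "w = m + M + (w - m - M)" by simp
        show "3 * r + 4 \<le> w - m - M" "3 * r + 4 \<le> p - M - (w - m - M)" using False by (auto simp: q_def)
      qed
      then show ?thesis ..
    qed
  qed
  have "diam_le Y1 (int (mu p (X + Y)) - int (card X0))"
  proof (rule freiman_rectified(2)[OF p X(1) X0(1,2,5) dX0])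
    show "Y1 \<subseteq> Y" "finite Y1" by (auto simp: Y1_def)
    show "Y1 \<noteq> {}" using Y0Y1 Y0ne by auto
    show "diam_le Y1 (M + 2 * q)" by (auto simp: diam_le_def Y1_def)
    show "x + r + (M + 2 * q) < p" using LM r by (simp add: q_def)
    show "spread X0 Y1" by (rule sp)
  qed (use muY1 R X0(4) r in \<open>simp_all add: x_def y_def s_def\<close>)
  then have "diam_le Y1 (y + r)" unfolding X0(4) s_def[symmetric] using R by (force simp: diam_le_def)
  moreover have "y + r < p" using xs R(4) r by simp
  ultimately show ?thesis unfolding y_def[symmetric]
    by (intro arcI[OF p finY1 _ _ Y(1) muY1]) (auto simp: Y1_def)
qed

section \<open>Subsets of the prime field\<close>

definition lift :: "'p::prime_card mod_ring set \<Rightarrow> int set" where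
  "lift A = {n. of_int n \<in> A}"

lemma of_int_mod_ring_eq_iff:
  "(of_int m :: 'p::prime_card mod_ring) = of_int n \<longleftrightarrow> int CARD('p) dvd m - n"
proof -
  have "(of_int m :: 'p mod_ring) = of_int n \<longleftrightarrow> (of_int (m - n) :: 'p mod_ring) = 0" by simp
  also have "\<dots> \<longleftrightarrow> int CARD('p) dvd m - n" by (simp only: of_int_eq_0_iff_char_dvd semiring_char_mod_ring)
  finally show ?thesis .
qed

lemma mod_ring_of_int: "\<exists>n. (a :: 'p::prime_card mod_ring) = of_int n"
  using surj_of_nat_mod_ring[of a] by (metis of_int_of_nat_eq)

lemma per_lift: "per (int CARD('p)) (lift (A :: 'p::prime_card mod_ring set))"
  by (simp add: per_def lift_def)

lemma mu_lift: "mu (int CARD('p)) (lift (A :: 'p::prime_card mod_ring set)) = card A"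
proof -
  have p0: "int CARD('p) > 0" using prime_card_int[where 'a = 'p] prime_gt_0_int by blast
  have "bij_betw of_int (lift A \<inter> {0..<int CARD('p)}) A"
    unfolding bij_betw_def
  proof
    show "inj_on (of_int :: int \<Rightarrow> 'p mod_ring) (lift A \<inter> {0..<int CARD('p)})"
    proof (rule inj_onI)
      fix x y assume xy: "x \<in> lift A \<inter> {0..<int CARD('p)}" "y \<in> lift A \<inter> {0..<int CARD('p)}"
        "(of_int x :: 'p mod_ring) = of_int y"
      then have "int CARD('p) dvd x - y" by (simp add: of_int_mod_ring_eq_iff)
      then have "x mod int CARD('p) = y mod int CARD('p)" unfolding mod_eq_dvd_iff .
      then show "x = y" using xy by simp
    qed
    show "of_int ` (lift A \<inter> {0..<int CARD('p)}) = A"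
    proof
      show "A \<subseteq> of_int ` (lift A \<inter> {0..<int CARD('p)})"
      proof
        fix a assume a: "a \<in> A"
        obtain n where n: "a = of_int n" using mod_ring_of_int by blast
        have "(of_int (n mod int CARD('p)) :: 'p mod_ring) = of_int n"
          unfolding of_int_mod_ring_eq_iff by (simp add: mod_eq_dvd_iff[symmetric])
        then show "a \<in> of_int ` (lift A \<inter> {0..<int CARD('p)})"
          using a n p0 by (intro rev_image_eqI[of "n mod int CARD('p)"]) (auto simp: lift_def)
      qed
    qed (auto simp: lift_def)
  qed
  then show ?thesis unfolding mu_def by (rule bij_betw_same_card)
qed

lemma lift_plus: "lift (A + B) = lift A + lift (B :: 'p::prime_card mod_ring set)"
proof (rule Set.set_eqI)
  fix n show "n \<in> lift (A + B) \<longleftrightarrow> n \<in> lift A + lift B"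
  proof
    assume "n \<in> lift (A + B)"
    then obtain a b where ab: "a \<in> A" "b \<in> B" "of_int n = a + b" by (auto simp: lift_def elim!: set_plus_elim)
    obtain i where i: "a = of_int i" using mod_ring_of_int by blast
    have "of_int (n - i) = b" using ab(3) i by simp
    then have "i + (n - i) \<in> lift A + lift B" using ab i by (intro set_plus_intro) (auto simp: lift_def)
    then show "n \<in> lift A + lift B" by simp
  next
    assume "n \<in> lift A + lift B"
    then obtain i j where "i \<in> lift A" "j \<in> lift B" "n = i + j" by (auto elim!: set_plus_elim)
    then show "n \<in> lift (A + B)" by (auto simp: lift_def intro: set_plus_intro)
  qed
qed

lemma lift_neg_compl: "lift (uminus ` (UNIV - S)) = uminus ` (- lift (S :: 'p::prime_card mod_ring set))"
proof (rule Set.set_eqI)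
  fix n
  have "of_int n \<in> uminus ` (UNIV - S) \<longleftrightarrow> - of_int n \<notin> S" by (metis Diff_iff UNIV_I add.inverse_inverse image_iff)
  then show "n \<in> lift (uminus ` (UNIV - S)) \<longleftrightarrow> n \<in> uminus ` (- lift S)"
    unfolding mem_uminus by (simp add: lift_def)
qed

lemma progression_of_arc:
  fixes A :: "'p::prime_card mod_ring set" and r :: int
  assumes u: "\<not> int CARD('p) dvd u" and arc: "arc (int CARD('p)) (int (card A) + r) (aff c u (lift A))"
    and r: "0 \<le> int (card A) + r"
  obtains P where "arith_progression (of_int u) P" "A \<subseteq> P" "int (card P) \<le> int (card A) + r + 1"
proof -
  let ?p = "int CARD('p)"
  have p: "prime ?p" by (rule prime_card_int)
  obtain e where e: "\<And>z. z \<in> aff c u (lift A) \<Longrightarrow> (z - e) mod ?p \<le> int (card A) + r"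
    using arc by (auto simp: arc_def)
  define n where "n = nat (int (card A) + r + 1)"
  define b :: "'p mod_ring" where "b = of_int (c + u * e)"
  define P where "P = (\<lambda>i. b + of_nat i * of_int u) ` {0..n - 1}"
  have n1: "n \<ge> 1" using r by (simp add: n_def)
  obtain v where v: "?p dvd u * v - 1" by (rule prime_inverse[OF p u])
  have "A \<subseteq> P"
  proof
    fix a assume a: "a \<in> A"
    obtain x where x: "a = of_int x" using mod_ring_of_int by blast
    define z where "z = v * (x - c)"
    have "c + u * z - x = (u * v - 1) * (x - c)" by (simp add: z_def algebra_simps)
    then have "?p dvd c + u * z - x" using v by simp
    then have az: "a = of_int (c + u * z)" using x of_int_mod_ring_eq_iff[of "c + u * z" x] by metis
    then have "z \<in> aff c u (lift A)" using a by (simp add: aff_def lift_def)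
    define i where "i = (z - e) mod ?p"
    have i: "0 \<le> i" "i \<le> int (card A) + r"
      using e[OF \<open>z \<in> aff c u (lift A)\<close>] prime_gt_0_int[OF p] by (auto simp: i_def)
    have "?p dvd i - (z - e)" by (simp add: i_def mod_eq_dvd_iff[symmetric])
    then have "?p dvd u * (i - (z - e))" by simp
    moreover have "u * (i - (z - e)) = (c + u * e + i * u) - (c + u * z)" by (simp add: algebra_simps)
    ultimately have "a = of_int (c + u * e + i * u)" unfolding az of_int_mod_ring_eq_iff
      by (metis dvd_diff_commute)
    also have "\<dots> = b + of_nat (nat i) * of_int u" using i(1) by (simp add: b_def)
    finally show "a \<in> P" unfolding P_def using i by (intro rev_image_eqI[of "nat i"]) (auto simp: n_def)
  qed
  moreover have "card P \<le> n" unfolding P_def using card_image_le[of "{0..n - 1}"] n1 by fastforce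
  then have "int (card P) \<le> int (card A) + r + 1" using r by (simp add: n_def)
  moreover have "arith_progression (of_int u) P" unfolding arith_progression_def P_def using n1 by blast
  ultimately show thesis using that by blast
qed

section \<open>From atoms back to A, B and C\<close>

theorem theorem3p5:
  fixes A B C :: "'p::prime_card mod_ring set"
    and p :: nat
    and r :: int
  assumes p: "p = CARD('p)"
    and A: "A \<noteq> {}"
    and B: "B \<noteq> {}"
    and AB: "A + B \<noteq> UNIV"
    and C: "C = uminus ` (UNIV - (A + B))"
    and r: "int (card (A + B)) = int (card A) + int (card B) + r"
    and card_le: "card A \<ge> card B"
    and p_large: "9253 / 1963 * (10 * real_of_int r + 26.5 + sqrt (2 * real_of_int r + 17 / 4))
                    \<le> real p"
    and small: "real (card (A + B))
                  \<le> min (real (card A) + (1 + 1 / 9) * real (card B) - 3)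
                        (real p - 9 * (real_of_int r + 3))"
  shows "\<exists>d P\<^sub>A P\<^sub>B P\<^sub>C.
           arith_progression d P\<^sub>A \<and> arith_progression d P\<^sub>B \<and> arith_progression d P\<^sub>C \<and>
           A \<subseteq> P\<^sub>A \<and> int (card P\<^sub>A) \<le> int (card A) + r + 1 \<and>
           B \<subseteq> P\<^sub>B \<and> int (card P\<^sub>B) \<le> int (card B) + r + 1 \<and>
           C \<subseteq> P\<^sub>C \<and> int (card P\<^sub>C) \<le> int (card C) + r + 1"
proof -
  have pr: "prime (int p)" unfolding p by (rule prime_card_int)
  have p0: "int p > 0" using pr prime_gt_0_int by blast
  define X where "X = lift A"
  define Y where "Y = lift B"
  define Z where "Z = lift C"
  have per: "per (int p) X" "per (int p) Y" "per (int p) Z"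
    unfolding X_def Y_def Z_def p by (rule per_lift)+
  have mu: "mu (int p) X = card A" "mu (int p) Y = card B" "mu (int p) Z = card C"
    unfolding X_def Y_def Z_def p by (rule mu_lift)+
  have XY: "X + Y = lift (A + B)" by (simp add: X_def Y_def lift_plus)
  have muXY: "mu (int p) (X + Y) = card (A + B)" unfolding XY p by (rule mu_lift)
  have Zd: "Z = uminus ` (- (X + Y))" unfolding Z_def XY C by (rule lift_neg_compl)
  have ne: "X \<noteq> {}" "Y \<noteq> {}" using A B mu_pos_iff[OF p0] per mu by (auto simp: card_gt_0_iff)
  have "card (A + B) < CARD('p)"
    using AB psubset_card_mono[of UNIV "A + B"] by auto
  then have "X + Y \<noteq> UNIV" using muXY mu_UNIV[OF p0] p by auto
  then have "card A + card B \<le> card (A + B) + 1"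
    using cauchy_davenport[OF pr per(1) ne(1) per(2) ne(2)] mu muXY by simp
  then have r1: "r \<ge> -1" using r by simp
  \<comment> \<open>Cancelling \<open>|A| + |B|\<close> in the first bound on \<open>|A + B|\<close>
    leaves \<open>r + 3 <= |B| / 9\<close>.\<close>
  have "9 * (real_of_int r + 3) \<le> real (card B)"
  proof -
    have "real_of_int (int (card (A + B))) = real (card A) + real (card B) + real_of_int r" unfolding r by simp
    then show ?thesis using small by simp
  qed
  then have "real_of_int (9 * (r + 3)) \<le> real_of_int (int (card B))" by simp
  then have cB: "9 * (r + 3) \<le> int (card B)" by (simp only: of_int_le_iff)
  have cA: "9 * (r + 3) \<le> int (card A)" using cB card_le by simp
  have "real_of_int (int (card (A + B)) + 9 * (r + 3)) \<le> real_of_int (int p)" using small by simp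
  then have cC: "int (card (A + B)) + 9 * (r + 3) \<le> int p" by (simp only: of_int_le_iff)
  \<comment> \<open>The root is at least its value \<open>3 / 2\<close> at \<open>r = -1\<close>,
    which turns \<open>26.5\<close> into \<open>28\<close>; the rest is
    \<open>9253 / 1963 > 47 / 10\<close>.\<close>
  have p47: "real p \<ge> 47 * real_of_int (r + 3) - 10"
  proof -
    have "3 / 2 \<le> sqrt (2 * real_of_int r + 17 / 4)"
      using r1 by (intro real_le_rsqrt) (auto simp: power2_eq_square)
    then have "9253 / 1963 * (10 * real_of_int r + 28) \<le> real p" using p_large by simp
    then show ?thesis using r1 by simp
  qed
  define k where "k = nat (9 * (r + 3))"
  have k: "int k = 9 * (r + 3)" "k \<ge> 1" "k \<ge> 2" using r1 by (auto simp: k_def)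
  have adm1: "admissible (int p) k Y X" using per cA cC mu muXY k by (simp add: admissible_def)
  obtain V where V: "admissible (int p) k Y V"
    "\<And>X'. admissible (int p) k Y X' \<Longrightarrow> mu (int p) (V + Y) + mu (int p) X' \<le> mu (int p) (X' + Y) + mu (int p) V"
    "\<And>d. (+) d ` V = V \<or> mu (int p) (V \<inter> (+) d ` V) < k"
    using atom_exists[OF p0 per(2) adm1 k(2)] by blast
  have perV: "per (int p) V" and kV: "9 * (r + 3) \<le> int (mu (int p) V)" and VYp: "int (mu (int p) (V + Y)) + 9 * (r + 3) \<le> int p"
    using V(1) k by (auto simp: admissible_def)
  have VY: "int (mu (int p) (V + Y)) \<le> int (mu (int p) V) + int (mu (int p) Y) + r"
    using V(2)[OF adm1] r muXY mu by simp
  have Vat: "(+) d ` V = V \<or> int (mu (int p) (V \<inter> (+) d ` V)) < 9 * (r + 3)" for d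
    using V(3)[of d] k(1) by auto
  have sizeV: "int (mu (int p) V) \<le> 11 * (r + 3) - 1"
    by (rule atom_size[OF pr r1 perV kV Vat per(2) _ VY]) (use cB mu VYp r1 in auto)
  \<comment> \<open>\<open>Y\<close> competes with the atom \<open>W\<close> of \<open>V\<close>, so
    \<open>(W, V)\<close> again has excess at most \<open>r\<close>, and now both sets are
    small.\<close>
  have adm2: "admissible (int p) k V Y" using per(2) cB mu VYp k by (simp add: admissible_def add.commute)
  obtain W where W: "admissible (int p) k V W"
    "\<And>X'. admissible (int p) k V X' \<Longrightarrow> mu (int p) (W + V) + mu (int p) X' \<le> mu (int p) (X' + V) + mu (int p) W"
    "\<And>d. (+) d ` W = W \<or> mu (int p) (W \<inter> (+) d ` W) < k"
    using atom_exists[OF p0 perV adm2 k(2)] by blast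
  have perW: "per (int p) W" and kW: "9 * (r + 3) \<le> int (mu (int p) W)" and WVp: "int (mu (int p) (W + V)) + 9 * (r + 3) \<le> int p"
    using W(1) k by (auto simp: admissible_def)
  have WV: "int (mu (int p) (W + V)) \<le> int (mu (int p) W) + int (mu (int p) V) + r"
    using W(2)[OF adm2] VY by (simp add: add.commute[of Y])
  have Wat: "(+) d ` W = W \<or> int (mu (int p) (W \<inter> (+) d ` W)) < 9 * (r + 3)" for d
    using W(3)[of d] k(1) by auto
  have sizeW: "int (mu (int p) W) \<le> 11 * (r + 3) - 1"
    by (rule atom_size[OF pr r1 perW kW Wat perV _ WV]) (use kV WVp r1 in auto)
  have "int (mu (int p) (V + W)) \<le> int (mu (int p) V) + int (mu (int p) W) + r"
    using WV by (simp add: add.commute[of V])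
  then obtain u where u: "\<not> int p dvd u" and "arc_along (int p) u (int (mu (int p) V) + r) V"
    by (rule small_pair_arc_along[OF pr p47 r1 perV kV sizeV perW kW sizeW])
  then obtain c where arcV: "arc (int p) (int (mu (int p) V) + r) (aff c u V)" by (auto simp: arc_along_def)
  \<comment> \<open>Every transfer keeps the same \<open>u\<close>, which becomes the common
    difference.\<close>
  have transfer: "arc (int p) (int (mu (int p) T) + r) (aff 0 u T)"
    if S: "per (int p) S" "9 * (r + 3) \<le> int (mu (int p) S)" "arc (int p) (int (mu (int p) S) + r) (aff c u S)"
      and T: "per (int p) T" "9 * (r + 3) \<le> int (mu (int p) T)"
      and ST: "int (mu (int p) (S + T)) \<le> int (mu (int p) S) + int (mu (int p) T) + r"
        "int (mu (int p) (S + T)) + 9 * (r + 3) \<le> int p" for S T c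
  proof -
    note mua = mu_aff[OF pr u]
    have e: "aff c u S + aff 0 u T = aff (c + 0) u (S + T)" by (rule aff_plus[OF pr u S(1) T(1)])
    have "arc (int p) (int (mu (int p) (aff 0 u T)) + r) (aff 0 u T)"
      by (rule arc_transfer[OF p0 r1 per_aff[OF S(1), of c u]])
        (use S T ST in \<open>simp_all add: e mua per_aff per_plus\<close>)
    then show ?thesis by (simp add: mua T(1))
  qed
  have arcY: "arc (int p) (int (card B) + r) (aff 0 u Y)"
    using transfer[OF perV kV arcV per(2)] cB mu VY VYp by simp
  have arcX: "arc (int p) (int (card A) + r) (aff 0 u X)"
    using transfer[OF per(2) _ _ per(1), of 0] arcY cA cB cC mu muXY r by (simp add: add.commute[of Y])
  have muZ: "int (card C) = int p - int (card (A + B))"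
    unfolding mu(3)[symmetric] muXY[symmetric] Zd
    by (simp add: mu_uminus[OF p0 per_Compl[OF per_plus[OF per(1)]]] mu_Compl[OF p0])
  \<comment> \<open>By duality \<open>|B + C| <= p - |A|\<close>, and
    \<open>p - |A| = |B| + |C| + r\<close>, so \<open>(B, C)\<close> satisfies the hypotheses of the
    transfer with the same \<open>r\<close>.\<close>
  have "Z + Y \<subseteq> - uminus ` X" unfolding Zd by (rule dual_sumset)
  then have "mu (int p) (Z + Y) \<le> mu (int p) (- uminus ` X)" by (rule mu_mono)
  then have muZY: "int (mu (int p) (Y + Z)) \<le> int p - int (card A)"
    using mu_Compl[OF p0, of "uminus ` X"] mu_uminus[OF p0 per(1)] mu by (simp add: add.commute[of Y])
  have arcZ: "arc (int p) (int (card C) + r) (aff 0 u Z)"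
    using transfer[OF per(2) _ _ per(3), of 0] arcY cA cB cC mu muZ muZY r by simp
  have pos: "0 \<le> int (card A) + r" "0 \<le> int (card B) + r" "0 \<le> int (card C) + r"
    using cA cB cC muZ r1 by auto
  note prog = progression_of_arc[OF u[unfolded p]]
  obtain PA where "arith_progression (of_int u) PA" "A \<subseteq> PA" "int (card PA) \<le> int (card A) + r + 1"
    using prog[of A r 0] arcX pos by (auto simp: X_def p)
  moreover obtain PB where "arith_progression (of_int u) PB" "B \<subseteq> PB" "int (card PB) \<le> int (card B) + r + 1"
    using prog[of B r 0] arcY pos by (auto simp: Y_def p)
  moreover obtain PC where "arith_progression (of_int u) PC" "C \<subseteq> PC" "int (card PC) \<le> int (card C) + r + 1"
    using prog[of C r 0] arcZ pos by (auto simp: Z_def p)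
  ultimately show ?thesis by blast
qed

end
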